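(* Let $W$ be a compact closed oriented $3$-manifold and $\rho$ a flat principal $PSL(2,\mathbb{C})$-bundle over $W$. Denote by $\mathcal{I}$ the idealization map $\mathcal{T}\mapsto\mathcal{T}_{\mathcal{I}}$ on the $\mathcal{D}$-triangulations for $(W,\rho)$. For any $\mathcal{D}$-transit $\mathfrak{d}$ there exists an $\mathcal{I}$-transit $\mathfrak{i}$ such that $\mathfrak{i}\circ\mathcal{I}=\mathcal{I}\circ\mathfrak{d}$; and for any $\mathcal{I}$-transit $\mathfrak{i}$ there exists a $\mathcal{D}$-transit $\mathfrak{d}$ such that $\mathfrak{i}\circ\mathcal{I}=\mathcal{I}\circ\mathfrak{d}$. (That is: if $\mathfrak{d}:\mathcal{T}\to\mathcal{T}'$ is a $\mathcal{D}$-transit then there is an $\mathcal{I}$-transit $\mathcal{T}_{\mathcal{I}}\to\mathcal{T}'_{\mathcal{I}}$; and every $\mathcal{I}$-transit between $\mathcal{I}$-triangulations for $(W,\rho)$ is obtained in this way from some $\mathcal{D}$-transit between $\mathcal{D}$-triangulations whose idealizations are its source and target.)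
   Context: Triangulations. A triangulation $T$ of $W$ is a singular triangulation: a finite family of oriented abstract tetrahedra (with the orientation of $W$) with identifications of pairs of distinct abstract $2$-faces, with quotient $W$; self-adjacencies and multiple adjacencies are allowed. $E(T)$ is the set of edges of $T$ (after identification), $E_\Delta(T)$ the set of all edges of the abstract tetrahedra, $\epsilon_T:E_\Delta(T)\to E(T)$ the identification map. $T$ is quasi-regular if every edge of $T$ has two distinct endpoints. Branchings. A branching $b$ of $T$ is a choice of orientation for each edge of $T$ which on every abstract tetrahedron comes from a total ordering $v_0,v_1,v_2,v_3$ of its vertices, each edge pointing from its smaller to its larger endpoint. Put $e_0=[v_0,v_1]$, $e_1=[v_1,v_2]$, $e_2=[v_0,v_2]$, and let $e'_j$ be the edge opposite to $e_j$. The index $*=*_b$ of the tetrahedron is $1$ if the orientation given by the ordered triple $([v_0,v_1],[v_0,v_2],[v_0,v_3])$ agrees with that of $W$, and $-1$ otherwise. Cocycles. A $PSL(2,\mathbb{C})$-valued $1$-cocycle $z$ on $T$ assigns $z(e)\in PSL(2,\mathbb{C})$ to each oriented edge, with $z(-e)=z(e)^{-1}$ and $z([x,y])z([y,t])=z([x,t])$ on each $2$-face with vertices $x,y,t$. Two cocycles are equivalent if they differ by $z'(e)=\lambda(v)^{-1}z(e)\lambda(v')$ ($e$ from $v$ to $v'$) for some $PSL(2,\mathbb{C})$-valued function $\lambda$ on the vertices; equivalence classes correspond to isomorphism classes of flat principal $PSL(2,\mathbb{C})$-bundles on $W$. Idealization. $PSL(2,\mathbb{C})$ acts on $\mathbb{CP}^1$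 by Moebius transformations. On a branched tetrahedron with cocycle $z$ write $z_j=z(e_j)$, $z'_j=z(e'_j)$. It is idealizable if $u_0=0$, $u_1=z_0(0)$, $u_2=z_0z_1(0)$, $u_3=z_0z_1z'_0(0)$ are $4$ distinct points of $\mathbb{C}$. Then put $p_0=u_1(u_3-u_2)$, $p_1=(u_2-u_1)u_3$, $p_2=-u_2(u_3-u_1)$, $w_j=-p_{j+1}/p_{j+2}$ (indices mod $3$), $w(e_j)=w(e'_j)=w_j\in\mathbb{C}\setminus\{0,1\}$. A $\mathcal{D}$-triangulation for $(W,\rho)$ is $\mathcal{T}=(T,b,z)$ with $T$ quasi-regular, $b$ a branching, $z$ a $1$-cocycle representing $\rho$ such that all abstract tetrahedra are idealizable; its idealization is $\mathcal{T}_{\mathcal{I}}=(T,b,w)$. The triples $\mathcal{T}_{\mathcal{I}}$ arising this way are the $\mathcal{I}$-triangulations for $(W,\rho)$. Moves. $2\to3$: replace two tetrahedra with a common $2$-face $f$ by three tetrahedra sharing a new edge joining the two vertices opposite to $f$. $0\to2$: replace two $2$-faces adjacent along an edge by two tetrahedra glued along two faces (sharing a new edge), the other faces matching the two former ones. Bubble: replace a $2$-face by two tetrahedra glued along three faces (sharing a new vertex). The inverses are the negative moves. All moves are required to be quasi-regular (source and target triangulations are quasi-regular) and to carry a branching transit: branchings on source and target that agree on common edges. $\mathcal{D}$-transits. A $\mathcal{D}$-transit $(T_0,b_0,z_0)\leftrightarrow(T_1,b_1,z_1)$ is a quasi-regular branching transit such that $z_0$ and $z_1$ are idealizable and agree on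 the common edges of $T_0$ and $T_1$. $\mathcal{I}$-transits. For a move $T\to T'$ let $\widetilde E(T)\subset E_\Delta(T)$, $\widetilde E(T')\subset E_\Delta(T')$ be the edges of the abstract tetrahedra involved in the move, and $\widehat E(T)=E_\Delta(T)\setminus\widetilde E(T)$, $\widehat E(T')=E_\Delta(T')\setminus\widetilde E(T')$, which are naturally identified. A $2\to3$ $\mathcal{I}$-transit $(T,b,w)\to(T',b',w')$ of $\mathcal{I}$-triangulations for $(W,\rho)$ is one (supported by a quasi-regular branching transit) such that $w=w'$ on $\widehat E(T)=\widehat E(T')$ and, for each common edge $e\in\epsilon_T(\widetilde E(T))\cap\epsilon_{T'}(\widetilde E(T'))$, $\prod_{a\in\epsilon_T^{-1}(e)}w(a)^*=\prod_{a'\in\epsilon_{T'}^{-1}(e)}w'(a')^*$, where $*$ is the index of the tetrahedron containing $a$ (resp. $a'$). For $0\to2$ and positive bubble moves, the second condition is replaced by: for each $e\in\epsilon_{T'}(\widetilde E(T'))$, $\prod_{a'\in\epsilon_{T'}^{-1}(e)}w'(a')^*=1$ (this means that the two new tetrahedra have the same modular triples). $3\to2$ $\mathcal{I}$-transits are defined like $2\to3$ ones; for negative $2\to0$ and bubble moves $w'$ is obtained by forgetting the moduli of the two disappearing tetrahedra. *)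

theory Defs
  imports
    "HOL-Analysis.Analysis"
    "HOL-Combinatorics.Permutations"
    "HOL-Homology.Homology"
begin

section \<open>The group PSL(2,C) and its action on the Riemann sphere\<close>

quotient_type psl2 = "complex^2^2" / partial:
  "\<lambda>A B. det A = 1 \<and> det B = 1 \<and> (A = B \<or> A = - B)"
  morphisms rep_psl2 abs_psl2
proof (rule part_equivpI)
  show "\<exists>A::complex^2^2. det A = 1 \<and> det A = 1 \<and> (A = A \<or> A = - A)"
    by (rule exI[of _ "mat 1"]) simp
  show "symp (\<lambda>A B::complex^2^2. det A = 1 \<and> det B = 1 \<and> (A = B \<or> A = - B))"
    by (auto simp: symp_def)
  show "transp (\<lambda>A B::complex^2^2. det A = 1 \<and> det B = 1 \<and> (A = B \<or> A = - B))"
    by (auto simp: transp_def)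
qed

definition adjugate2 :: "complex^2^2 \<Rightarrow> complex^2^2" where
  "adjugate2 A = vector [vector [A$2$2, - A$1$2], vector [- A$2$1, A$1$1]]"

lemma mat2_eq_iff:
  "(A::complex^2^2) = B \<longleftrightarrow>
     A$1$1 = B$1$1 \<and> A$1$2 = B$1$2 \<and> A$2$1 = B$2$1 \<and> A$2$2 = B$2$2"
  by (auto simp: vec_eq_iff forall_2)

lemma mat2_mult_nth:
  "((A::complex^2^2) ** B) $ i $ j = A$i$1 * B$1$j + A$i$2 * B$2$j"
  by (simp add: matrix_matrix_mult_def sum_2)

lemma mat2_one_nth:
  "(mat 1 :: complex^2^2)$1$1 = 1" "(mat 1 :: complex^2^2)$1$2 = 0"
  "(mat 1 :: complex^2^2)$2$1 = 0" "(mat 1 :: complex^2^2)$2$2 = 1"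
  by (simp_all add: mat_def)

lemma adjugate2_nth:
  "adjugate2 A $1$1 = A$2$2" "adjugate2 A $1$2 = - A$1$2"
  "adjugate2 A $2$1 = - A$2$1" "adjugate2 A $2$2 = A$1$1"
  by (simp_all add: adjugate2_def)

instantiation psl2 :: "{monoid_mult, inverse}"
begin

lift_definition times_psl2 :: "psl2 \<Rightarrow> psl2 \<Rightarrow> psl2" is "(**)"
  by (auto simp: det_mul mat2_eq_iff mat2_mult_nth)

lift_definition one_psl2 :: psl2 is "mat 1"
  by simp

lift_definition inverse_psl2 :: "psl2 \<Rightarrow> psl2" is adjugate2
  by (auto simp: det_2 mat2_eq_iff adjugate2_nth algebra_simps)

definition divide_psl2 :: "psl2 \<Rightarrow> psl2 \<Rightarrow> psl2" where
  "divide_psl2 g h = g * inverse h"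

instance
proof
  fix a b c :: psl2
  show "a * b * c = a * (b * c)"
    by transfer (simp add: matrix_mul_assoc det_mul)
  show "1 * a = a"
    by transfer simp
  show "a * 1 = a"
    by transfer simp
qed

end

lemma psl2_left_inverse: "inverse g * g = (1::psl2)"
  by transfer (auto simp: det_2 mat2_eq_iff mat2_mult_nth mat2_one_nth adjugate2_nth algebra_simps)

lemma psl2_right_inverse: "g * inverse g = (1::psl2)"
  by transfer (auto simp: det_2 mat2_eq_iff mat2_mult_nth mat2_one_nth adjugate2_nth algebra_simps)

datatype cp1 = Aff (aff: complex) | Infty

definition moebius_mat :: "complex^2^2 \<Rightarrow> cp1 \<Rightarrow> cp1" where
  "moebius_mat A x = (case x of
      Aff u \<Rightarrow> if A$2$1 * u + A$2$2 = 0 then Infty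
               else Aff ((A$1$1 * u + A$1$2) / (A$2$1 * u + A$2$2))
    | Infty \<Rightarrow> if A$2$1 = 0 then Infty else Aff (A$1$1 / A$2$1))"

lemma moebius_mat_uminus: "moebius_mat (- A) x = moebius_mat A x"
proof (cases x)
  case (Aff u)
  have "- (A$2$1 * u) - A$2$2 = - (A$2$1 * u + A$2$2)"
    "- (A$1$1 * u) - A$1$2 = - (A$1$1 * u + A$1$2)" by simp_all
  then show ?thesis using Aff
    by (simp only: moebius_mat_def cp1.case vector_uminus_component mult_minus_left
        add_uminus_conv_diff minus_divide_divide neg_equal_0_iff_equal)
qed (simp add: moebius_mat_def)

lift_definition moebius :: "psl2 \<Rightarrow> cp1 \<Rightarrow> cp1" is moebius_mat
  by (auto simp: moebius_mat_uminus)

lemma moebius_mat_mult: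
  assumes "det A = 1" "det B = 1"
  shows "moebius_mat (A ** B) x = moebius_mat A (moebius_mat B x)"
proof -
  have a: "A$1$1 * A$2$2 - A$1$2 * A$2$1 = 1" and b: "B$1$1 * B$2$2 - B$1$2 * B$2$1 = 1"
    using assms by (simp_all add: det_2)
  define M where "M = (\<lambda>(C::complex^2^2) p q.
    if C$2$1 * p + C$2$2 * q = 0 then Infty
    else Aff ((C$1$1 * p + C$1$2 * q) / (C$2$1 * p + C$2$2 * q)))"
  have scale: "M C (p * k) (q * k) = M C p q" if "k \<noteq> 0" for C p q k
  proof -
    have "C$2$1 * (p * k) + C$2$2 * (q * k) = (C$2$1 * p + C$2$2 * q) * k"
      "C$1$1 * (p * k) + C$1$2 * (q * k) = (C$1$1 * p + C$1$2 * q) * k"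
      by (simp_all add: algebra_simps)
    then show ?thesis using that by (simp add: M_def)
  qed
  have step: "M (A ** B) p q = moebius_mat A (M B p q)" if "p \<noteq> 0 \<or> q \<noteq> 0" for p q
  proof -
    define p' q' where "p' = B$1$1 * p + B$1$2 * q" and "q' = B$2$1 * p + B$2$2 * q"
    have e: "M (A ** B) p q = M A p' q'"
      by (simp add: M_def p'_def q'_def mat2_mult_nth algebra_simps)
    have "B$2$2 * p' - B$1$2 * q' = (B$1$1 * B$2$2 - B$1$2 * B$2$1) * p"
      "B$1$1 * q' - B$2$1 * p' = (B$1$1 * B$2$2 - B$1$2 * B$2$1) * q"
      by (simp_all add: p'_def q'_def algebra_simps)
    then have "p' \<noteq> 0 \<or> q' \<noteq> 0" using that b by auto
    show ?thesis
    proof (cases "q' = 0")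
      case True
      then have "p' \<noteq> 0" using \<open>p' \<noteq> 0 \<or> q' \<noteq> 0\<close> by simp
      then have "M A p' q' = moebius_mat A Infty"
        using True by (simp add: M_def moebius_mat_def)
      moreover have "M B p q = Infty" using True by (simp add: M_def q'_def)
      ultimately show ?thesis using e by simp
    next
      case False
      have "M A p' q' = M A (p' / q') 1"
        using scale[of q' A "p' / q'" 1] False by simp
      also have "\<dots> = moebius_mat A (Aff (p' / q'))"
        by (simp add: M_def moebius_mat_def)
      also have "Aff (p' / q') = M B p q"
        using False by (simp add: M_def p'_def q'_def)
      finally show ?thesis using e by simp
    qed
  qed
  have "moebius_mat C x = (case x of Aff u \<Rightarrow> M C u 1 | Infty \<Rightarrow> M C 1 0)" for C
    by (simp add: M_def moebius_mat_def split: cp1.split)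
  then show ?thesis using step[of _ 1] step[of 1 0] by (cases x) simp_all
qed

lemma moebius_mult: "moebius (g * h) x = moebius g (moebius h x)"
  by transfer (simp add: moebius_mat_mult)

section \<open>Closed oriented 3-manifolds and flat bundles\<close>

definition closed_3_manifold :: "'w topology \<Rightarrow> bool" where
  "closed_3_manifold W \<longleftrightarrow> compact_space W \<and> Hausdorff_space W \<and>
     (\<forall>x\<in>topspace W. \<exists>U. openin W U \<and> x \<in> U \<and>
        subtopology W U homeomorphic_space Euclidean_space 3)"

type_synonym 'w orientation = "'w \<Rightarrow> 'w chain set"

abbreviation local_homology :: "'w topology \<Rightarrow> 'w \<Rightarrow> 'w chain set monoid" where
  "local_homology W x \<equiv> relative_homology_group 3 W (topspace W - {x})"

definition orientation_of :: "'w topology \<Rightarrow> 'w orientation \<Rightarrow> bool" where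
  "orientation_of W \<omega> \<longleftrightarrow>
     (\<forall>x\<in>topspace W. \<omega> x \<in> carrier (local_homology W x) \<and>
        generate (local_homology W x) {\<omega> x} = carrier (local_homology W x)) \<and>
     (\<forall>x\<in>topspace W. \<exists>U. openin W U \<and> x \<in> U \<and>
        (\<exists>\<mu>\<in>carrier (relative_homology_group 3 W (topspace W - U)).
           \<forall>y\<in>U. hom_induced 3 W (topspace W - U) W (topspace W - {y}) id \<mu> = \<omega> y))"

text \<open>A flat principal bundle is a principal bundle whose structure group is PSL(2,C) with the
  discrete topology (locally constant transition functions): local trivialisations are
  homeomorphisms for the product of the base with a discrete fibre, equivariant for the right
  action. Parallel transport is lifting of paths to such a total space.\<close>

record ('w, 'p) psl2_bundle =
  total :: "'p topology"
  action :: "'p \<Rightarrow> psl2 \<Rightarrow> 'p"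
  proj :: "'p \<Rightarrow> 'w"

definition flat_psl2_bundle :: "'w topology \<Rightarrow> ('w, 'p) psl2_bundle \<Rightarrow> bool" where
  "flat_psl2_bundle W \<rho> \<longleftrightarrow>
     (\<forall>y\<in>topspace (total \<rho>). proj \<rho> y \<in> topspace W \<and> action \<rho> y 1 = y \<and>
        (\<forall>g. action \<rho> y g \<in> topspace (total \<rho>) \<and> proj \<rho> (action \<rho> y g) = proj \<rho> y) \<and>
        (\<forall>g h. action \<rho> (action \<rho> y g) h = action \<rho> y (g * h))) \<and>
     (\<forall>x\<in>topspace W. \<exists>U \<phi>. openin W U \<and> x \<in> U \<and>
        homeomorphic_map (prod_topology (subtopology W U) (discrete_topology UNIV))
          (subtopology (total \<rho>) {y \<in> topspace (total \<rho>). proj \<rho> y \<in> U}) \<phi> \<and>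
        (\<forall>y\<in>U. \<forall>g h. proj \<rho> (\<phi> (y, g)) = y \<and>
           action \<rho> (\<phi> (y, g)) h = \<phi> (y, g * h)))"

section \<open>Singular triangulations\<close>

text \<open>The vertices of every abstract tetrahedron are numbered 0,1,2,3, compatibly with its
  orientation. A marked face (t,a,b,c) is the abstract 2-face of t with vertices a,b,c, listed in
  this order, and \<open>glue T (t,a,b,c) = (t',a',b',c')\<close> says that this face is identified with the face
  a',b',c' of t' by the affine map sending a, b, c to a', b', c'. The characteristic map of t,
  defined on the standard 3-simplex, is \<open>chart T t\<close>.\<close>

type_synonym 't mface = "'t \<times> nat \<times> nat \<times> nat"

record ('t, 'w) triangulation =
  tets :: "'t set"
  glue :: "'t mface \<Rightarrow> 't mface"
  chart :: "'t \<Rightarrow> (nat \<Rightarrow> real) \<Rightarrow> 'w"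

definition mfaces :: "('t, 'w) triangulation \<Rightarrow> 't mface set" where
  "mfaces T = {(t, a, b, c). t \<in> tets T \<and> {a, b, c} \<subseteq> {..<4} \<and> distinct [a, b, c]}"

fun unmark :: "'t mface \<Rightarrow> 't \<times> nat set" where
  "unmark (t, a, b, c) = (t, {a, b, c})"

text \<open>The last condition says that the identifications reverse the induced orientations, that is,
  the orientations of the abstract tetrahedra fit together.\<close>

definition gluing :: "('t, 'w) triangulation \<Rightarrow> bool" where
  "gluing T \<longleftrightarrow> finite (tets T) \<and>
     (\<forall>q\<in>mfaces T. glue T q \<in> mfaces T \<and> glue T (glue T q) = q \<and> unmark (glue T q) \<noteq> unmark q) \<and>
     (\<forall>t a b c t' a' b' c'. (t, a, b, c) \<in> mfaces T \<and> glue T (t, a, b, c) = (t', a', b', c') \<longrightarrow>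
        glue T (t, b, a, c) = (t', b', a', c') \<and>
        glue T (t, b, c, a) = (t', b', c', a') \<and>
        (\<exists>\<pi>. \<pi> permutes {..<4} \<and> sign \<pi> = - 1 \<and> \<pi> a = a' \<and> \<pi> b = b' \<and> \<pi> c = c'))"

definition point_glue ::
    "('t, 'w) triangulation \<Rightarrow> (('t \<times> (nat \<Rightarrow> real)) \<times> ('t \<times> (nat \<Rightarrow> real))) set" where
  "point_glue T = {((t, x), (t', x')) | t x t' x' a b c a' b' c'.
     (t, a, b, c) \<in> mfaces T \<and> glue T (t, a, b, c) = (t', a', b', c') \<and>
     x \<in> standard_simplex 3 \<and> x' \<in> standard_simplex 3 \<and>
     x a + x b + x c = 1 \<and> x' a' = x a \<and> x' b' = x b \<and> x' c' = x c}"

definition vert :: "('t, 'w) triangulation \<Rightarrow> 't \<times> nat \<Rightarrow> ('t \<times> nat) set" where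
  "vert T x = {((t, a), (t', a')) | t a t' a'. \<exists>b c b' c'.
     (t, a, b, c) \<in> mfaces T \<and> glue T (t, a, b, c) = (t', a', b', c')}\<^sup>* `` {x}"

text \<open>\<open>abs_edges T\<close> is the set of edges of the abstract tetrahedra and \<open>edge T\<close> the identification
  map; an edge of T is the set of the abstract edges identified to it, so the fibre of \<open>edge T\<close>
  over an edge e is e itself.\<close>

type_synonym 't aedge = "'t \<times> nat set"

definition abs_edges :: "('t, 'w) triangulation \<Rightarrow> 't aedge set" where
  "abs_edges T = {(t, {a, b}) | t a b. t \<in> tets T \<and> a < 4 \<and> b < 4 \<and> a \<noteq> b}"

definition edge :: "('t, 'w) triangulation \<Rightarrow> 't aedge \<Rightarrow> 't aedge set" where
  "edge T x = {((t, {a, b}), (t', {a', b'})) | t a b t' a' b'. \<exists>c c'.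
     (t, a, b, c) \<in> mfaces T \<and> glue T (t, a, b, c) = (t', a', b', c')}\<^sup>* `` {x}"

type_synonym 't oedge = "'t \<times> nat \<times> nat"

definition oriented_edges :: "('t, 'w) triangulation \<Rightarrow> 't oedge set" where
  "oriented_edges T = {(t, a, b). t \<in> tets T \<and> a < 4 \<and> b < 4 \<and> a \<noteq> b}"

definition quasi_regular :: "('t, 'w) triangulation \<Rightarrow> bool" where
  "quasi_regular T \<longleftrightarrow> (\<forall>(t, a, b)\<in>oriented_edges T. vert T (t, a) \<noteq> vert T (t, b))"

definition barycentre :: "nat \<Rightarrow> real" where
  "barycentre = (\<lambda>i. if i < 4 then 1/4 else 0)"

text \<open>The characteristic maps induce a homeomorphism from the quotient to W, and the class of each
  characteristic map in the local homology at an interior point is the orientation class of W.\<close>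

definition triangulates ::
    "('t, 'w) triangulation \<Rightarrow> 'w topology \<Rightarrow> 'w orientation \<Rightarrow> bool" where
  "triangulates T W \<omega> \<longleftrightarrow> gluing T \<and>
     (\<forall>t\<in>tets T. singular_simplex 3 W (chart T t)) \<and>
     quotient_map
       (sum_topology (\<lambda>t. subtopology (powertop_real UNIV) (standard_simplex 3)) (tets T))
       W (\<lambda>(t, x). chart T t x) \<and>
     (\<forall>t\<in>tets T. \<forall>t'\<in>tets T. \<forall>x\<in>standard_simplex 3. \<forall>x'\<in>standard_simplex 3.
        chart T t x = chart T t' x' \<longleftrightarrow> ((t, x), (t', x')) \<in> (point_glue T)\<^sup>*) \<and>
     (\<forall>t\<in>tets T. homologous_rel_set 3 W (topspace W - {chart T t barycentre})
        (frag_of (chart T t)) = \<omega> (chart T t barycentre))"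

section \<open>Branchings and cocycles\<close>

text \<open>Functions of the oriented edges of T are encoded as functions of the oriented edges of the
  abstract tetrahedra which are compatible with the face identifications. A branching holds of
  (t,a,b) if the edge with endpoints a, b is oriented from a to b.\<close>

type_synonym 't branching = "'t oedge \<Rightarrow> bool"
type_synonym 't cochain = "'t oedge \<Rightarrow> psl2"
type_synonym 't moduli = "'t aedge \<Rightarrow> complex"

definition edge_function :: "('t, 'w) triangulation \<Rightarrow> ('t oedge \<Rightarrow> 'c) \<Rightarrow> bool" where
  "edge_function T f \<longleftrightarrow> (\<forall>t a b c t' a' b' c'.
     (t, a, b, c) \<in> mfaces T \<and> glue T (t, a, b, c) = (t', a', b', c') \<longrightarrow>
     f (t, a, b) = f (t', a', b'))"

text \<open>\<open>v 0, v 1, v 2, v 3\<close> are the vertices of t in the total ordering inducing the branching.\<close>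

definition orders :: "'t branching \<Rightarrow> 't \<Rightarrow> (nat \<Rightarrow> nat) \<Rightarrow> bool" where
  "orders b t v \<longleftrightarrow> v permutes {..<4} \<and>
     (\<forall>i<4. \<forall>j<4. i \<noteq> j \<longrightarrow> (b (t, v i, v j) \<longleftrightarrow> i < j))"

definition is_branching :: "('t, 'w) triangulation \<Rightarrow> 't branching \<Rightarrow> bool" where
  "is_branching T b \<longleftrightarrow> edge_function T b \<and> (\<forall>t\<in>tets T. \<exists>v. orders b t v)"

definition vertex_order :: "'t branching \<Rightarrow> 't \<Rightarrow> nat \<Rightarrow> nat" where
  "vertex_order b t = (THE v. orders b t v)"

lemma orders_unique:
  assumes "orders b t v" "orders b t v'"
  shows "v = v'"
proof -
  have vp: "v permutes {..<4}" "v' permutes {..<4}"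
    using assms by (auto simp: orders_def)
  define f where "f = inv_into UNIV v \<circ> v'"
  have fp: "f permutes {..<4}"
    unfolding f_def using vp by (intro permutes_compose permutes_inv)
  have vf: "v (f i) = v' i" for i
    using vp(1) by (simp add: f_def permutes_inverses)
  have "strict_mono_on {..<4} f"
  proof (rule strict_mono_onI)
    fix i j :: nat assume ij: "i \<in> {..<4}" "j \<in> {..<4}" "i < j"
    have lt: "f i < 4" "f j < 4" using ij permutes_in_image[OF fp] by auto
    have ne: "f i \<noteq> f j" using ij permutes_inj[OF fp] by (auto dest: injD)
    have "b (t, v' i, v' j)" using assms(2) ij by (auto simp: orders_def)
    then show "f i < f j" using assms(1) lt ne by (auto simp: orders_def vf[symmetric])
  qed
  then have m: "f 0 < f 1" "f 1 < f 2" "f 2 < f 3" by (auto simp: strict_mono_on_def)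
  moreover have "f 3 < 4" using permutes_in_image[OF fp, of 3] by auto
  ultimately have "f 0 = 0 \<and> f 1 = 1 \<and> f 2 = 2 \<and> f 3 = 3" by linarith
  moreover have "i < 4 \<Longrightarrow> i = 0 \<or> i = 1 \<or> i = 2 \<or> i = 3" for i :: nat by linarith
  ultimately have "f i = i" for i
    using permutes_not_in[OF fp, of i] by (cases "i < 4") auto
  then show ?thesis using vf by (metis ext)
qed

lemma vertex_order_eq: "orders b t v \<Longrightarrow> vertex_order b t = v"
  unfolding vertex_order_def by (blast intro: the_equality orders_unique)

text \<open>Since the numbering 0,1,2,3 of the vertices is positive, the frame
  ([v0,v1],[v0,v2],[v0,v3]) is positive iff the permutation v is even.\<close>

definition index :: "'t branching \<Rightarrow> 't \<Rightarrow> int" where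
  "index b t = sign (vertex_order b t)"

definition cocycle :: "('t, 'w) triangulation \<Rightarrow> 't cochain \<Rightarrow> bool" where
  "cocycle T z \<longleftrightarrow> edge_function T z \<and>
     (\<forall>(t, a, b)\<in>oriented_edges T. z (t, b, a) = inverse (z (t, a, b))) \<and>
     (\<forall>(t, a, b, c)\<in>mfaces T. z (t, a, b) * z (t, b, c) = z (t, a, c))"

definition edge_point :: "nat \<Rightarrow> nat \<Rightarrow> real \<Rightarrow> nat \<Rightarrow> real" where
  "edge_point a b r = (\<lambda>i. if i = a then 1 - r else if i = b then r else 0)"

text \<open>z represents \<rho> if, for some choice of a point s(v) of the bundle over each vertex v, the
  parallel transport P from v to v' along each edge e satisfies P(s(v)) z(e) = s(v'). With this
  convention z is multiplicative along paths, and replacing s(v) by s(v)\<lambda>(v) replaces z(e) by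
  the product of the inverse of \<lambda>(v), z(e) and \<lambda>(v').\<close>

definition represents ::
    "('t, 'w) triangulation \<Rightarrow> 't cochain \<Rightarrow> ('w, 'p) psl2_bundle \<Rightarrow> bool" where
  "represents T z \<rho> \<longleftrightarrow> (\<exists>s::'w \<Rightarrow> 'p. \<forall>(t, a, b)\<in>oriented_edges T.
     \<exists>\<gamma>. continuous_map (top_of_set {0..1}) (total \<rho>) \<gamma> \<and>
       (\<forall>r\<in>{0..1}. proj \<rho> (\<gamma> r) = chart T t (edge_point a b r)) \<and>
       \<gamma> 0 = s (chart T t (edge_point a b 0)) \<and>
       action \<rho> (\<gamma> 1) (z (t, a, b)) = s (chart T t (edge_point a b 1)))"

section \<open>Idealization\<close>

definition ideal_point :: "'t branching \<Rightarrow> 't cochain \<Rightarrow> 't \<Rightarrow> nat \<Rightarrow> cp1" where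
  "ideal_point b z t j =
     (let v = vertex_order b t; z0 = z (t, v 0, v 1); z1 = z (t, v 1, v 2); z0' = z (t, v 2, v 3)
      in [Aff 0, moebius z0 (Aff 0), moebius (z0 * z1) (Aff 0), moebius (z0 * z1 * z0') (Aff 0)] ! j)"

definition idealizable :: "'t branching \<Rightarrow> 't cochain \<Rightarrow> 't \<Rightarrow> bool" where
  "idealizable b z t \<longleftrightarrow> inj_on (ideal_point b z t) {..<4} \<and> Infty \<notin> ideal_point b z t ` {..<4}"

definition modulus_p :: "'t branching \<Rightarrow> 't cochain \<Rightarrow> 't \<Rightarrow> nat \<Rightarrow> complex" where
  "modulus_p b z t j =
     (let u = (\<lambda>k. aff (ideal_point b z t k))
      in [u 1 * (u 3 - u 2), (u 2 - u 1) * u 3, - u 2 * (u 3 - u 1)] ! j)"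

definition modulus_w :: "'t branching \<Rightarrow> 't cochain \<Rightarrow> 't \<Rightarrow> nat \<Rightarrow> complex" where
  "modulus_w b z t j = - modulus_p b z t ((j + 1) mod 3) / modulus_p b z t ((j + 2) mod 3)"

definition basic_edge :: "'t branching \<Rightarrow> 't \<Rightarrow> nat \<Rightarrow> nat set" where
  "basic_edge b t j =
     (let v = vertex_order b t in [{v 0, v 1}, {v 1, v 2}, {v 0, v 2}] ! j)"

text \<open>The value 0 outside the abstract edges makes the moduli a well-defined object.\<close>

definition moduli_of ::
    "('t, 'w) triangulation \<Rightarrow> 't branching \<Rightarrow> 't cochain \<Rightarrow> 't moduli" where
  "moduli_of T b z = (\<lambda>(t, e). if (t, e) \<in> abs_edges T
     then modulus_w b z t
            (THE j. j < 3 \<and> (e = basic_edge b t j \<or> e = {..<4} - basic_edge b t j))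
     else 0)"

type_synonym ('t, 'w) dtri = "('t, 'w) triangulation \<times> 't branching \<times> 't cochain"
type_synonym ('t, 'w) itri = "('t, 'w) triangulation \<times> 't branching \<times> 't moduli"

definition D_triangulation ::
    "'w topology \<Rightarrow> 'w orientation \<Rightarrow> ('w, 'p) psl2_bundle \<Rightarrow> ('t, 'w) dtri \<Rightarrow> bool" where
  "D_triangulation W \<omega> \<rho> = (\<lambda>(T, b, z).
     triangulates T W \<omega> \<and> quasi_regular T \<and> is_branching T b \<and> cocycle T z \<and>
     represents T z \<rho> \<and> (\<forall>t\<in>tets T. idealizable b z t))"

definition idealization :: "('t, 'w) dtri \<Rightarrow> ('t, 'w) itri" where
  "idealization = (\<lambda>(T, b, z). (T, b, moduli_of T b z))"

definition I_triangulation ::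
    "'w topology \<Rightarrow> 'w orientation \<Rightarrow> ('w, 'p) psl2_bundle \<Rightarrow> ('t, 'w) itri \<Rightarrow> bool" where
  "I_triangulation W \<omega> \<rho> J \<longleftrightarrow> (\<exists>D. D_triangulation W \<omega> \<rho> D \<and> J = idealization D)"

section \<open>Moves\<close>

text \<open>\<open>Move23 \<tau> \<kappa>\<close>: the triangulated bipyramid has vertices 0,...,4, where 0 and 1 are the apexes.
  \<open>\<tau> m\<close> is the tetrahedron with all these vertices except m, and \<open>\<kappa> m p\<close> is the number of its
  vertex p. So \<open>\<tau> 0\<close>, \<open>\<tau> 1\<close> are replaced by \<open>\<tau> 2\<close>, \<open>\<tau> 3\<close>, \<open>\<tau> 4\<close>, which share the new edge [0,1].

  \<open>Move02 q\<^sub>1 q\<^sub>2 s\<^sub>1 s\<^sub>2 \<kappa>\<^sub>1 \<kappa>\<^sub>2\<close>: \<open>q\<^sub>1\<close> = [a,b,c] and \<open>q\<^sub>2\<close> = [a,b,d] are abstract faces of the two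
  2-faces adjacent along [a,b]; they lie on the same side of these, since otherwise the target
  cannot satisfy the orientation condition in \<open>gluing\<close>. The new tetrahedra \<open>s\<^sub>1\<close>, \<open>s\<^sub>2\<close> have vertices a,b,c,d numbered
  \<open>\<kappa> 0, \<kappa> 1, \<kappa> 2, \<kappa> 3\<close> with \<open>\<kappa> = \<kappa>\<^sub>1, \<kappa>\<^sub>2\<close>; \<open>s\<^sub>1\<close> is glued to \<open>q\<^sub>1\<close> and \<open>q\<^sub>2\<close> and \<open>s\<^sub>2\<close> to the faces
  formerly glued to them. The edge [c,d] is new, and [a,b] is split into one copy for each of
  \<open>s\<^sub>1\<close>, \<open>s\<^sub>2\<close>.

  \<open>Bubble q s\<^sub>1 s\<^sub>2 \<kappa>\<^sub>1 \<kappa>\<^sub>2\<close>: \<open>q\<close> = [x,y,z] is one of the two abstract copies of the 2-face; the new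
  vertex n and x,y,z are numbered \<open>\<kappa> 3\<close> and \<open>\<kappa> 0, \<kappa> 1, \<kappa> 2\<close>.\<close>

datatype 't move =
    Move23 "nat \<Rightarrow> 't" "nat \<Rightarrow> nat \<Rightarrow> nat"
  | Move02 "'t mface" "'t mface" 't 't "nat \<Rightarrow> nat" "nat \<Rightarrow> nat"
  | Bubble "'t mface" 't 't "nat \<Rightarrow> nat" "nat \<Rightarrow> nat"

definition move23_outer :: "(nat \<Rightarrow> 't) \<Rightarrow> (nat \<Rightarrow> nat \<Rightarrow> nat) \<Rightarrow> ('t mface \<times> 't mface) set" where
  "move23_outer \<tau> \<kappa> = {((\<tau> m, \<kappa> m p, \<kappa> m q, \<kappa> m r), (\<tau> n, \<kappa> n p, \<kappa> n q, \<kappa> n r)) | m n p q r.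
     m \<in> {0, 1} \<and> n \<in> {2, 3, 4} \<and> {m, n, p, q, r} = {..4}}"

fun boundary_faces :: "'t move \<Rightarrow> ('t mface \<times> 't mface) set" where
  "boundary_faces (Move23 \<tau> \<kappa>) = move23_outer \<tau> \<kappa>"
| "boundary_faces (Move02 q\<^sub>1 q\<^sub>2 s\<^sub>1 s\<^sub>2 \<kappa>\<^sub>1 \<kappa>\<^sub>2) = {}"
| "boundary_faces (Bubble q s\<^sub>1 s\<^sub>2 \<kappa>\<^sub>1 \<kappa>\<^sub>2) = {}"

fun positive_move ::
    "'t move \<Rightarrow> ('t, 'w) triangulation \<Rightarrow> ('t, 'w) triangulation \<Rightarrow> bool" where
  "positive_move (Move23 \<tau> \<kappa>) T T' \<longleftrightarrow>
     inj_on \<tau> {..4} \<and> {\<tau> 0, \<tau> 1} \<subseteq> tets T \<and> {\<tau> 2, \<tau> 3, \<tau> 4} \<inter> tets T = {} \<and>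
     tets T' = (tets T - {\<tau> 0, \<tau> 1}) \<union> {\<tau> 2, \<tau> 3, \<tau> 4} \<and>
     (\<forall>m\<le>4. bij_betw (\<kappa> m) ({..4} - {m}) {..<4}) \<and>
     glue T (\<tau> 0, \<kappa> 0 2, \<kappa> 0 3, \<kappa> 0 4) = (\<tau> 1, \<kappa> 1 2, \<kappa> 1 3, \<kappa> 1 4) \<and>
     (\<forall>m n k. {m, n, k} = {2, 3, 4} \<longrightarrow>
        glue T' (\<tau> m, \<kappa> m 0, \<kappa> m 1, \<kappa> m k) = (\<tau> n, \<kappa> n 0, \<kappa> n 1, \<kappa> n k)) \<and>
     (let R = {(q, q) | q. q \<in> mfaces T \<inter> mfaces T'} \<union> move23_outer \<tau> \<kappa>
      in \<forall>(q, q')\<in>R. (glue T q, glue T' q') \<in> R)"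
| "positive_move (Move02 q\<^sub>1 q\<^sub>2 s\<^sub>1 s\<^sub>2 \<kappa>\<^sub>1 \<kappa>\<^sub>2) T T' \<longleftrightarrow>
     {q\<^sub>1, q\<^sub>2} \<subseteq> mfaces T \<and>
     distinct (map unmark [q\<^sub>1, glue T q\<^sub>1, q\<^sub>2, glue T q\<^sub>2]) \<and>
     (case (q\<^sub>1, q\<^sub>2) of ((t\<^sub>1, a\<^sub>1, b\<^sub>1, c), (t\<^sub>2, a\<^sub>2, b\<^sub>2, d)) \<Rightarrow>
        edge T (t\<^sub>1, {a\<^sub>1, b\<^sub>1}) = edge T (t\<^sub>2, {a\<^sub>2, b\<^sub>2}) \<and>
        vert T (t\<^sub>1, a\<^sub>1) = vert T (t\<^sub>2, a\<^sub>2) \<and> vert T (t\<^sub>1, b\<^sub>1) = vert T (t\<^sub>2, b\<^sub>2)) \<and>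
     s\<^sub>1 \<noteq> s\<^sub>2 \<and> {s\<^sub>1, s\<^sub>2} \<inter> tets T = {} \<and> tets T' = tets T \<union> {s\<^sub>1, s\<^sub>2} \<and>
     \<kappa>\<^sub>1 permutes {..<4} \<and> \<kappa>\<^sub>2 permutes {..<4} \<and>
     glue T' (s\<^sub>1, \<kappa>\<^sub>1 0, \<kappa>\<^sub>1 1, \<kappa>\<^sub>1 2) = q\<^sub>1 \<and> glue T' (s\<^sub>1, \<kappa>\<^sub>1 0, \<kappa>\<^sub>1 1, \<kappa>\<^sub>1 3) = q\<^sub>2 \<and>
     glue T' (s\<^sub>2, \<kappa>\<^sub>2 0, \<kappa>\<^sub>2 1, \<kappa>\<^sub>2 2) = glue T q\<^sub>1 \<and> glue T' (s\<^sub>2, \<kappa>\<^sub>2 0, \<kappa>\<^sub>2 1, \<kappa>\<^sub>2 3) = glue T q\<^sub>2 \<and>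
     glue T' (s\<^sub>1, \<kappa>\<^sub>1 0, \<kappa>\<^sub>1 2, \<kappa>\<^sub>1 3) = (s\<^sub>2, \<kappa>\<^sub>2 0, \<kappa>\<^sub>2 2, \<kappa>\<^sub>2 3) \<and>
     glue T' (s\<^sub>1, \<kappa>\<^sub>1 1, \<kappa>\<^sub>1 2, \<kappa>\<^sub>1 3) = (s\<^sub>2, \<kappa>\<^sub>2 1, \<kappa>\<^sub>2 2, \<kappa>\<^sub>2 3) \<and>
     (\<forall>q\<in>mfaces T. unmark q \<notin> unmark ` {q\<^sub>1, glue T q\<^sub>1, q\<^sub>2, glue T q\<^sub>2} \<longrightarrow> glue T' q = glue T q)"
| "positive_move (Bubble q\<^sub>0 s\<^sub>1 s\<^sub>2 \<kappa>\<^sub>1 \<kappa>\<^sub>2) T T' \<longleftrightarrow>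
     q\<^sub>0 \<in> mfaces T \<and>
     s\<^sub>1 \<noteq> s\<^sub>2 \<and> {s\<^sub>1, s\<^sub>2} \<inter> tets T = {} \<and> tets T' = tets T \<union> {s\<^sub>1, s\<^sub>2} \<and>
     \<kappa>\<^sub>1 permutes {..<4} \<and> \<kappa>\<^sub>2 permutes {..<4} \<and>
     glue T' (s\<^sub>1, \<kappa>\<^sub>1 0, \<kappa>\<^sub>1 1, \<kappa>\<^sub>1 2) = q\<^sub>0 \<and>
     glue T' (s\<^sub>2, \<kappa>\<^sub>2 0, \<kappa>\<^sub>2 1, \<kappa>\<^sub>2 2) = glue T q\<^sub>0 \<and>
     glue T' (s\<^sub>1, \<kappa>\<^sub>1 0, \<kappa>\<^sub>1 1, \<kappa>\<^sub>1 3) = (s\<^sub>2, \<kappa>\<^sub>2 0, \<kappa>\<^sub>2 1, \<kappa>\<^sub>2 3) \<and>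
     glue T' (s\<^sub>1, \<kappa>\<^sub>1 0, \<kappa>\<^sub>1 2, \<kappa>\<^sub>1 3) = (s\<^sub>2, \<kappa>\<^sub>2 0, \<kappa>\<^sub>2 2, \<kappa>\<^sub>2 3) \<and>
     glue T' (s\<^sub>1, \<kappa>\<^sub>1 1, \<kappa>\<^sub>1 2, \<kappa>\<^sub>1 3) = (s\<^sub>2, \<kappa>\<^sub>2 1, \<kappa>\<^sub>2 2, \<kappa>\<^sub>2 3) \<and>
     (\<forall>q\<in>mfaces T. unmark q \<notin> unmark ` {q\<^sub>0, glue T q\<^sub>0} \<longrightarrow> glue T' q = glue T q)"

text \<open>The move takes place in W: up to a map of W homotopic to the identity (the identity itself
  for a 2-3 move inside a bipyramid, the collapse of the pillow onto the former 2-faces for the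
  other moves), the tetrahedra not involved and the boundary of the bipyramid stay where they
  are.\<close>

definition in_place ::
    "'w topology \<Rightarrow> 't move \<Rightarrow> ('t, 'w) triangulation \<Rightarrow> ('t, 'w) triangulation \<Rightarrow> bool" where
  "in_place W m T T' \<longleftrightarrow> (\<exists>h. homotopic_with (\<lambda>_. True) W W h id \<and>
     (\<forall>t\<in>tets T \<inter> tets T'. \<forall>x\<in>standard_simplex 3. h (chart T' t x) = chart T t x) \<and>
     (\<forall>((t, a, b, c), (t', a', b', c'))\<in>boundary_faces m.
        \<forall>x\<in>standard_simplex 3. \<forall>x'\<in>standard_simplex 3.
          x a + x b + x c = 1 \<and> x' a' = x a \<and> x' b' = x b \<and> x' c' = x c \<longrightarrow>
          h (chart T' t' x') = chart T t x))"

text \<open>Common edges, as a correspondence between oriented abstract edges: those of the tetrahedra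
  not involved in the move, and, for the 2-3 move, those in the boundary of the bipyramid. For the
  other moves, every edge of T is the edge of a tetrahedron not involved in the move.\<close>

fun boundary_edges :: "'t move \<Rightarrow> ('t oedge \<times> 't oedge) set" where
  "boundary_edges (Move23 \<tau> \<kappa>) =
     {((t, a, b), (t', a', b')) | t a b t' a' b'. \<exists>c c'.
        ((t, a, b, c), (t', a', b', c')) \<in> move23_outer \<tau> \<kappa>}"
| "boundary_edges (Move02 q\<^sub>1 q\<^sub>2 s\<^sub>1 s\<^sub>2 \<kappa>\<^sub>1 \<kappa>\<^sub>2) = {}"
| "boundary_edges (Bubble q s\<^sub>1 s\<^sub>2 \<kappa>\<^sub>1 \<kappa>\<^sub>2) = {}"

definition common_edges ::
    "'t move \<Rightarrow> ('t, 'w) triangulation \<Rightarrow> ('t, 'w) triangulation \<Rightarrow> ('t oedge \<times> 't oedge) set" where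
  "common_edges m T T' =
     {(a, a) | a. a \<in> oriented_edges T \<inter> oriented_edges T'} \<union> boundary_edges m"

definition agree ::
    "'t move \<Rightarrow> ('t, 'w) triangulation \<Rightarrow> ('t, 'w) triangulation \<Rightarrow>
     ('t oedge \<Rightarrow> 'c) \<Rightarrow> ('t oedge \<Rightarrow> 'c) \<Rightarrow> bool" where
  "agree m T T' f f' \<longleftrightarrow> (\<forall>(a, a')\<in>common_edges m T T'. f a = f' a')"

section \<open>Transits\<close>

definition positive_branching_transit ::
    "'w topology \<Rightarrow> 'w orientation \<Rightarrow> 't move \<Rightarrow>
     ('t, 'w) triangulation \<Rightarrow> 't branching \<Rightarrow> ('t, 'w) triangulation \<Rightarrow> 't branching \<Rightarrow> bool" where
  "positive_branching_transit W \<omega> m T b T' b' \<longleftrightarrow>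
     triangulates T W \<omega> \<and> triangulates T' W \<omega> \<and> quasi_regular T \<and> quasi_regular T' \<and>
     positive_move m T T' \<and> in_place W m T T' \<and>
     is_branching T b \<and> is_branching T' b' \<and> agree m T T' b b'"

definition positive_D_transit ::
    "'w topology \<Rightarrow> 'w orientation \<Rightarrow> ('w, 'p) psl2_bundle \<Rightarrow> 't move \<Rightarrow>
     ('t, 'w) dtri \<Rightarrow> ('t, 'w) dtri \<Rightarrow> bool" where
  "positive_D_transit W \<omega> \<rho> m = (\<lambda>(T, b, z) (T', b', z').
     D_triangulation W \<omega> \<rho> (T, b, z) \<and> D_triangulation W \<omega> \<rho> (T', b', z') \<and>
     positive_branching_transit W \<omega> m T b T' b' \<and> agree m T T' z z')"

definition unchanged_edges ::
    "('t, 'w) triangulation \<Rightarrow> ('t, 'w) triangulation \<Rightarrow> 't aedge set" where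
  "unchanged_edges T T' = {a \<in> abs_edges T. fst a \<in> tets T \<inter> tets T'}"

definition changed_edges ::
    "('t, 'w) triangulation \<Rightarrow> ('t, 'w) triangulation \<Rightarrow> 't aedge set" where
  "changed_edges T T' = abs_edges T - unchanged_edges T T'"

definition edge_product :: "'t branching \<Rightarrow> 't moduli \<Rightarrow> 't aedge set \<Rightarrow> complex" where
  "edge_product b w e = (\<Prod>a\<in>e. w a powi index b (fst a))"

text \<open>In the 2-3 case the abstract edges (t,{i,j}) and (t',{i',j'}) run over the pairs lying over a
  common edge of the two triangulations.\<close>

fun moduli_condition ::
    "'t move \<Rightarrow> ('t, 'w) itri \<Rightarrow> ('t, 'w) itri \<Rightarrow> bool" where
  "moduli_condition (Move23 \<tau> \<kappa>) (T, b, w) (T', b', w') \<longleftrightarrow>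
     (\<forall>((t, i, j), (t', i', j'))\<in>boundary_edges (Move23 \<tau> \<kappa>).
        edge_product b w (edge T (t, {i, j})) = edge_product b' w' (edge T' (t', {i', j'})))"
| "moduli_condition _ (T, b, w) (T', b', w') \<longleftrightarrow>
     (\<forall>a\<in>changed_edges T' T. edge_product b' w' (edge T' a) = 1)"

definition I_transit_data ::
    "'w topology \<Rightarrow> 'w orientation \<Rightarrow> ('w, 'p) psl2_bundle \<Rightarrow> 't move \<Rightarrow>
     ('t, 'w) itri \<Rightarrow> ('t, 'w) itri \<Rightarrow> bool" where
  "I_transit_data W \<omega> \<rho> m = (\<lambda>(T, b, w) (T', b', w').
     I_triangulation W \<omega> \<rho> (T, b, w) \<and> I_triangulation W \<omega> \<rho> (T', b', w') \<and>
     positive_branching_transit W \<omega> m T b T' b' \<and>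
     (\<forall>a\<in>unchanged_edges T T'. w a = w' a))"

definition positive_I_transit ::
    "'w topology \<Rightarrow> 'w orientation \<Rightarrow> ('w, 'p) psl2_bundle \<Rightarrow> 't move \<Rightarrow>
     ('t, 'w) itri \<Rightarrow> ('t, 'w) itri \<Rightarrow> bool" where
  "positive_I_transit W \<omega> \<rho> m J J' \<longleftrightarrow> I_transit_data W \<omega> \<rho> m J J' \<and> moduli_condition m J J'"

text \<open>Here J' is the source and J the target of the negative transit. The 3-2 transits satisfy the
  same edge conditions as the 2-3 ones; for the other negative moves the moduli are merely
  forgotten.\<close>

definition negative_I_transit ::
    "'w topology \<Rightarrow> 'w orientation \<Rightarrow> ('w, 'p) psl2_bundle \<Rightarrow> 't move \<Rightarrow>
     ('t, 'w) itri \<Rightarrow> ('t, 'w) itri \<Rightarrow> bool" where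
  "negative_I_transit W \<omega> \<rho> m J' J \<longleftrightarrow> I_transit_data W \<omega> \<rho> m J J' \<and>
     (case m of Move23 \<tau> \<kappa> \<Rightarrow> moduli_condition m J J' | _ \<Rightarrow> True)"

datatype direction = Positive | Negative

record ('t, 'x) transit =
  support :: "'t move \<times> direction"
  source :: 'x
  target :: 'x

definition D_transits ::
    "'w topology \<Rightarrow> 'w orientation \<Rightarrow> ('w, 'p) psl2_bundle \<Rightarrow>
     ('t, ('t, 'w) dtri) transit set" where
  "D_transits W \<omega> \<rho> = {d. case support d of
       (m, Positive) \<Rightarrow> positive_D_transit W \<omega> \<rho> m (source d) (target d)
     | (m, Negative) \<Rightarrow> positive_D_transit W \<omega> \<rho> m (target d) (source d)}"

definition I_transits ::
    "'w topology \<Rightarrow> 'w orientation \<Rightarrow> ('w, 'p) psl2_bundle \<Rightarrow>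
     ('t, ('t, 'w) itri) transit set" where
  "I_transits W \<omega> \<rho> = {i. case support i of
       (m, Positive) \<Rightarrow> positive_I_transit W \<omega> \<rho> m (source i) (target i)
     | (m, Negative) \<Rightarrow> negative_I_transit W \<omega> \<rho> m (source i) (target i)}"

text \<open>\<open>i \<circ> \<I> = \<I> \<circ> d\<close>: the transits i and d are supported by the same move, and i goes from the
  idealization of the source of d to the idealization of its target.\<close>

definition covers ::
    "('t, ('t, 'w) itri) transit \<Rightarrow> ('t, ('t, 'w) dtri) transit \<Rightarrow> bool" where
  "covers i d \<longleftrightarrow> support i = support d \<and>
     source i = idealization (source d) \<and> target i = idealization (target d)"

end

theory Submission
  imports Defs
begin

text \<open>The moduli of a cocycle are cross ratios. Seen from a vertex \<open>a\<close> of a tetrahedron, the vertex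
  \<open>x\<close> is at the point \<open>z(a,x)(0)\<close> of the Riemann sphere. In the coordinate \<open>1/u\<close>, which puts \<open>a\<close> itself
  at infinity, this point is the slope \<open>s(a,x)\<close>, and the modulus of \<open>[a,b]\<close> in the tetrahedron with
  vertices \<open>a, b, c, d\<close>, raised to the power given by the index, is
  \<open>(s(a,c) - s(a,b)) / (s(a,d) - s(a,b))\<close> when \<open>(a,b,c,d)\<close> is positively oriented
  (\<open>modulus_conv_slopes\<close>). Each of the two differences belongs to a 2-face, so in the product over
  all tetrahedra around an edge every 2-face contributes once to the numerator and once to the
  denominator. Hence the product is 1 at every edge of every \<open>\<D>\<close>-triangulation
  (\<open>edge_product_eq_1\<close>). This gives the \<open>\<I>\<close>-transit below a \<open>\<D>\<close>-transit: both sides of the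
  conditions on the moduli are 1.

  Conversely, let \<open>T \<rightarrow> T'\<close> be the positive move of an \<open>\<I>\<close>-transit, in either direction, and let \<open>z'\<close>
  be a cocycle on \<open>T'\<close> with the given idealization. Every edge of \<open>T\<close> is an edge of \<open>T'\<close>, so \<open>z'\<close>
  restricts to \<open>T\<close> (\<open>restrict_cocycle\<close>). Three points make this restriction the cocycle that
  is looked for.

  First, it represents the same bundle. The maps of \<open>T\<close> and \<open>T'\<close> to \<open>W\<close> agree on common edges only
  up to a map homotopic to the identity; lifting the homotopy to the flat bundle transports the points
  chosen over the vertices of \<open>T'\<close> to points over the vertices of \<open>T\<close>
  (\<open>represents_via_homotopy\<close>).

  Second, it is idealizable. The developed vertices stay distinct but some of them may be at infinity.
  Conjugation of \<open>z'\<close> by a parabolic element that fixes 0 translates all slopes by one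
  constant; it does not change the moduli, and for a generic constant no edge sends 0 to infinity
  (\<open>D_triangulation_generic\<close>).

  Third, its moduli are the given ones. They are so on the tetrahedra that do not take part in the
  move. In a 2-3 move the five vertices of the bipyramid are distinct by quasi-regularity, so an
  edge from an apex to the equator has only one tetrahedron of the bipyramid in \<open>T\<close> around it. That
  the product at this edge is 1 determines the modulus there, and one modulus determines the
  modular triple (\<open>moduli_determined_by_unchanged\<close>).\<close>

section \<open>Lifting paths and homotopies to a flat bundle\<close>

lemma psl2_cancel_left: "(g::psl2) * h = g * k \<longleftrightarrow> h = k"
  by (metis mult.assoc mult_1_left psl2_left_inverse)

definition lifts ::
    "'a topology \<Rightarrow> ('a \<Rightarrow> 'w) \<Rightarrow> ('w, 'p) psl2_bundle \<Rightarrow> ('a \<Rightarrow> 'p) \<Rightarrow> bool" where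
  "lifts X K \<rho> \<sigma> \<longleftrightarrow> continuous_map X (total \<rho>) \<sigma> \<and> (\<forall>x\<in>topspace X. proj \<rho> (\<sigma> x) = K x)"

lemma lifts_topspace: "lifts X K \<rho> \<sigma> \<Longrightarrow> x \<in> topspace X \<Longrightarrow> \<sigma> x \<in> topspace (total \<rho>)"
  by (auto simp: lifts_def continuous_map_def Pi_iff)

lemma lifts_subtopology: "lifts X K \<rho> \<sigma> \<Longrightarrow> lifts (subtopology X S) K \<rho> \<sigma>"
  by (auto simp: lifts_def continuous_map_from_subtopology)

lemma lifts_compose:
  assumes "lifts Y K \<rho> \<sigma>" "continuous_map X Y f" "\<And>x. x \<in> topspace X \<Longrightarrow> K (f x) = L x"
  shows "lifts X L \<rho> (\<lambda>x. \<sigma> (f x))"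
  using assms continuous_map_compose[of X Y f "total \<rho>" \<sigma>]
  by (auto simp: lifts_def o_def continuous_map_def Pi_iff)

text \<open>Over a trivialising open set a lift is a locally constant function with values in the group. The
  preimage of this set is taken in the source of \<open>K\<close>, where it is open because \<open>K\<close> is continuous; the
  definition of a flat bundle does not say that the projection is continuous.\<close>

lemma local_coordinates:
  assumes fl: "flat_psl2_bundle W \<rho>" and K: "continuous_map X W K" and x: "x \<in> topspace X"
  obtains V \<phi> where "openin X V" "x \<in> V"
    "\<And>f. continuous_map (subtopology X V) (discrete_topology UNIV) f \<Longrightarrow>
       lifts (subtopology X V) K \<rho> (\<lambda>y. \<phi> (K y, f y))"
    "\<And>\<sigma>. lifts X K \<rho> \<sigma> \<Longrightarrow> \<exists>f. continuous_map (subtopology X V) (discrete_topology UNIV) f \<and>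
       (\<forall>y\<in>V. \<sigma> y = \<phi> (K y, f y))"
    "\<And>y g h. y \<in> V \<Longrightarrow> action \<rho> (\<phi> (K y, g)) h = \<phi> (K y, g * h)"
    "\<And>y g h. y \<in> V \<Longrightarrow> \<phi> (K y, g) = \<phi> (K y, h) \<Longrightarrow> g = h"
proof -
  have "K x \<in> topspace W" using K x by (auto simp: continuous_map_def Pi_iff)
  then obtain U \<phi> where U: "openin W U" "K x \<in> U" and
    h: "homeomorphic_map (prod_topology (subtopology W U) (discrete_topology UNIV))
          (subtopology (total \<rho>) {y \<in> topspace (total \<rho>). proj \<rho> y \<in> U}) \<phi>" and
    e: "\<And>y g h. y \<in> U \<Longrightarrow> proj \<rho> (\<phi> (y, g)) = y \<and> action \<rho> (\<phi> (y, g)) h = \<phi> (y, g * h)"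
    using fl unfolding flat_psl2_bundle_def by meson
  let ?P = "prod_topology (subtopology W U) (discrete_topology (UNIV :: psl2 set))"
  let ?Q = "subtopology (total \<rho>) {y \<in> topspace (total \<rho>). proj \<rho> y \<in> U}"
  obtain \<psi> where "homeomorphic_maps ?P ?Q \<phi> \<psi>" using h homeomorphic_map_maps by blast
  then have \<phi>: "continuous_map ?P ?Q \<phi>" and \<psi>: "continuous_map ?Q ?P \<psi>"
    and \<psi>\<phi>: "\<And>p. p \<in> topspace ?P \<Longrightarrow> \<psi> (\<phi> p) = p" and \<phi>\<psi>: "\<And>q. q \<in> topspace ?Q \<Longrightarrow> \<phi> (\<psi> q) = q"
    unfolding homeomorphic_maps_def by blast+
  have UW: "U \<subseteq> topspace W" using U openin_subset by blast
  define V where "V = {y \<in> topspace X. K y \<in> U}"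
  have V: "openin X V" unfolding V_def using K U by (auto simp: continuous_map_def)
  have KV: "continuous_map (subtopology X V) (subtopology W U) K"
    by (rule continuous_map_into_subtopology[OF continuous_map_from_subtopology[OF K]])
      (simp add: V_def)
  have a: "lifts (subtopology X V) K \<rho> (\<lambda>y. \<phi> (K y, f y))"
    if f: "continuous_map (subtopology X V) (discrete_topology UNIV) f" for f
  proof -
    have "continuous_map (subtopology X V) ?P (\<lambda>y. (K y, f y))"
      using KV f by (rule continuous_map_pairedI)
    then have "continuous_map (subtopology X V) ?Q (\<phi> \<circ> (\<lambda>y. (K y, f y)))"
      using \<phi> continuous_map_compose by blast
    then have "continuous_map (subtopology X V) (total \<rho>) (\<phi> \<circ> (\<lambda>y. (K y, f y)))"
      using continuous_map_into_fulltopology by blast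
    then show ?thesis using e by (auto simp: lifts_def o_def V_def)
  qed
  have b: "\<exists>f. continuous_map (subtopology X V) (discrete_topology UNIV) f \<and>
       (\<forall>y\<in>V. \<sigma> y = \<phi> (K y, f y))" if \<sigma>: "lifts X K \<rho> \<sigma>" for \<sigma>
  proof (intro exI conjI ballI)
    have s: "continuous_map (subtopology X V) ?Q \<sigma>"
    proof (rule continuous_map_into_subtopology[OF continuous_map_from_subtopology])
      show "continuous_map X (total \<rho>) \<sigma>" using \<sigma> by (simp add: lifts_def)
      show "\<sigma> \<in> topspace (subtopology X V) \<rightarrow> {y \<in> topspace (total \<rho>). proj \<rho> y \<in> U}"
        using \<sigma> lifts_topspace[OF \<sigma>] by (auto simp: V_def lifts_def)
    qed
    have "continuous_map (subtopology X V) ?P (\<psi> \<circ> \<sigma>)"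
      using s \<psi> continuous_map_compose by blast
    then show "continuous_map (subtopology X V) (discrete_topology UNIV) (\<lambda>y. snd (\<psi> (\<sigma> y)))"
      using continuous_map_compose[OF _ continuous_map_snd] by (fastforce simp: o_def)
    fix y assume y: "y \<in> V"
    then have q: "\<sigma> y \<in> topspace ?Q"
      using s V openin_subset by (fastforce simp: continuous_map_def Pi_iff)
    then have "\<psi> (\<sigma> y) \<in> topspace ?P" using \<psi> by (auto simp: continuous_map_def Pi_iff)
    then have "fst (\<psi> (\<sigma> y)) \<in> U" by auto
    then have "proj \<rho> (\<phi> (\<psi> (\<sigma> y))) = fst (\<psi> (\<sigma> y))" using e by (metis prod.collapse)
    then have "fst (\<psi> (\<sigma> y)) = K y"
      using \<phi>\<psi>[OF q] \<sigma> y V openin_subset by (fastforce simp: lifts_def)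
    then show "\<sigma> y = \<phi> (K y, snd (\<psi> (\<sigma> y)))" using \<phi>\<psi>[OF q] by (metis prod.collapse)
  qed
  have d: "g = h" if "y \<in> V" "\<phi> (K y, g) = \<phi> (K y, h)" for y g h
  proof -
    have "(K y, k) \<in> topspace ?P" for k using that(1) UW by (auto simp: V_def)
    then have "(K y, g) = (K y, h)" using \<psi>\<phi> that(2) by metis
    then show ?thesis by simp
  qed
  show ?thesis
  proof (rule that[of V \<phi>])
    show "x \<in> V" using x U by (simp add: V_def)
    show "action \<rho> (\<phi> (K y, g)) h = \<phi> (K y, g * h)" if "y \<in> V" for y g h
      using e that by (simp add: V_def)
  qed (fact V a b d)+
qed

lemma continuous_map_locally:
  assumes "\<And>x. x \<in> topspace X \<Longrightarrow> \<exists>V. openin X V \<and> x \<in> V \<and> continuous_map (subtopology X V) Y f"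
  shows "continuous_map X Y f"
proof -
  define I where "I = {V. openin X V \<and> continuous_map (subtopology X V) Y f}"
  show ?thesis
    by (rule pasting_lemma[of I X "\<lambda>V. V" Y "\<lambda>V. f"]) (use assms in \<open>auto simp: I_def\<close>)
qed

lemma continuous_map_to_discrete_mult:
  assumes "continuous_map X (discrete_topology UNIV) (f :: _ \<Rightarrow> psl2)"
  shows "continuous_map X (discrete_topology UNIV) (\<lambda>x. f x * g)"
proof -
  have "continuous_map (discrete_topology UNIV) (discrete_topology UNIV) (\<lambda>x. x * g)" by simp
  from continuous_map_compose[OF assms this] show ?thesis by (simp add: o_def)
qed

lemma lifts_action:
  assumes fl: "flat_psl2_bundle W \<rho>" and K: "continuous_map X W K" and \<sigma>: "lifts X K \<rho> \<sigma>"
  shows "lifts X K \<rho> (\<lambda>x. action \<rho> (\<sigma> x) g)"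
proof -
  have "continuous_map X (total \<rho>) (\<lambda>x. action \<rho> (\<sigma> x) g)"
  proof (rule continuous_map_locally)
    fix x assume x: "x \<in> topspace X"
    obtain V \<phi> where V: "openin X V" "x \<in> V" and
      a: "\<And>f. continuous_map (subtopology X V) (discrete_topology UNIV) f \<Longrightarrow>
         lifts (subtopology X V) K \<rho> (\<lambda>y. \<phi> (K y, f y))" and
      b: "\<And>\<sigma>. lifts X K \<rho> \<sigma> \<Longrightarrow> \<exists>f. continuous_map (subtopology X V) (discrete_topology UNIV) f \<and>
         (\<forall>y\<in>V. \<sigma> y = \<phi> (K y, f y))" and
      c: "\<And>y g h. y \<in> V \<Longrightarrow> action \<rho> (\<phi> (K y, g)) h = \<phi> (K y, g * h)" and
      d: "\<And>y g h. y \<in> V \<Longrightarrow> \<phi> (K y, g) = \<phi> (K y, h) \<Longrightarrow> g = h"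
      by (rule local_coordinates[OF fl K x]) (rule that)
    obtain f where f: "continuous_map (subtopology X V) (discrete_topology UNIV) f"
      "\<And>y. y \<in> V \<Longrightarrow> \<sigma> y = \<phi> (K y, f y)" using b[OF \<sigma>] by blast
    have "continuous_map (subtopology X V) (total \<rho>) (\<lambda>y. \<phi> (K y, f y * g))"
      using a[OF continuous_map_to_discrete_mult[OF f(1)]] by (simp add: lifts_def)
    then have "continuous_map (subtopology X V) (total \<rho>) (\<lambda>x. action \<rho> (\<sigma> x) g)"
      by (rule continuous_map_eq) (use f(2) c in auto)
    with V show "\<exists>V. openin X V \<and> x \<in> V \<and> continuous_map (subtopology X V) (total \<rho>) (\<lambda>x. action \<rho> (\<sigma> x) g)"
      by blast
  qed
  moreover have "proj \<rho> (action \<rho> (\<sigma> x) g) = K x" if "x \<in> topspace X" for x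
    using fl \<sigma> lifts_topspace[OF \<sigma> that] that by (auto simp: flat_psl2_bundle_def lifts_def)
  ultimately show ?thesis by (auto simp: lifts_def)
qed

text \<open>In local coordinates the quotient of two lifts is locally constant.\<close>

lemma lifts_differ_by_constant:
  assumes fl: "flat_psl2_bundle W \<rho>" and K: "continuous_map X W K" and conn: "connected_space X"
    and \<sigma>: "lifts X K \<rho> \<sigma>" and \<tau>: "lifts X K \<rho> \<tau>"
  obtains g where "\<And>x. x \<in> topspace X \<Longrightarrow> \<tau> x = action \<rho> (\<sigma> x) g"
proof (cases "topspace X = {}")
  case True then show ?thesis using that by blast
next
  case False
  define A where "A = (\<lambda>g. {x \<in> topspace X. \<tau> x = action \<rho> (\<sigma> x) g})"
  have loc: "\<exists>V g. openin X V \<and> x \<in> V \<and> V \<subseteq> A g \<and> (\<forall>h. x \<in> A h \<longrightarrow> h = g)"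
    if x: "x \<in> topspace X" for x
  proof -
    obtain V \<phi> where V: "openin X V" "x \<in> V" and
      a: "\<And>f. continuous_map (subtopology X V) (discrete_topology UNIV) f \<Longrightarrow>
         lifts (subtopology X V) K \<rho> (\<lambda>y. \<phi> (K y, f y))" and
      b: "\<And>\<sigma>. lifts X K \<rho> \<sigma> \<Longrightarrow> \<exists>f. continuous_map (subtopology X V) (discrete_topology UNIV) f \<and>
         (\<forall>y\<in>V. \<sigma> y = \<phi> (K y, f y))" and
      c: "\<And>y g h. y \<in> V \<Longrightarrow> action \<rho> (\<phi> (K y, g)) h = \<phi> (K y, g * h)" and
      d: "\<And>y g h. y \<in> V \<Longrightarrow> \<phi> (K y, g) = \<phi> (K y, h) \<Longrightarrow> g = h"
      by (rule local_coordinates[OF fl K x]) (rule that)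
    obtain f where f: "continuous_map (subtopology X V) (discrete_topology UNIV) f"
      "\<And>y. y \<in> V \<Longrightarrow> \<sigma> y = \<phi> (K y, f y)" using b[OF \<sigma>] by blast
    obtain f' where f': "continuous_map (subtopology X V) (discrete_topology UNIV) f'"
      "\<And>y. y \<in> V \<Longrightarrow> \<tau> y = \<phi> (K y, f' y)" using b[OF \<tau>] by blast
    have VX: "V \<subseteq> topspace X" using V openin_subset by blast
    define V' where "V' = {y \<in> V. f y = f x} \<inter> {y \<in> V. f' y = f' x}"
    have "openin (subtopology X V) {y \<in> topspace (subtopology X V). f y \<in> {f x}}"
      "openin (subtopology X V) {y \<in> topspace (subtopology X V). f' y \<in> {f' x}}"
      using f(1) f'(1) by (auto simp only: continuous_map_def openin_discrete_topology)
    then have "openin X {y \<in> V. f y = f x}" "openin X {y \<in> V. f' y = f' x}"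
      using V openin_trans_full VX by (auto simp: Int_absorb1)
    then have "openin X V'" unfolding V'_def by blast
    moreover have "\<tau> y = action \<rho> (\<sigma> y) h \<longleftrightarrow> h = inverse (f x) * f' x" if "y \<in> V'" for y h
    proof -
      have "\<tau> y = action \<rho> (\<sigma> y) h \<longleftrightarrow> f' x = f x * h"
        using that f(2) f'(2) c d[of y] by (auto simp: V'_def)
      also have "\<dots> \<longleftrightarrow> f x * (inverse (f x) * f' x) = f x * h"
        by (simp add: mult.assoc[symmetric] psl2_right_inverse)
      finally show ?thesis by (auto simp: psl2_cancel_left)
    qed
    ultimately show ?thesis using VX V(2)
      by (intro exI[of _ V'] exI[of _ "inverse (f x) * f' x"]) (auto simp: V'_def A_def)
  qed
  have op: "openin X (A g)" for g
  proof (subst openin_subopen, intro ballI)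
    fix x assume x: "x \<in> A g"
    then have "x \<in> topspace X" by (simp add: A_def)
    then obtain V h where V: "openin X V" "x \<in> V" "V \<subseteq> A h" "\<And>h'. x \<in> A h' \<Longrightarrow> h' = h"
      using loc by metis
    then have "h = g" using x by metis
    then show "\<exists>V. openin X V \<and> x \<in> V \<and> V \<subseteq> A g" using V by metis
  qed
  obtain x0 where x0: "x0 \<in> topspace X" using False by blast
  obtain V g where "x0 \<in> V" "V \<subseteq> A g" using loc[OF x0] by metis
  then have g: "x0 \<in> A g" by blast
  have "topspace X - A g = \<Union> {A h | h. h \<noteq> g}"
  proof
    show "topspace X - A g \<subseteq> \<Union> {A h |h. h \<noteq> g}"
    proof
      fix x assume x: "x \<in> topspace X - A g"
      then obtain V h where "x \<in> V" "V \<subseteq> A h" using loc[of x] by (elim DiffE) metis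
      then have "x \<in> A h" by blast
      moreover from this have "h \<noteq> g" using x by blast
      ultimately show "x \<in> \<Union> {A h |h. h \<noteq> g}" by blast
    qed
    have "A h \<subseteq> topspace X - A g" if "h \<noteq> g" for h
    proof
      fix x assume "x \<in> A h"
      moreover from this have "x \<in> topspace X" by (simp add: A_def)
      ultimately show "x \<in> topspace X - A g" using loc[of x] that by (metis DiffI)
    qed
    then show "\<Union> {A h |h. h \<noteq> g} \<subseteq> topspace X - A g" by blast
  qed
  then have "closedin X (A g)" using op by (auto simp: closedin_def A_def)
  then have "A g = topspace X" using conn op g by (auto simp: connected_space_clopen_in)
  then show ?thesis using that[of g] by (auto simp: A_def)
qed

text \<open>The two lifts differ by a constant on the connected overlap; moving one of them by
  this constant makes them match.\<close>

lemma lifts_Un: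
  assumes fl: "flat_psl2_bundle W \<rho>" and K: "continuous_map (subtopology X (A \<union> B)) W K"
    and cl: "closedin X A" "closedin X B" and conn: "connectedin X (A \<inter> B)"
    and \<sigma>: "lifts (subtopology X A) K \<rho> \<sigma>" and \<tau>: "lifts (subtopology X B) K \<rho> \<tau>"
  shows "\<exists>\<upsilon>. lifts (subtopology X (A \<union> B)) K \<rho> \<upsilon>"
proof -
  have sub: "A \<subseteq> topspace X" "B \<subseteq> topspace X" using cl closedin_subset by auto
  have Ks: "continuous_map (subtopology X S) W K" if "S \<subseteq> A \<union> B" for S
    using K that continuous_map_from_subtopology_mono by blast
  have s: "lifts (subtopology X (A \<inter> B)) K \<rho> \<sigma>" "lifts (subtopology X (A \<inter> B)) K \<rho> \<tau>"
    using lifts_subtopology[OF \<sigma>, of B] lifts_subtopology[OF \<tau>, of A]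
    by (simp_all add: subtopology_subtopology Int_commute)
  obtain g where g: "\<And>x. x \<in> A \<inter> B \<Longrightarrow> \<sigma> x = action \<rho> (\<tau> x) g"
    using lifts_differ_by_constant[OF fl Ks[of "A \<inter> B"] connected_space_subtopology[OF conn] s(2,1)]
      sub by (auto simp: Int_absorb1 le_infI1)
  define \<tau>' where "\<tau>' = (\<lambda>x. action \<rho> (\<tau> x) g)"
  have \<tau>': "lifts (subtopology X B) K \<rho> \<tau>'"
    unfolding \<tau>'_def by (rule lifts_action[OF fl Ks \<tau>]) auto
  define \<upsilon> where "\<upsilon> = (\<lambda>x. if x \<in> A then \<sigma> x else \<tau>' x)"
  have "continuous_map (subtopology X (A \<union> B)) (total \<rho>) \<upsilon>"
  proof (rule pasting_lemma_closed[where I = "UNIV :: bool set" and T = "\<lambda>i. if i then A else B"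
        and f = "\<lambda>i. if i then \<sigma> else \<tau>'"])
    show "closedin (subtopology X (A \<union> B)) (if i then A else B)" for i
      using cl by (auto intro: closedin_subset_topspace)
    show "continuous_map (subtopology (subtopology X (A \<union> B)) (if i then A else B)) (total \<rho>)
        (if i then \<sigma> else \<tau>')" for i
      using \<sigma> \<tau>' by (auto simp: subtopology_subtopology lifts_def Int_absorb1 Int_commute)
    show "(if i then \<sigma> else \<tau>') x = (if j then \<sigma> else \<tau>') x"
      if "x \<in> topspace (subtopology X (A \<union> B)) \<inter> (if i then A else B) \<inter> (if j then A else B)" for i j x
      using that g by (auto simp: \<tau>'_def split: if_splits)
    show "\<exists>j. j \<in> UNIV \<and> x \<in> (if j then A else B) \<and> \<upsilon> x = (if j then \<sigma> else \<tau>') x"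
      if "x \<in> topspace (subtopology X (A \<union> B))" for x
    proof (cases "x \<in> A")
      case True then show ?thesis by (intro exI[of _ True]) (simp add: \<upsilon>_def)
    next
      case False then show ?thesis using that by (intro exI[of _ False]) (simp add: \<upsilon>_def)
    qed
  qed simp
  then show ?thesis using \<sigma> \<tau>' by (intro exI[of _ \<upsilon>]) (auto simp: lifts_def \<upsilon>_def)
qed

text \<open>A small rectangle lifts by a trivialisation, and rectangles with a common side can be joined.
  Compactness of the interval is used in one coordinate to get thin strips of full height, and then in
  the other.\<close>

lemma lift_square:
  assumes fl: "flat_psl2_bundle W \<rho>"
    and K: "continuous_map (top_of_set ({0..1} \<times> {0..1 :: real})) W (K :: real \<times> real \<Rightarrow> 'w)"
  obtains \<sigma> where "lifts (top_of_set ({0..1} \<times> {0..1})) K \<rho> \<sigma>"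
proof -
  let ?Q = "{0..1} \<times> {0..1} :: (real \<times> real) set"
  define L where "L = (\<lambda>S. S \<subseteq> ?Q \<longrightarrow> (\<exists>\<sigma>. lifts (top_of_set S) K \<rho> \<sigma>))"
  have KS: "continuous_map (top_of_set S) W K" if "S \<subseteq> ?Q" for S
    using K that continuous_map_from_subtopology_mono by blast
  have Un: "L (A \<union> B)" if "L A" "L B" "closed A" "closed B" "connected (A \<inter> B)" for A B
    unfolding L_def
  proof
    assume s: "A \<union> B \<subseteq> ?Q"
    then obtain \<sigma> \<tau> where "lifts (top_of_set A) K \<rho> \<sigma>" "lifts (top_of_set B) K \<rho> \<tau>"
      using \<open>L A\<close> \<open>L B\<close> by (auto simp: L_def)
    then show "\<exists>\<sigma>. lifts (top_of_set (A \<union> B)) K \<rho> \<sigma>"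
      using lifts_Un[OF fl KS[OF s]] that by (auto simp: connectedin_iff_connected)
  qed
  have pt: "\<exists>d>0. \<forall>a b c e. a \<le> x \<and> x \<le> b \<and> b - a < d \<and> c \<le> y \<and> y \<le> e \<and> e - c < d \<longrightarrow>
      L ({a..b} \<times> {c..e})" if p: "(x, y) \<in> ?Q" for x y
  proof -
    have p': "(x, y) \<in> topspace (top_of_set ?Q)" using p by simp
    obtain V \<phi> where V: "openin (top_of_set ?Q) V" "(x, y) \<in> V" and
      a: "\<And>f. continuous_map (subtopology (top_of_set ?Q) V) (discrete_topology UNIV) f \<Longrightarrow>
         lifts (subtopology (top_of_set ?Q) V) K \<rho> (\<lambda>y. \<phi> (K y, f y))" and
      b: "\<And>\<sigma>. lifts (top_of_set ?Q) K \<rho> \<sigma> \<Longrightarrow> \<exists>f. continuous_map (subtopology (top_of_set ?Q) V) (discrete_topology UNIV) f \<and>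
         (\<forall>y\<in>V. \<sigma> y = \<phi> (K y, f y))" and
      c: "\<And>y g h. y \<in> V \<Longrightarrow> action \<rho> (\<phi> (K y, g)) h = \<phi> (K y, g * h)" and
      d: "\<And>y g h. y \<in> V \<Longrightarrow> \<phi> (K y, g) = \<phi> (K y, h) \<Longrightarrow> g = h"
      by (rule local_coordinates[OF fl K p']) (rule that)
    obtain O' where O: "open O'" "V = ?Q \<inter> O'" using V by (auto simp: openin_open)
    obtain r where r: "r > 0" "ball (x, y) r \<subseteq> O'" using O V(2) open_contains_ball by blast
    have "L ({a..b} \<times> {c..e})"
      if h: "a \<le> x" "x \<le> b" "b - a < r / 2" "c \<le> y" "y \<le> e" "e - c < r / 2" for a b c e
      unfolding L_def
    proof
      assume s: "{a..b} \<times> {c..e} \<subseteq> ?Q"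
      have "{a..b} \<times> {c..e} \<subseteq> ball (x, y) r"
      proof
        fix q assume "q \<in> {a..b} \<times> {c..e}"
        then obtain u v where q: "q = (u, v)" "a \<le> u" "u \<le> b" "c \<le> v" "v \<le> e" by auto
        have "dist (x, y) (u, v) \<le> \<bar>x - u\<bar> + \<bar>y - v\<bar>"
          unfolding dist_Pair_Pair dist_real_def using sqrt_sum_squares_le_sum_abs by simp
        also have "\<dots> < r" using q h by linarith
        finally show "q \<in> ball (x, y) r" using q by simp
      qed
      then have "{a..b} \<times> {c..e} \<subseteq> V" using s r O by blast
      moreover have "lifts (subtopology (top_of_set ?Q) V) K \<rho> (\<lambda>y. \<phi> (K y, 1))"
        by (rule a) simp
      ultimately have "lifts (subtopology (subtopology (top_of_set ?Q) V) ({a..b} \<times> {c..e})) K \<rho> (\<lambda>y. \<phi> (K y, 1))"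
        using lifts_subtopology by blast
      moreover have "?Q \<inter> V \<inter> ({a..b} \<times> {c..e}) = {a..b} \<times> {c..e}"
        using s \<open>{a..b} \<times> {c..e} \<subseteq> V\<close> by blast
      ultimately show "\<exists>\<sigma>. lifts (top_of_set ({a..b} \<times> {c..e})) K \<rho> \<sigma>"
        by (intro exI[of _ "\<lambda>y. \<phi> (K y, 1)"]) (simp only: subtopology_subtopology)
    qed
    then show ?thesis using r(1) by (intro exI[of _ "r / 2"]) auto
  qed
  \<comment> \<open>As definitions, \<open>thin\<close> and \<open>full\<close> protect the bounds 0 and 1 of the fixed side from being
    generalised together with those of the interval on which the induction runs.\<close>
  define thin where
    "thin = (\<lambda>x c e. \<exists>d>0. \<forall>a b. a \<le> x \<and> x \<le> b \<and> b - a < d \<longrightarrow> L ({a..b} \<times> {c..e}))"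
  have strip: "thin x 0 1" if x: "0 \<le> x" "x \<le> 1" for x
  proof -
    have "0 \<le> (1 :: real)" by simp
    then show ?thesis
    proof (induct rule: Bolzano)
      case (trans c e f)
      obtain d1 where d1: "d1 > 0"
        "\<And>a b. a \<le> x \<and> x \<le> b \<and> b - a < d1 \<Longrightarrow> L ({a..b} \<times> {c..e})"
        using trans(1) unfolding thin_def by blast
      obtain d2 where d2: "d2 > 0"
        "\<And>a b. a \<le> x \<and> x \<le> b \<and> b - a < d2 \<Longrightarrow> L ({a..b} \<times> {e..f})"
        using trans(2) unfolding thin_def by blast
      have "L ({a..b} \<times> {c..f})" if "a \<le> x" "x \<le> b" "b - a < min d1 d2" for a b
      proof -
        have eq: "{a..b} \<times> {c..f} = {a..b} \<times> {c..e} \<union> {a..b} \<times> {e..f}"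
          using trans by auto
        have "({a..b} \<times> {c..e}) \<inter> ({a..b} \<times> {e..f}) = {a..b} \<times> {e}"
          using trans by auto
        then have "connected (({a..b} \<times> {c..e}) \<inter> ({a..b} \<times> {e..f}))"
          by (simp add: connected_Times)
        then show ?thesis unfolding eq using that d1 d2
          by (intro Un) (auto intro: closed_Times)
      qed
      then show ?case using d1(1) d2(1) unfolding thin_def by (intro exI[of _ "min d1 d2"]) auto
    next
      case (local y)
      then obtain d where d: "d > 0" "\<forall>a b c e. a \<le> x \<and> x \<le> b \<and> b - a < d \<and> c \<le> y \<and> y \<le> e \<and> e - c < d \<longrightarrow>
          L ({a..b} \<times> {c..e})" using pt[of x y] x by auto
      then show ?case unfolding thin_def by blast
    qed
  qed
  define full where "full = (\<lambda>a b. L ({a..b} \<times> {0..1}))"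
  have "0 \<le> (1 :: real)" by simp
  then have "full 0 1"
  proof (induct rule: Bolzano)
    case (trans c e f)
    have eq: "{c..f} \<times> {0..1} = {c..e} \<times> {0..1} \<union> {e..f} \<times> {0..1::real}"
      using trans by auto
    have "({c..e} \<times> {0..1}) \<inter> ({e..f} \<times> {0..1}) = {e} \<times> {0..1::real}"
      using trans by auto
    then have "connected (({c..e} \<times> {0..1}) \<inter> ({e..f} \<times> {0..1::real}))"
      by (simp add: connected_Times)
    then show ?case unfolding full_def eq using trans
      by (intro Un) (auto intro: closed_Times simp: full_def)
  next
    case (local x)
    show ?case using strip[OF local] unfolding thin_def full_def .
  qed
  then have "L ?Q" by (simp add: full_def)
  then show ?thesis using that by (auto simp: L_def)
qed


text \<open>Parallel transport along the track of \<open>x\<close> under a homotopy \<open>H\<close>, as a relation between its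
  initial and its final point.\<close>

definition transports ::
    "(real \<times> 'w \<Rightarrow> 'w) \<Rightarrow> ('w, 'p) psl2_bundle \<Rightarrow> 'w \<Rightarrow> 'p \<Rightarrow> 'p \<Rightarrow> bool" where
  "transports H \<rho> x y y' \<longleftrightarrow>
     (\<exists>\<sigma>. lifts (top_of_set {0..1}) (\<lambda>r. H (r, x)) \<rho> \<sigma> \<and> \<sigma> 0 = y \<and> \<sigma> 1 = y')"

lemma continuous_map_track:
  assumes "continuous_map (prod_topology (top_of_set {0..1::real}) W) W H" "x \<in> topspace W"
  shows "continuous_map (top_of_set {0..1}) W (\<lambda>r. H (r, x))"
proof -
  have "continuous_map (top_of_set {0..1}) (prod_topology (top_of_set {0..1}) W) (\<lambda>r. (r, x))"
    by (intro continuous_map_pairedI) (use assms(2) in auto)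
  from continuous_map_compose[OF this assms(1)] show ?thesis by (simp add: o_def)
qed

lemma transports_unique:
  assumes fl: "flat_psl2_bundle W \<rho>"
    and H: "continuous_map (prod_topology (top_of_set {0..1}) W) W H" and x: "x \<in> topspace W"
    and y: "transports H \<rho> x y y1" "transports H \<rho> x y y2"
  shows "y1 = y2"
proof -
  let ?I = "top_of_set {0..1 :: real}"
  note K = continuous_map_track[OF H x]
  obtain \<sigma> \<tau> where \<sigma>: "lifts ?I (\<lambda>r. H (r, x)) \<rho> \<sigma>" "\<sigma> 0 = y" "\<sigma> 1 = y1"
    and \<tau>: "lifts ?I (\<lambda>r. H (r, x)) \<rho> \<tau>" "\<tau> 0 = y" "\<tau> 1 = y2"
    using y unfolding transports_def by blast
  have "connected_space ?I" by (simp add: connected_space_subtopology connectedin_iff_connected)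
  then obtain g where g: "\<And>r. r \<in> topspace ?I \<Longrightarrow> \<tau> r = action \<rho> (\<sigma> r) g"
    using lifts_differ_by_constant[OF fl K _ \<sigma>(1) \<tau>(1)] by blast
  have "0 \<in> topspace ?I" by simp
  obtain V \<phi> where V: "openin ?I V" "0 \<in> V" and
      a: "\<And>f. continuous_map (subtopology ?I V) (discrete_topology UNIV) f \<Longrightarrow>
         lifts (subtopology ?I V) (\<lambda>r. H (r, x)) \<rho> (\<lambda>r. \<phi> (H (r, x), f r))" and
      b: "\<And>\<sigma>. lifts ?I (\<lambda>r. H (r, x)) \<rho> \<sigma> \<Longrightarrow>
         \<exists>f. continuous_map (subtopology ?I V) (discrete_topology UNIV) f \<and>
         (\<forall>r\<in>V. \<sigma> r = \<phi> (H (r, x), f r))" and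
      c: "\<And>r g h. r \<in> V \<Longrightarrow> action \<rho> (\<phi> (H (r, x), g)) h = \<phi> (H (r, x), g * h)" and
      d: "\<And>r g h. r \<in> V \<Longrightarrow> \<phi> (H (r, x), g) = \<phi> (H (r, x), h) \<Longrightarrow> g = h"
      by (rule local_coordinates[OF fl K \<open>0 \<in> topspace ?I\<close>]) (rule that)
  obtain f where "\<forall>r\<in>V. \<sigma> r = \<phi> (H (r, x), f r)" using b[OF \<sigma>(1)] by blast
  then have "\<sigma> 0 = \<phi> (H (0, x), f 0)" using V(2) by blast
  moreover have "\<sigma> 0 = action \<rho> (\<sigma> 0) g" using g[of 0] \<sigma>(2) \<tau>(2) by simp
  ultimately have "\<phi> (H (0, x), f 0) = \<phi> (H (0, x), f 0 * g)" using c[OF V(2)] by simp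
  then have "f 0 * 1 = f 0 * g" using d[OF V(2)] by simp
  then have "g = 1" using psl2_cancel_left by metis
  moreover have "\<sigma> 1 \<in> topspace (total \<rho>)" using lifts_topspace[OF \<sigma>(1)] by simp
  ultimately show ?thesis using g[of 1] \<sigma>(3) \<tau>(3) fl by (simp add: flat_psl2_bundle_def)
qed

lemma transports_action:
  assumes fl: "flat_psl2_bundle W \<rho>"
    and H: "continuous_map (prod_topology (top_of_set {0..1}) W) W H" and x: "x \<in> topspace W"
    and y: "transports H \<rho> x y y'"
  shows "transports H \<rho> x (action \<rho> y g) (action \<rho> y' g)"
  using y lifts_action[OF fl continuous_map_track[OF H x]] unfolding transports_def by metis

text \<open>A path \<open>p\<close> and a homotopy span a square. Its lift can be chosen to extend \<open>\<gamma>\<close>, since the two differ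
  by a constant, and the opposite side is then a lift of the transported path.\<close>

lemma transports_path:
  fixes p :: "real \<Rightarrow> 'w"
  assumes fl: "flat_psl2_bundle W \<rho>"
    and H: "continuous_map (prod_topology (top_of_set {0..1}) W) W H"
    and H0: "\<And>x. x \<in> topspace W \<Longrightarrow> H (0, x) = x"
    and p: "continuous_map (top_of_set {0..1}) W p" and \<gamma>: "lifts (top_of_set {0..1}) p \<rho> \<gamma>"
  obtains \<gamma>' where "lifts (top_of_set {0..1}) (\<lambda>u. H (1, p u)) \<rho> \<gamma>'"
    "\<And>u. u \<in> {0..1} \<Longrightarrow> transports H \<rho> (p u) (\<gamma> u) (\<gamma>' u)"
proof -
  let ?I = "top_of_set {0..1 :: real}"
  let ?Q = "top_of_set ({0..1 :: real} \<times> {0..1 :: real})"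
  define K where "K = (\<lambda>(r, u). H (r, p u))"
  have Q: "?Q = prod_topology ?I ?I" by (simp add: prod_topology_subtopology_eu)
  have "continuous_map ?Q (prod_topology ?I W) (\<lambda>q. (fst q, p (snd q)))"
    unfolding Q using continuous_map_compose[OF continuous_map_snd[of ?I ?I] p]
    by (intro continuous_map_pairedI continuous_map_fst) (simp add: o_def)
  from continuous_map_compose[OF this H] have K: "continuous_map ?Q W K"
    by (simp add: K_def o_def case_prod_unfold)
  obtain \<sigma> where \<sigma>: "lifts ?Q K \<rho> \<sigma>" using lift_square[OF fl K] by blast
  have vert: "continuous_map ?I ?Q (\<lambda>u. (r, u))" and hor: "continuous_map ?I ?Q (\<lambda>u. (u, r))"
    if "r \<in> {0..1}" for r
    unfolding Q using that by (auto intro!: continuous_map_pairedI continuous_intros)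
  have pW: "p u \<in> topspace W" if "u \<in> {0..1}" for u
    using p that by (auto simp: continuous_map_def Pi_iff)
  have "lifts ?I p \<rho> (\<lambda>u. \<sigma> (0, u))"
    by (rule lifts_compose[OF \<sigma> vert]) (use H0 pW in \<open>auto simp: K_def\<close>)
  moreover have "connected_space ?I" by (simp add: connected_space_subtopology connectedin_iff_connected)
  ultimately obtain g where g: "\<And>u. u \<in> topspace ?I \<Longrightarrow> \<gamma> u = action \<rho> (\<sigma> (0, u)) g"
    using lifts_differ_by_constant[OF fl p _ _ \<gamma>] by blast
  define \<tau> where "\<tau> = (\<lambda>q. action \<rho> (\<sigma> q) g)"
  have \<tau>: "lifts ?Q K \<rho> \<tau>" unfolding \<tau>_def by (rule lifts_action[OF fl K \<sigma>])
  show ?thesis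
  proof (rule that[of "\<lambda>u. \<tau> (1, u)"])
    show "lifts ?I (\<lambda>u. H (1, p u)) \<rho> (\<lambda>u. \<tau> (1, u))"
      by (rule lifts_compose[OF \<tau> vert]) (auto simp: K_def)
    fix u :: real assume u: "u \<in> {0..1}"
    have "lifts ?I (\<lambda>r. H (r, p u)) \<rho> (\<lambda>r. \<tau> (r, u))"
      by (rule lifts_compose[OF \<tau> hor[OF u]]) (auto simp: K_def)
    then show "transports H \<rho> (p u) (\<gamma> u) (\<tau> (1, u))"
      using g[of u] u unfolding transports_def by (intro exI[of _ "\<lambda>r. \<tau> (r, u)"]) (simp add: \<tau>_def)
  qed
qed

lemma edge_point_in_simplex:
  assumes "a < 4" "b < 4" "a \<noteq> b" "r \<in> {0..1}"
  shows "edge_point a b r \<in> standard_simplex 3"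
proof -
  have "(\<Sum>i\<le>3. edge_point a b r i) = (\<Sum>i\<in>{a, b}. edge_point a b r i)"
    using assms by (intro sum.mono_neutral_right) (auto simp: edge_point_def)
  then show ?thesis using assms by (auto simp: standard_simplex_def edge_point_def)
qed

lemma edge_point_1: "a \<noteq> b \<Longrightarrow> edge_point a b 1 = edge_point b a 0"
  by (auto simp: edge_point_def)

lemma continuous_map_edge_path:
  assumes "singular_simplex 3 W f" "a < 4" "b < 4" "a \<noteq> b"
  shows "continuous_map (top_of_set {0..1}) W (\<lambda>r. f (edge_point a b r))"
proof -
  have c: "continuous_map (subtopology (powertop_real UNIV) (standard_simplex 3)) W f"
    using assms(1) by (simp add: singular_simplex_def)
  have "continuous_map (top_of_set {0..1}) (powertop_real UNIV) (edge_point a b)"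
  proof (rule continuous_map_componentwise_UNIV[THEN iffD2], intro allI)
    fix i
    have "continuous_on {0..1} (\<lambda>r. edge_point a b r i)"
      by (cases "i = a"; cases "i = b") (auto simp: edge_point_def intro!: continuous_intros)
    then show "continuous_map (top_of_set {0..1}) euclideanreal (\<lambda>r. edge_point a b r i)" by simp
  qed
  then have "continuous_map (top_of_set {0..1}) (subtopology (powertop_real UNIV) (standard_simplex 3)) (edge_point a b)"
    by (rule continuous_map_into_subtopology) (use edge_point_in_simplex assms in auto)
  from continuous_map_compose[OF this c] show ?thesis by (simp add: o_def)
qed

lemma represents_iff:
  "represents T z \<rho> \<longleftrightarrow> (\<exists>s. \<forall>(t, a, b)\<in>oriented_edges T.
     \<exists>\<gamma>. lifts (top_of_set {0..1}) (\<lambda>r. chart T t (edge_point a b r)) \<rho> \<gamma> \<and>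
       \<gamma> 0 = s (chart T t (edge_point a b 0)) \<and>
       action \<rho> (\<gamma> 1) (z (t, a, b)) = s (chart T t (edge_point a b 1)))"
  unfolding represents_def lifts_def by simp

text \<open>Conjugation corresponds to moving all points chosen over the vertices by the same element.\<close>

lemma represents_conjugate:
  assumes fl: "flat_psl2_bundle W \<rho>" and T: "\<forall>t\<in>tets T. singular_simplex 3 W (chart T t)"
    and z: "represents T z \<rho>"
  shows "represents T (\<lambda>e. inverse g * z e * g) \<rho>"
proof -
  obtain s where s: "\<forall>(t, a, b)\<in>oriented_edges T.
     \<exists>\<gamma>. lifts (top_of_set {0..1}) (\<lambda>r. chart T t (edge_point a b r)) \<rho> \<gamma> \<and>
       \<gamma> 0 = s (chart T t (edge_point a b 0)) \<and>
       action \<rho> (\<gamma> 1) (z (t, a, b)) = s (chart T t (edge_point a b 1))"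
    using z unfolding represents_iff by blast
  have ac: "action \<rho> (action \<rho> y h) k = action \<rho> y (h * k)" if "y \<in> topspace (total \<rho>)" for y h k
    using fl that by (simp add: flat_psl2_bundle_def)
  show ?thesis
    unfolding represents_iff
  proof (intro exI[of _ "\<lambda>v. action \<rho> (s v) g"] ballI, clarify)
    fix t a b assume e: "(t, a, b) \<in> oriented_edges T"
    then obtain \<gamma> where \<gamma>: "lifts (top_of_set {0..1}) (\<lambda>r. chart T t (edge_point a b r)) \<rho> \<gamma>"
       "\<gamma> 0 = s (chart T t (edge_point a b 0))"
       "action \<rho> (\<gamma> 1) (z (t, a, b)) = s (chart T t (edge_point a b 1))" using s by fast
    have p: "continuous_map (top_of_set {0..1}) W (\<lambda>r. chart T t (edge_point a b r))"
      using e T by (intro continuous_map_edge_path) (auto simp: oriented_edges_def)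
    have "\<gamma> 1 \<in> topspace (total \<rho>)" using lifts_topspace[OF \<gamma>(1)] by simp
    then have "action \<rho> (action \<rho> (\<gamma> 1) g) (inverse g * z (t, a, b) * g) =
        action \<rho> (action \<rho> (\<gamma> 1) (z (t, a, b))) g"
      by (simp add: ac mult.assoc[symmetric] psl2_right_inverse)
    with \<gamma> lifts_action[OF fl p \<gamma>(1), of g]
    show "\<exists>\<gamma>. lifts (top_of_set {0..1}) (\<lambda>r. chart T t (edge_point a b r)) \<rho> \<gamma> \<and>
       \<gamma> 0 = action \<rho> (s (chart T t (edge_point a b 0))) g \<and>
       action \<rho> (\<gamma> 1) (inverse g * z (t, a, b) * g) = action \<rho> (s (chart T t (edge_point a b 1))) g"
      by (intro exI[of _ "\<lambda>r. action \<rho> (\<gamma> r) g"]) simp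
  qed
qed

text \<open>Two triangulations may be placed in \<open>W\<close> in different ways, with corresponding edges that agree
  only after applying a map homotopic to the identity. The points chosen over the vertices are then
  transported along the homotopy. For this to be well defined, \<open>F\<close> must assign to each vertex of \<open>T\<close>
  the position of a vertex of \<open>T'\<close>, whichever tetrahedron of \<open>T\<close> is used to name the vertex.\<close>

lemma represents_via_homotopy:
  assumes fl: "flat_psl2_bundle W \<rho>" and hom: "homotopic_with (\<lambda>_. True) W W h id"
    and T': "\<forall>t\<in>tets T'. singular_simplex 3 W (chart T' t)" and z': "represents T' z' \<rho>"
    and edges: "\<And>t a b. (t, a, b) \<in> oriented_edges T \<Longrightarrow> \<exists>t' a' b'. (t', a', b') \<in> oriented_edges T' \<and>
       z (t, a, b) = z' (t', a', b') \<and>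
       (\<forall>r\<in>{0..1}. h (chart T' t' (edge_point a' b' r)) = chart T t (edge_point a b r)) \<and>
       chart T' t' (edge_point a' b' 0) = F (t, a) \<and> chart T' t' (edge_point a' b' 1) = F (t, b)"
    and F: "\<And>t a b t1 a1 b1. (t, a, b) \<in> oriented_edges T \<Longrightarrow> (t1, a1, b1) \<in> oriented_edges T \<Longrightarrow>
       chart T t (edge_point a b 0) = chart T t1 (edge_point a1 b1 0) \<Longrightarrow> F (t, a) = F (t1, a1)"
  shows "represents T z \<rho>"
proof -
  let ?I = "top_of_set {0..1 :: real}"
  obtain H where H: "continuous_map (prod_topology ?I W) W H"
    and "\<forall>x. H (0, x) = x" and "\<forall>x. H (1, x) = h x"
    using homotopic_with_symD[OF hom] unfolding homotopic_with_def id_apply by blast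
  then have H0: "\<And>x. H (0, x) = x" and H1: "\<And>x. H (1, x) = h x" by blast+
  obtain s' where s': "\<forall>(t, a, b)\<in>oriented_edges T'.
     \<exists>\<gamma>. lifts ?I (\<lambda>r. chart T' t (edge_point a b r)) \<rho> \<gamma> \<and>
       \<gamma> 0 = s' (chart T' t (edge_point a b 0)) \<and>
       action \<rho> (\<gamma> 1) (z' (t, a, b)) = s' (chart T' t (edge_point a b 1))"
    using z' unfolding represents_iff by blast
  define S where "S = (\<lambda>v y. \<exists>t a b. (t, a, b) \<in> oriented_edges T \<and>
     v = chart T t (edge_point a b 0) \<and> transports H \<rho> (F (t, a)) (s' (F (t, a))) y)"
  define s where "s = (\<lambda>v. THE y. S v y)"
  have FW: "F (t, a) \<in> topspace W" if "(t, a, b) \<in> oriented_edges T" for t a b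
  proof -
    obtain t' a' b' where e': "(t', a', b') \<in> oriented_edges T'" "chart T' t' (edge_point a' b' 0) = F (t, a)"
      using edges \<open>(t, a, b) \<in> oriented_edges T\<close> by metis
    have "continuous_map ?I W (\<lambda>r. chart T' t' (edge_point a' b' r))"
      using e' T' by (intro continuous_map_edge_path) (auto simp: oriented_edges_def)
    then have "chart T' t' (edge_point a' b' 0) \<in> topspace W"
      by (rule continuous_map_funspace[THEN funcset_mem]) simp
    then show ?thesis by (simp only: e'(2))
  qed
  have sS: "s (chart T t (edge_point a b 0)) = y"
    if e: "(t, a, b) \<in> oriented_edges T" and y: "transports H \<rho> (F (t, a)) (s' (F (t, a))) y" for t a b y
    unfolding s_def
  proof (rule the_equality)
    show "S (chart T t (edge_point a b 0)) y" using e y unfolding S_def by blast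
    fix y' assume "S (chart T t (edge_point a b 0)) y'"
    then obtain t1 a1 b1 where 1: "(t1, a1, b1) \<in> oriented_edges T"
      "chart T t (edge_point a b 0) = chart T t1 (edge_point a1 b1 0)"
      "transports H \<rho> (F (t1, a1)) (s' (F (t1, a1))) y'" unfolding S_def by blast
    then have "F (t, a) = F (t1, a1)" using F e by blast
    then show "y' = y" using 1(3) y transports_unique[OF fl H FW[OF e]] by metis
  qed
  show ?thesis
    unfolding represents_iff
  proof (intro exI[of _ s] ballI, clarify)
    fix t a b assume e: "(t, a, b) \<in> oriented_edges T"
    then have e2: "(t, b, a) \<in> oriented_edges T" and "a \<noteq> b" by (auto simp: oriented_edges_def)
    obtain t' a' b' where e': "(t', a', b') \<in> oriented_edges T'" "z (t, a, b) = z' (t', a', b')"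
      "\<And>r. r \<in> {0..1} \<Longrightarrow> h (chart T' t' (edge_point a' b' r)) = chart T t (edge_point a b r)"
      "chart T' t' (edge_point a' b' 0) = F (t, a)" "chart T' t' (edge_point a' b' 1) = F (t, b)"
      using edges[OF e] by blast
    obtain \<gamma> where \<gamma>: "lifts ?I (\<lambda>r. chart T' t' (edge_point a' b' r)) \<rho> \<gamma>"
       "\<gamma> 0 = s' (F (t, a))" "action \<rho> (\<gamma> 1) (z (t, a, b)) = s' (F (t, b))"
      using s' e' by fastforce
    have p: "continuous_map ?I W (\<lambda>r. chart T' t' (edge_point a' b' r))"
      using e' T' by (intro continuous_map_edge_path) (auto simp: oriented_edges_def)
    obtain \<gamma>' where \<gamma>': "lifts ?I (\<lambda>r. H (1, chart T' t' (edge_point a' b' r))) \<rho> \<gamma>'"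
      and tr: "\<And>u. u \<in> {0..1} \<Longrightarrow> transports H \<rho> (chart T' t' (edge_point a' b' u)) (\<gamma> u) (\<gamma>' u)"
      using transports_path[OF fl H H0 p \<gamma>(1)] by blast
    have "lifts ?I (\<lambda>r. chart T t (edge_point a b r)) \<rho> \<gamma>'"
      using \<gamma>' e'(3) by (auto simp: lifts_def H1)
    moreover have "\<gamma>' 0 = s (chart T t (edge_point a b 0))"
      using sS[OF e] tr[of 0] \<gamma>(2) e'(4) by simp
    moreover have "action \<rho> (\<gamma>' 1) (z (t, a, b)) = s (chart T t (edge_point b a 0))"
      using sS[OF e2] transports_action[OF fl H FW[OF e2], of "\<gamma> 1" "\<gamma>' 1" "z (t, a, b)"]
        tr[of 1] \<gamma>(3) e'(5) by simp
    ultimately show "\<exists>\<gamma>. lifts ?I (\<lambda>r. chart T t (edge_point a b r)) \<rho> \<gamma> \<and>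
       \<gamma> 0 = s (chart T t (edge_point a b 0)) \<and>
       action \<rho> (\<gamma> 1) (z (t, a, b)) = s (chart T t (edge_point a b 1))"
      using edge_point_1[OF \<open>a \<noteq> b\<close>] by auto
  qed
qed

section \<open>Moduli as ratios of slope differences\<close>

lemma det_rep_psl2: "det (rep_psl2 g) = 1"
  using Quotient_rep_reflp[OF Quotient_psl2] by simp

lemma moebius_one: "moebius 1 x = x"
  by transfer (auto simp: moebius_mat_def mat2_one_nth split: cp1.split)

lemma moebius_inverse: "moebius (inverse g) (moebius g x) = x"
  by (simp add: moebius_mult[symmetric] psl2_left_inverse moebius_one)

lemma moebius_eq_iff: "moebius g x = moebius g y \<longleftrightarrow> x = y"
  by (metis moebius_inverse)

lemma moebius_inverse_eq_iff: "moebius (inverse g) x = y \<longleftrightarrow> x = moebius g y"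
proof -
  have "moebius g (moebius (inverse g) x) = x"
    by (simp add: moebius_mult[symmetric] psl2_right_inverse moebius_one)
  then show ?thesis using moebius_eq_iff[of g "moebius (inverse g) x" y] by simp
qed

fun reciprocal :: "cp1 \<Rightarrow> complex" where
  "reciprocal (Aff u) = inverse u"
| "reciprocal Infty = 0"

text \<open>In the coordinate \<open>1/u\<close> the parabolic elements fixing 0 act by translations, so differences of
  slopes are invariant under conjugation by them.\<close>

definition slope :: "psl2 \<Rightarrow> complex" where
  "slope g = reciprocal (moebius g (Aff 0))"

text \<open>Composing \<open>g\<close> with the inversion sends \<open>p\<close> to infinity, so in terms of \<open>1 / (x - p)\<close> it is an affine
  map.\<close>

lemma reciprocal_moebius_diff:
  assumes "moebius g (Aff p) = Aff 0"
  obtains k where "k \<noteq> 0"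
    "\<And>x y. x \<noteq> p \<Longrightarrow> y \<noteq> p \<Longrightarrow> reciprocal (moebius g (Aff x)) - reciprocal (moebius g (Aff y)) =
       k * (y - x) / ((x - p) * (y - p))"
proof -
  define A where "A = rep_psl2 g"
  define \<alpha> \<beta> \<gamma> \<delta> where "\<alpha> = A$1$1" and "\<beta> = A$1$2" and "\<gamma> = A$2$1" and "\<delta> = A$2$2"
  have m: "moebius g (Aff x) = (if \<gamma> * x + \<delta> = 0 then Infty else Aff ((\<alpha> * x + \<beta>) / (\<gamma> * x + \<delta>)))" for x
    by (simp add: moebius.rep_eq moebius_mat_def A_def \<alpha>_def \<beta>_def \<gamma>_def \<delta>_def)
  have d: "\<alpha> * \<delta> - \<beta> * \<gamma> = 1"
    using det_rep_psl2[of g] by (simp add: det_2 A_def \<alpha>_def \<beta>_def \<gamma>_def \<delta>_def)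
  have "\<gamma> * p + \<delta> \<noteq> 0" "\<alpha> * p + \<beta> = 0"
    using assms m[of p] by (auto split: if_splits)
  then have b: "\<beta> = - (\<alpha> * p)" by (simp add: eq_neg_iff_add_eq_0 add.commute)
  have a: "\<alpha> \<noteq> 0" using d b by auto
  have r: "reciprocal (moebius g (Aff x)) = (\<gamma> * x + \<delta>) / (\<alpha> * (x - p))" for x
    by (simp add: m b right_diff_distrib)
  show ?thesis
  proof (rule that[of "(\<gamma> * p + \<delta>) / \<alpha>"])
    show "(\<gamma> * p + \<delta>) / \<alpha> \<noteq> 0" using a \<open>\<gamma> * p + \<delta> \<noteq> 0\<close> by simp
    show "reciprocal (moebius g (Aff x)) - reciprocal (moebius g (Aff y)) =
       (\<gamma> * p + \<delta>) / \<alpha> * (y - x) / ((x - p) * (y - p))" if "x \<noteq> p" "y \<noteq> p" for x y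
    proof -
      have "x - p \<noteq> 0" "y - p \<noteq> 0" using that by auto
      then show ?thesis unfolding r using a by (simp add: divide_simps) (simp add: algebra_simps)
    qed
  qed
qed

lemma mfaces_iff:
  "(t, a, b, c) \<in> mfaces T \<longleftrightarrow> t \<in> tets T \<and> a < 4 \<and> b < 4 \<and> c < 4 \<and> a \<noteq> b \<and> b \<noteq> c \<and> a \<noteq> c"
  by (auto simp: mfaces_def)

lemma cocycle_mult:
  assumes "cocycle T z" "(t, a, b, c) \<in> mfaces T"
  shows "z (t, a, b) * z (t, b, c) = z (t, a, c)"
  using assms unfolding cocycle_def by fast

lemma cocycle_inverse:
  assumes "cocycle T z" "(t, a, b) \<in> oriented_edges T"
  shows "z (t, b, a) = inverse (z (t, a, b))"
  using assms unfolding cocycle_def by fast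

lemma inverse_psl2_mult_cancel: "inverse (g::psl2) * (g * h) = h"
  by (simp add: mult.assoc[symmetric] psl2_left_inverse)

lemma psl2_mult_inverse_cancel: "(g::psl2) * (inverse g * h) = h"
  by (simp add: mult.assoc[symmetric] psl2_right_inverse)

lemma less_4_cases: "(i::nat) < 4 \<Longrightarrow> i = 0 \<or> i = 1 \<or> i = 2 \<or> i = 3"
  by linarith

lemma orders_less_4: "orders b t v \<Longrightarrow> i < 4 \<Longrightarrow> v i < 4"
  using permutes_in_image[of v "{..<4}" i] by (auto simp: orders_def)

lemma orders_inj: "orders b t v \<Longrightarrow> v i = v j \<longleftrightarrow> i = j"
  using permutes_inj by (auto simp: orders_def dest: injD)

definition from_first :: "'t cochain \<Rightarrow> 't \<Rightarrow> (nat \<Rightarrow> nat) \<Rightarrow> nat \<Rightarrow> psl2" where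
  "from_first z t v k = (if k = 0 then 1 else z (t, v 0, v k))"

lemma cocycle_conv_from_first:
  assumes z: "cocycle T z" and t: "t \<in> tets T" and v: "orders b t v"
    and ij: "i < 4" "j < 4" "i \<noteq> j"
  shows "z (t, v i, v j) = inverse (from_first z t v i) * from_first z t v j"
proof -
  note vl = orders_less_4[OF v] and vi = orders_inj[OF v]
  have inv: "z (t, v i, v 0) = inverse (z (t, v 0, v i))" if "i \<noteq> 0"
    by (rule cocycle_inverse[OF z]) (use t vl vi ij that in \<open>auto simp: oriented_edges_def\<close>)
  have m: "z (t, v i, v 0) * z (t, v 0, v j) = z (t, v i, v j)" if "i \<noteq> 0" "j \<noteq> 0"
    by (rule cocycle_mult[OF z]) (use t vl vi ij that in \<open>auto simp: mfaces_iff\<close>)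
  have "inverse (1::psl2) = 1" by (metis mult.right_neutral psl2_left_inverse)
  then show ?thesis using m inv ij by (cases "i = 0"; cases "j = 0") (auto simp: from_first_def)
qed

lemma ideal_point_conv:
  assumes z: "cocycle T z" and t: "t \<in> tets T" and v: "orders b t v" and k: "k < 4"
  shows "ideal_point b z t k = moebius (from_first z t v k) (Aff 0)"
proof -
  note vl = orders_less_4[OF v] and vi = orders_inj[OF v]
  have 2: "z (t, v 0, v 1) * z (t, v 1, v 2) = z (t, v 0, v 2)"
    by (rule cocycle_mult[OF z]) (use t vl vi in \<open>simp add: mfaces_iff\<close>)
  have 3: "z (t, v 0, v 2) * z (t, v 2, v 3) = z (t, v 0, v 3)"
    by (rule cocycle_mult[OF z]) (use t vl vi in \<open>simp add: mfaces_iff\<close>)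
  show ?thesis using less_4_cases[OF k]
    by (elim disjE)
      (simp_all add: ideal_point_def Let_def vertex_order_eq[OF v] 2[simplified] 3[simplified]
        moebius_one from_first_def)
qed

lemma aff_ideal_point_eq_iff:
  assumes id: "idealizable b z t" and pq: "p < 4" "q < 4"
  shows "aff (ideal_point b z t p) = aff (ideal_point b z t q) \<longleftrightarrow> p = q"
proof
  assume "aff (ideal_point b z t p) = aff (ideal_point b z t q)"
  moreover have "ideal_point b z t p \<noteq> Infty" "ideal_point b z t q \<noteq> Infty"
    using id pq by (force simp: idealizable_def)+
  ultimately have "ideal_point b z t p = ideal_point b z t q" by (metis cp1.exhaust_sel)
  then show "p = q" using id pq by (auto simp: idealizable_def inj_on_def)
qed simp

text \<open>The developed vertices i and j differ by the transport of 0 along the edge between them.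
  Thus distinctness is a condition on every edge, whereas finiteness is one on the edges from the
  smallest vertex only. An edge may start at the smallest vertex of one tetrahedron and not of
  another, so a cocycle that is idealizable on one side of a move may fail to be so on the other
  side.\<close>

lemma idealizable_iff:
  assumes "cocycle T z" "t \<in> tets T" "orders b t v"
  shows "idealizable b z t \<longleftrightarrow>
    (\<forall>i<4. \<forall>j<4. i \<noteq> j \<longrightarrow> moebius (z (t, v i, v j)) (Aff 0) \<noteq> Aff 0) \<and>
    (\<forall>j<4. j \<noteq> 0 \<longrightarrow> moebius (z (t, v 0, v j)) (Aff 0) \<noteq> Infty)"
proof -
  note z = assms(1) and t = assms(2) and v = assms(3)
  have "moebius (z (t, v i, v j)) (Aff 0) = Aff 0 \<longleftrightarrow> ideal_point b z t j = ideal_point b z t i"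
    if "i < 4" "j < 4" "i \<noteq> j" for i j
    by (simp add: cocycle_conv_from_first[OF assms that] ideal_point_conv[OF assms that(1)]
        ideal_point_conv[OF assms that(2)] moebius_mult moebius_inverse_eq_iff)
  then have "inj_on (ideal_point b z t) {..<4} \<longleftrightarrow>
      (\<forall>i<4. \<forall>j<4. i \<noteq> j \<longrightarrow> moebius (z (t, v i, v j)) (Aff 0) \<noteq> Aff 0)"
    unfolding inj_on_def by (metis lessThan_iff)
  moreover have "Infty \<notin> ideal_point b z t ` {..<4} \<longleftrightarrow>
      (\<forall>j<4. j \<noteq> 0 \<longrightarrow> moebius (z (t, v 0, v j)) (Aff 0) \<noteq> Infty)"
  proof
    assume "Infty \<notin> ideal_point b z t ` {..<4}"
    then have "ideal_point b z t j \<noteq> Infty" if "j < 4" for j using that by force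
    then show "\<forall>j<4. j \<noteq> 0 \<longrightarrow> moebius (z (t, v 0, v j)) (Aff 0) \<noteq> Infty"
      using ideal_point_conv[OF assms] by (metis from_first_def)
  next
    assume *: "\<forall>j<4. j \<noteq> 0 \<longrightarrow> moebius (z (t, v 0, v j)) (Aff 0) \<noteq> Infty"
    have "ideal_point b z t j \<noteq> Infty" if "j < 4" for j
      using ideal_point_conv[OF assms that] * that by (auto simp: moebius_one from_first_def)
    then show "Infty \<notin> ideal_point b z t ` {..<4}" by force
  qed
  ultimately show ?thesis unfolding idealizable_def by blast
qed

definition slope_diff :: "'t cochain \<Rightarrow> 't mface \<Rightarrow> complex" where
  "slope_diff z = (\<lambda>(t, a, b, c). slope (z (t, a, c)) - slope (z (t, a, b)))"

text \<open>Seen from the vertex \<open>v i\<close>, that is, after moving \<open>v i\<close> to 0 by parallel transport and to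
  infinity by inversion, the other vertices are the slopes.\<close>

lemma slope_diff_developed:
  assumes z: "cocycle T z" and t: "t \<in> tets T" and v: "orders b t v" and id: "idealizable b z t"
    and i: "i < 4"
  obtains k where "k \<noteq> 0"
    "\<And>j l. j < 4 \<Longrightarrow> l < 4 \<Longrightarrow> j \<noteq> i \<Longrightarrow> l \<noteq> i \<Longrightarrow> slope_diff z (t, v i, v j, v l) =
       k * (aff (ideal_point b z t j) - aff (ideal_point b z t l)) /
       ((aff (ideal_point b z t l) - aff (ideal_point b z t i)) *
        (aff (ideal_point b z t j) - aff (ideal_point b z t i)))"
proof -
  define Z where "Z = from_first z t v"
  define u where "u = (\<lambda>k. aff (ideal_point b z t k))"
  have U: "moebius (Z k) (Aff 0) = Aff (u k)" if "k < 4" for k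
  proof -
    have "ideal_point b z t k \<noteq> Infty" using id that by (force simp: idealizable_def)
    then show ?thesis
      using ideal_point_conv[OF z t v that] by (cases "ideal_point b z t k") (auto simp: Z_def u_def)
  qed
  have une: "u j \<noteq> u i" if "j < 4" "j \<noteq> i" for j
    using aff_ideal_point_eq_iff[OF id that(1) i] that(2) by (simp add: u_def)
  have "moebius (inverse (Z i)) (Aff (u i)) = Aff 0"
    using U[OF i] moebius_inverse by metis
  then obtain k where k: "k \<noteq> 0"
    "\<And>x y. x \<noteq> u i \<Longrightarrow> y \<noteq> u i \<Longrightarrow>
       reciprocal (moebius (inverse (Z i)) (Aff x)) - reciprocal (moebius (inverse (Z i)) (Aff y)) =
       k * (y - x) / ((x - u i) * (y - u i))"
    using reciprocal_moebius_diff by blast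
  have s: "slope (z (t, v i, v j)) = reciprocal (moebius (inverse (Z i)) (Aff (u j)))"
    if "j < 4" "j \<noteq> i" for j
  proof -
    have "z (t, v i, v j) = inverse (Z i) * Z j"
      using cocycle_conv_from_first[OF z t v i that(1)] that(2) by (simp add: Z_def)
    then show ?thesis using that by (simp add: slope_def moebius_mult U)
  qed
  show ?thesis
    by (rule that[of k]) (use k une in \<open>auto simp: slope_diff_def s u_def\<close>)
qed

lemma moduli_of_basic:
  assumes t: "t \<in> tets T" and v: "orders b t v"
  shows "moduli_of T b z (t, {v 0, v 1}) = modulus_w b z t 0"
    "moduli_of T b z (t, {v 2, v 3}) = modulus_w b z t 0"
    "moduli_of T b z (t, {v 1, v 2}) = modulus_w b z t 1"
    "moduli_of T b z (t, {v 0, v 3}) = modulus_w b z t 1"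
    "moduli_of T b z (t, {v 0, v 2}) = modulus_w b z t 2"
    "moduli_of T b z (t, {v 1, v 3}) = modulus_w b z t 2"
proof -
  note vl = orders_less_4[OF v] and vi = orders_inj[OF v]
  have "v ` {..<4} = {..<4}" using v permutes_image by (auto simp: orders_def)
  moreover have "{..<4::nat} = {0, 1, 2, 3}" by auto
  ultimately have U: "{..<4} = {v 0, v 1, v 2, v 3}" by auto
  have be: "basic_edge b t 0 = {v 0, v 1}" "basic_edge b t 1 = {v 1, v 2}" "basic_edge b t 2 = {v 0, v 2}"
    by (simp_all add: basic_edge_def Let_def vertex_order_eq[OF v] numeral_2_eq_2)
  have ce: "{..<4} - basic_edge b t 0 = {v 2, v 3}" "{..<4} - basic_edge b t 1 = {v 0, v 3}"
    "{..<4} - basic_edge b t 2 = {v 1, v 3}"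
    unfolding be U using vi by auto
  define B where "B = (\<lambda>j e. e = basic_edge b t j \<or> e = {..<4} - basic_edge b t j)"
  have B: "B 0 e \<longleftrightarrow> e = {v 0, v 1} \<or> e = {v 2, v 3}" "B 1 e \<longleftrightarrow> e = {v 1, v 2} \<or> e = {v 0, v 3}"
    "B 2 e \<longleftrightarrow> e = {v 0, v 2} \<or> e = {v 1, v 3}" for e
    unfolding B_def ce unfolding be by (rule refl)+
  have excl: "\<not> (B 0 e \<and> B 1 e)" "\<not> (B 0 e \<and> B 2 e)" "\<not> (B 1 e \<and> B 2 e)" for e
    unfolding B by (auto simp: doubleton_eq_iff vi)
  have uniq: "j' = j" if "j' < 3" "j < 3" "B j' e" "B j e" for j' j e
  proof -
    have "j' = 0 \<or> j' = 1 \<or> j' = 2" "j = 0 \<or> j = 1 \<or> j = 2" using that(1,2) by linarith+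
    then show ?thesis using excl[of e] that(3,4) by metis
  qed
  have m: "moduli_of T b z (t, {v i, v k}) = modulus_w b z t j"
    if "j < 3" "B j {v i, v k}" "i < 4" "k < 4" "i \<noteq> k" for j i k
  proof -
    have "(t, {v i, v k}) \<in> abs_edges T" using t that(3-5) vl vi unfolding abs_edges_def by blast
    moreover have "(THE j. j < 3 \<and> B j {v i, v k}) = j"
      using that(1,2) uniq by (intro the_equality) metis+
    ultimately show ?thesis by (simp add: moduli_of_def B_def)
  qed
  show "moduli_of T b z (t, {v 0, v 1}) = modulus_w b z t 0" by (rule m) (simp_all only: B, simp_all)
  show "moduli_of T b z (t, {v 2, v 3}) = modulus_w b z t 0" by (rule m) (simp_all only: B, simp_all)
  show "moduli_of T b z (t, {v 1, v 2}) = modulus_w b z t 1" by (rule m) (simp_all only: B, simp_all)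
  show "moduli_of T b z (t, {v 0, v 3}) = modulus_w b z t 1" by (rule m) (simp_all only: B, simp_all)
  show "moduli_of T b z (t, {v 0, v 2}) = modulus_w b z t 2" by (rule m) (simp_all only: B, simp_all)
  show "moduli_of T b z (t, {v 1, v 3}) = modulus_w b z t 2" by (rule m) (simp_all only: B, simp_all)
qed

text \<open>The even permutations of 0, 1, 2, 3 which list the first edge in increasing order.\<close>

definition even_quadruples :: "(nat \<times> nat \<times> nat \<times> nat) set" where
  "even_quadruples = {(0, 1, 2, 3), (0, 2, 3, 1), (0, 3, 1, 2), (1, 2, 0, 3), (1, 3, 2, 0), (2, 3, 0, 1)}"

lemma even_quadruples_cases [consumes 1]:
  assumes "(i, j, k, l) \<in> even_quadruples"
  obtains "i = 0" "j = 1" "k = 2" "l = 3" | "i = 0" "j = 2" "k = 3" "l = 1"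
    | "i = 0" "j = 3" "k = 1" "l = 2" | "i = 1" "j = 2" "k = 0" "l = 3"
    | "i = 1" "j = 3" "k = 2" "l = 0" | "i = 2" "j = 3" "k = 0" "l = 1"
  using assms unfolding even_quadruples_def insert_iff empty_iff prod.inject
  by (elim disjE conjE FalseE) (rule that, assumption+)+

lemma slope_diff_nonzero:
  assumes z: "cocycle T z" and t: "t \<in> tets T" and v: "orders b t v" and id: "idealizable b z t"
    and ijl: "i < 4" "j < 4" "l < 4" "i \<noteq> j" "j \<noteq> l" "i \<noteq> l"
  shows "slope_diff z (t, v i, v j, v l) \<noteq> 0"
proof -
  obtain k where k: "k \<noteq> 0"
    "\<And>j l. j < 4 \<Longrightarrow> l < 4 \<Longrightarrow> j \<noteq> i \<Longrightarrow> l \<noteq> i \<Longrightarrow> slope_diff z (t, v i, v j, v l) =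
       k * (aff (ideal_point b z t j) - aff (ideal_point b z t l)) /
       ((aff (ideal_point b z t l) - aff (ideal_point b z t i)) *
        (aff (ideal_point b z t j) - aff (ideal_point b z t i)))"
    using slope_diff_developed[OF z t v id ijl(1)] by blast
  then show ?thesis
    using k(1) k(2)[of j l] ijl by (auto simp: aff_ideal_point_eq_iff[OF id])
qed

lemma modulus_w_conv_p:
  "modulus_w b z t 0 = - modulus_p b z t 1 / modulus_p b z t 2"
  "modulus_w b z t 1 = - modulus_p b z t 2 / modulus_p b z t 0"
  "modulus_w b z t 2 = - modulus_p b z t 0 / modulus_p b z t 1"
proof -
  have "((0::nat) + 1) mod 3 = 1" "((0::nat) + 2) mod 3 = 2" "((1::nat) + 1) mod 3 = 2"
    "((1::nat) + 2) mod 3 = 0" "((2::nat) + 1) mod 3 = 0" "((2::nat) + 2) mod 3 = 1" by simp_all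
  note mod3 = this
  show "modulus_w b z t 0 = - modulus_p b z t 1 / modulus_p b z t 2"
    "modulus_w b z t 1 = - modulus_p b z t 2 / modulus_p b z t 0"
    "modulus_w b z t 2 = - modulus_p b z t 0 / modulus_p b z t 1"
    by (simp_all only: modulus_w_def mod3)
qed

lemma frac_eqI:
  fixes a b c d :: "'a::field"
  shows "b \<noteq> 0 \<Longrightarrow> d \<noteq> 0 \<Longrightarrow> a * d = c * b \<Longrightarrow> a / b = c / d"
  by (simp add: frac_eq_eq)

lemma cross_ratio_identities:
  fixes u1 u2 u3 :: complex
  assumes nz: "u1 \<noteq> 0" "u2 \<noteq> 0" "u3 \<noteq> 0" "u2 - u1 \<noteq> 0" "u3 - u1 \<noteq> 0" "u3 - u2 \<noteq> 0"
    "u1 - u2 \<noteq> 0" "u1 - u3 \<noteq> 0" "u2 - u3 \<noteq> 0"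
  shows "- ((u2 - u1) * u3) / (- u2 * (u3 - u1)) =
       ((u1 - u2) * (u3 - 0)) / ((u1 - u3) * (u2 - 0))"
    "- (u1 * (u3 - u2)) / ((u2 - u1) * u3) =
       ((u2 - u3) * (u1 - 0)) / ((u2 - u1) * (u3 - 0))"
    "- (- u2 * (u3 - u1)) / (u1 * (u3 - u2)) =
       ((u3 - u1) * (u2 - 0)) / ((u3 - u2) * (u1 - 0))"
    "- (- u2 * (u3 - u1)) / (u1 * (u3 - u2)) =
       ((u2 - 0) * (u3 - u1)) / ((u2 - u3) * (0 - u1))"
    "- (u1 * (u3 - u2)) / ((u2 - u1) * u3) =
       ((u3 - u2) * (0 - u1)) / ((u3 - 0) * (u2 - u1))"
    "- ((u2 - u1) * u3) / (- u2 * (u3 - u1)) =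
       ((u3 - 0) * (u1 - u2)) / ((u3 - u1) * (0 - u2))"
  by (rule frac_eqI; use nz in \<open>simp add: algebra_simps\<close>)+

text \<open>The cross ratio of the four developed vertices, computed after moving the smaller endpoint of the
  edge to infinity.\<close>

lemma modulus_conv_slopes:
  assumes z: "cocycle T z" and t: "t \<in> tets T" and v: "orders b t v" and id: "idealizable b z t"
    and q: "(i, j, k, l) \<in> even_quadruples"
  shows "moduli_of T b z (t, {v i, v j}) =
    slope_diff z (t, v i, v j, v k) / slope_diff z (t, v i, v j, v l)"
proof -
  define u where "u = (\<lambda>k. aff (ideal_point b z t k))"
  have lt: "i < 4" "j < 4" "k < 4" "l < 4" "i \<noteq> j" "i \<noteq> k" "i \<noteq> l"
    using q by (auto simp: even_quadruples_def)
  obtain c where c: "c \<noteq> 0" "\<And>j l. j < 4 \<Longrightarrow> l < 4 \<Longrightarrow> j \<noteq> i \<Longrightarrow> l \<noteq> i \<Longrightarrow>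
      slope_diff z (t, v i, v j, v l) = c * (u j - u l) / ((u l - u i) * (u j - u i))"
    unfolding u_def using slope_diff_developed[OF z t v id lt(1)] by blast
  have ne: "u p \<noteq> u q" if "p < 4" "q < 4" "p \<noteq> q" for p q
    using aff_ideal_point_eq_iff[OF id that(1,2)] that(3) by (simp add: u_def)
  have u0: "u 0 = 0"
    using ideal_point_conv[OF z t v, of 0] by (simp add: u_def moebius_one from_first_def)
  have nz: "u 1 \<noteq> 0" "u 2 \<noteq> 0" "u 3 \<noteq> 0" "u 2 - u 1 \<noteq> 0" "u 3 - u 1 \<noteq> 0" "u 3 - u 2 \<noteq> 0"
    "u 1 - u 2 \<noteq> 0" "u 1 - u 3 \<noteq> 0" "u 2 - u 3 \<noteq> 0"
    using ne[of 1 0] ne[of 2 0] ne[of 3 0] ne[of 2 1] ne[of 3 1] ne[of 3 2] u0 by auto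
  have "j \<noteq> l" using q by (auto simp: even_quadruples_def)
  then have n: "u j - u i \<noteq> 0" "u k - u i \<noteq> 0" "u l - u i \<noteq> 0" "u j - u l \<noteq> 0"
    using ne lt by auto
  have "slope_diff z (t, v i, v j, v k) / slope_diff z (t, v i, v j, v l) =
      (c * (u j - u k) / ((u k - u i) * (u j - u i))) / (c * (u j - u l) / ((u l - u i) * (u j - u i)))"
    using lt c(2)[of j k] c(2)[of j l] by simp
  also have "\<dots> = ((u j - u k) * (u l - u i)) / ((u j - u l) * (u k - u i))"
    using c(1) n by simp
  finally have "slope_diff z (t, v i, v j, v k) / slope_diff z (t, v i, v j, v l) =
      ((u j - u k) * (u l - u i)) / ((u j - u l) * (u k - u i))" .
  moreover have "moduli_of T b z (t, {v i, v j}) =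
      ((u j - u k) * (u l - u i)) / ((u j - u l) * (u k - u i))"
  proof -
    have p: "modulus_p b z t 0 = u 1 * (u 3 - u 2)" "modulus_p b z t 1 = (u 2 - u 1) * u 3"
      "modulus_p b z t 2 = - u 2 * (u 3 - u 1)"
      by (simp_all add: modulus_p_def u_def Let_def)
    have w: "modulus_w b z t 0 = - ((u 2 - u 1) * u 3) / (- u 2 * (u 3 - u 1))"
      "modulus_w b z t 1 = - (- u 2 * (u 3 - u 1)) / (u 1 * (u 3 - u 2))"
      "modulus_w b z t 2 = - (u 1 * (u 3 - u 2)) / ((u 2 - u 1) * u 3)"
      by (simp_all only: modulus_w_conv_p p)
    note m = moduli_of_basic[OF t v, of z]
    from q show ?thesis
    proof (cases rule: even_quadruples_cases)
      case 1
      show ?thesis unfolding 1 m w u0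
        by (rule cross_ratio_identities(1)[OF nz])
    next
      case 2
      show ?thesis unfolding 2 m w u0
        by (rule cross_ratio_identities(2)[OF nz])
    next
      case 3
      show ?thesis unfolding 3 m w u0
        by (rule cross_ratio_identities(3)[OF nz])
    next
      case 4
      show ?thesis unfolding 4 m w u0
        by (rule cross_ratio_identities(4)[OF nz])
    next
      case 5
      show ?thesis unfolding 5 m w u0
        by (rule cross_ratio_identities(5)[OF nz])
    next
      case 6
      show ?thesis unfolding 6 m w u0
        by (rule cross_ratio_identities(6)[OF nz])
    qed
  qed
  ultimately show ?thesis by simp
qed

section \<open>Face identifications\<close>

lemma gluing_mfaces: "gluing T \<Longrightarrow> q \<in> mfaces T \<Longrightarrow> glue T q \<in> mfaces T"
  and gluing_involution: "gluing T \<Longrightarrow> q \<in> mfaces T \<Longrightarrow> glue T (glue T q) = q"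
  by (auto simp: gluing_def)

lemma glue_swap:
  assumes "gluing T" "(t, a, b, c) \<in> mfaces T" "glue T (t, a, b, c) = (t', a', b', c')"
  shows "glue T (t, b, a, c) = (t', b', a', c')"
  using assms unfolding gluing_def by fast

lemma glue_rotate:
  assumes "gluing T" "(t, a, b, c) \<in> mfaces T" "glue T (t, a, b, c) = (t', a', b', c')"
  shows "glue T (t, b, c, a) = (t', b', c', a')"
  using assms unfolding gluing_def by fast

lemma glue_swap_last:
  assumes "gluing T" "(t, a, b, c) \<in> mfaces T" "glue T (t, a, b, c) = (t', a', b', c')"
  shows "glue T (t, a, c, b) = (t', a', c', b')"
proof -
  have "(t, b, a, c) \<in> mfaces T" using assms(2) by (auto simp: mfaces_iff)
  then show ?thesis using glue_rotate[OF assms(1) _ glue_swap[OF assms]] by blast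
qed

lemma glue_reverses_orientation:
  assumes "gluing T" "(t, a, b, c) \<in> mfaces T" "glue T (t, a, b, c) = (t', a', b', c')"
  shows "\<exists>\<pi>. \<pi> permutes {..<4} \<and> sign \<pi> = - 1 \<and> \<pi> a = a' \<and> \<pi> b = b' \<and> \<pi> c = c'"
  using assms unfolding gluing_def by meson

lemma edge_functionD:
  assumes "edge_function T f" "(t, a, b, c) \<in> mfaces T" "glue T (t, a, b, c) = (t', a', b', c')"
  shows "f (t, a, b) = f (t', a', b')"
  using assms unfolding edge_function_def by blast

definition edge_step :: "('t, 'w) triangulation \<Rightarrow> ('t aedge \<times> 't aedge) set" where
  "edge_step T = {((t, {a, b}), (t', {a', b'})) | t a b t' a' b'. \<exists>c c'.
     (t, a, b, c) \<in> mfaces T \<and> glue T (t, a, b, c) = (t', a', b', c')}"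

lemma edge_conv: "edge T x = (edge_step T)\<^sup>* `` {x}"
  by (simp add: edge_def edge_step_def)

lemma edge_refl: "x \<in> edge T x"
  by (simp add: edge_conv)

lemma edge_closed:
  assumes "(t, {a, b}) \<in> edge T x" "(t, a, b, c) \<in> mfaces T" "glue T (t, a, b, c) = (t', a', b', c')"
  shows "(t', {a', b'}) \<in> edge T x"
proof -
  have "((t, {a, b}), (t', {a', b'})) \<in> edge_step T"
    using assms(2,3) unfolding edge_step_def by blast
  then show ?thesis using assms(1) by (auto simp: edge_conv intro: rtrancl_into_rtrancl)
qed

lemma edge_subset:
  assumes "gluing T" "x \<in> abs_edges T"
  shows "edge T x \<subseteq> abs_edges T"
proof
  fix y assume "y \<in> edge T x"
  then have "(x, y) \<in> (edge_step T)\<^sup>*" by (simp add: edge_conv)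
  then show "y \<in> abs_edges T"
  proof (induction rule: rtrancl_induct)
    case (step y y')
    then obtain t a b c t' a' b' c' where y': "y' = (t', {a', b'})" "(t, a, b, c) \<in> mfaces T"
      "glue T (t, a, b, c) = (t', a', b', c')" unfolding edge_step_def by blast
    then have "(t', a', b', c') \<in> mfaces T" using gluing_mfaces[OF assms(1)] by metis
    then show ?case unfolding y' abs_edges_def mfaces_iff by blast
  qed (rule assms(2))
qed

lemma finite_abs_edges: "gluing T \<Longrightarrow> finite (abs_edges T)"
proof -
  assume "gluing T"
  then have "finite (tets T \<times> Pow {..<4::nat})" by (simp add: gluing_def)
  moreover have "abs_edges T \<subseteq> tets T \<times> Pow {..<4}" by (auto simp: abs_edges_def)
  ultimately show ?thesis using finite_subset by blast
qed

section \<open>The equations at the edges\<close>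

text \<open>The sign of the permutation listing \<open>a, b, c\<close> and then the fourth vertex, without naming the
  latter.\<close>

definition orientation :: "int \<Rightarrow> nat \<Rightarrow> nat \<Rightarrow> nat \<Rightarrow> bool" where
  "orientation s a b c \<longleftrightarrow> (\<exists>\<pi>. \<pi> permutes {..<4} \<and> sign \<pi> = s \<and> \<pi> 0 = a \<and> \<pi> 1 = b \<and> \<pi> 2 = c)"

lemma permutes_4_eqI:
  assumes "\<pi> permutes {..<4::nat}" "\<pi>' permutes {..<4}" "\<pi> 0 = \<pi>' 0" "\<pi> 1 = \<pi>' 1" "\<pi> 2 = \<pi>' 2"
  shows "\<pi> = \<pi>'"
proof
  fix i
  have U: "{..<4::nat} = {0, 1, 2, 3}" by auto
  have "\<pi> ` {..<4} = {..<4}" "\<pi>' ` {..<4} = {..<4}" using assms permutes_image by blast+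
  then have "\<pi> ` {0, 1, 2, 3} = \<pi>' ` {0, 1, 2, 3}" unfolding U by (rule trans[OF _ sym])
  then have e: "{\<pi> 0, \<pi> 1, \<pi> 2, \<pi> 3} = {\<pi>' 0, \<pi>' 1, \<pi>' 2, \<pi>' 3}"
    by (simp only: image_insert image_empty)
  have "inj \<pi>" using assms(1) permutes_inj by blast
  then have "\<pi> 3 \<noteq> \<pi> 0" "\<pi> 3 \<noteq> \<pi> 1" "\<pi> 3 \<noteq> \<pi> 2" by (simp_all add: inj_eq)
  moreover have "\<pi> 3 \<in> {\<pi>' 0, \<pi>' 1, \<pi>' 2, \<pi>' 3}" using e by auto
  ultimately have 3: "\<pi> 3 = \<pi>' 3" using assms(3-5) by auto
  show "\<pi> i = \<pi>' i"
  proof (cases "i < 4")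
    case True then show ?thesis using less_4_cases[OF True] assms(3-5) 3 by auto
  next
    case False then show ?thesis using assms(1,2) by (metis lessThan_iff permutes_not_in)
  qed
qed

lemma orientation_unique:
  assumes "orientation s a b c" "orientation s' a b c"
  shows "s' = s"
  using assms permutes_4_eqI unfolding orientation_def by metis

lemma orientation_other:
  assumes o: "orientation s a b c" and d: "d < 4" "d \<notin> {a, b, c}"
  shows "orientation (- s) a b d"
proof -
  obtain \<pi> where \<pi>: "\<pi> permutes {..<4}" "sign \<pi> = s" "\<pi> 0 = a" "\<pi> 1 = b" "\<pi> 2 = c"
    using o unfolding orientation_def by blast
  have "d \<in> \<pi> ` {..<4}" using d(1) permutes_image[OF \<pi>(1)] by simp
  then obtain i where i: "i < 4" "d = \<pi> i" by auto
  then have "\<pi> 3 = d" using less_4_cases[OF i(1)] d(2) \<pi>(3-5) by auto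
  let ?s = "Transposition.transpose 2 3 :: nat \<Rightarrow> nat"
  have s: "?s permutes {..<4}" by (simp add: permutes_swap_id)
  have "permutation \<pi>" "permutation ?s" using \<pi>(1) s permutation_permutes by blast+
  then have "sign (\<pi> \<circ> ?s) = - s" using \<pi>(2) by (simp add: sign_compose sign_swap_id)
  moreover have "(\<pi> \<circ> ?s) permutes {..<4}" using \<pi>(1) s permutes_compose by blast
  moreover have "(\<pi> \<circ> ?s) 0 = a" "(\<pi> \<circ> ?s) 1 = b" "(\<pi> \<circ> ?s) 2 = d"
    using \<pi> \<open>\<pi> 3 = d\<close> by (auto simp: transpose_def)
  ultimately show ?thesis unfolding orientation_def by blast
qed

lemma orientation_permute:
  assumes o: "orientation s a b c" and \<pi>: "\<pi> permutes {..<4}"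
  shows "orientation (sign \<pi> * s) (\<pi> a) (\<pi> b) (\<pi> c)"
proof -
  obtain \<sigma> where \<sigma>: "\<sigma> permutes {..<4}" "sign \<sigma> = s" "\<sigma> 0 = a" "\<sigma> 1 = b" "\<sigma> 2 = c"
    using o unfolding orientation_def by blast
  have "permutation \<pi>" "permutation \<sigma>" using \<pi> \<sigma> permutation_permutes by blast+
  then have "sign (\<pi> \<circ> \<sigma>) = sign \<pi> * s" using \<sigma>(2) by (simp add: sign_compose)
  moreover have "(\<pi> \<circ> \<sigma>) permutes {..<4}" using \<pi> \<sigma>(1) permutes_compose by blast
  moreover have "(\<pi> \<circ> \<sigma>) 0 = \<pi> a" "(\<pi> \<circ> \<sigma>) 1 = \<pi> b" "(\<pi> \<circ> \<sigma>) 2 = \<pi> c" using \<sigma> by auto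
  ultimately show ?thesis unfolding orientation_def by blast
qed

lemma orientation_even:
  assumes "(i, j, k, l) \<in> even_quadruples"
  shows "orientation 1 i j k"
proof -
  have t: "orientation 1 i j k"
    if "(Transposition.transpose p q \<circ> Transposition.transpose r s) 0 = i" "(Transposition.transpose p q \<circ> Transposition.transpose r s) 1 = j"
      "(Transposition.transpose p q \<circ> Transposition.transpose r s) 2 = k" "p < 4" "q < 4" "r < 4" "s < 4" "p \<noteq> q" "r \<noteq> s" for p q r s
  proof -
    have "Transposition.transpose p q permutes {..<4}" "Transposition.transpose r s permutes {..<4}"
      using that by (simp_all add: permutes_swap_id)
    moreover have "sign (Transposition.transpose p q \<circ> Transposition.transpose r s) = 1"
      using that by (simp add: sign_compose sign_swap_id permutation_swap_id)
    ultimately show ?thesis using that permutes_compose unfolding orientation_def by metis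
  qed
  have id: "orientation 1 0 1 2"
    unfolding orientation_def by (intro exI[of _ id]) (auto simp: sign_id permutes_id)
  from assms show ?thesis
  proof (cases rule: even_quadruples_cases)
    case 1 then show ?thesis using id by simp
  next
    case 2 then show ?thesis by (intro t[of 1 2 2 3]) (auto simp: transpose_def)
  next
    case 3 then show ?thesis by (intro t[of 2 3 1 2]) (auto simp: transpose_def)
  next
    case 4 then show ?thesis by (intro t[of 0 1 1 2]) (auto simp: transpose_def)
  next
    case 5 then show ?thesis by (intro t[of 0 1 1 3]) (auto simp: transpose_def)
  next
    case 6 then show ?thesis by (intro t[of 0 2 1 3]) (auto simp: transpose_def)
  qed
qed

lemma orders_surj:
  assumes "orders b t v" "p < 4"
  shows "\<exists>i<4. v i = p"
proof -
  have "v ` {..<4} = {..<4}" using assms(1) permutes_image by (auto simp: orders_def)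
  then have "p \<in> v ` {..<4}" using assms(2) by simp
  then show ?thesis by auto
qed

lemma abs_edge_cases:
  assumes v: "orders b t v" and e: "(t, e) \<in> abs_edges T"
  obtains i j k l where "(i, j, k, l) \<in> even_quadruples" "e = {v i, v j}"
proof -
  obtain p q where pq: "e = {p, q}" "p < 4" "q < 4" "p \<noteq> q" using e by (auto simp: abs_edges_def)
  obtain i' j' where "i' < 4" "v i' = p" "j' < 4" "v j' = q"
    using orders_surj[OF v pq(2)] orders_surj[OF v pq(3)] by blast
  then obtain i j where ij: "i < j" "j < 4" "e = {v i, v j}"
    using pq by (metis insert_commute linorder_neqE_nat)
  then have "(i, j) \<in> {(0, 1), (0, 2), (0, 3), (1, 2), (1, 3), (2, 3)}" by auto
  then have "\<exists>k l. (i, j, k, l) \<in> even_quadruples" unfolding even_quadruples_def by auto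
  then show ?thesis using that ij(3) by blast
qed

lemma even_quadruples_bounds:
  assumes "(i, j, k, l) \<in> even_quadruples"
  shows "i < j" "j < 4" "k < 4" "l < 4" "i \<noteq> k" "j \<noteq> k" "i \<noteq> l" "j \<noteq> l" "k \<noteq> l"
  using assms unfolding even_quadruples_def by auto

text \<open>The 2-faces around the edges in \<open>E\<close>, marked so that their first edge is in \<open>E\<close> and follows the
  branching. The sign \<open>s\<close> selects one of the two faces of a tetrahedron at each of its edges.\<close>

definition edge_faces ::
    "('t, 'w) triangulation \<Rightarrow> 't branching \<Rightarrow> int \<Rightarrow> 't aedge set \<Rightarrow> 't mface set" where
  "edge_faces T b s E = {(t, p, q, r). (t, p, q, r) \<in> mfaces T \<and> (t, {p, q}) \<in> E \<and> b (t, p, q) \<and>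
     orientation s p q r}"

fun first_edge :: "'t mface \<Rightarrow> 't aedge" where
  "first_edge (t, p, q, r) = (t, {p, q})"

lemma branching_antisym:
  assumes b: "is_branching T b" and e: "(t, p, q) \<in> oriented_edges T" and 1: "b (t, p, q)"
  shows "\<not> b (t, q, p)"
proof -
  have pq: "t \<in> tets T" "p < 4" "q < 4" "p \<noteq> q" using e by (auto simp: oriented_edges_def)
  obtain v where v: "orders b t v" using b pq(1) by (auto simp: is_branching_def)
  obtain i j where ij: "i < 4" "v i = p" "j < 4" "v j = q"
    using orders_surj[OF v pq(2)] orders_surj[OF v pq(3)] by blast
  then have "i \<noteq> j" using pq by auto
  then show ?thesis using v 1 ij unfolding orders_def by (metis less_asym)
qed

lemma edge_faces_inj:
  assumes b: "is_branching T b"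
  shows "inj_on first_edge (edge_faces T b s E)"
proof (rule inj_onI)
  fix x y assume xy: "x \<in> edge_faces T b s E" "y \<in> edge_faces T b s E" "first_edge x = first_edge y"
  obtain t p q r where x: "x = (t, p, q, r)" by (cases x)
  obtain t' p' q' r' where y: "y = (t', p', q', r')" by (cases y)
  have t: "t' = t" and pq: "{p, q} = {p', q'}" using xy(3) x y by auto
  have fx: "(t, p, q, r) \<in> mfaces T" "b (t, p, q)" "orientation s p q r"
    and fy: "(t, p', q', r') \<in> mfaces T" "b (t, p', q')" "orientation s p' q' r'"
    using xy(1,2) x y t by (auto simp: edge_faces_def)
  have "(t, p, q) \<in> oriented_edges T" using fx(1) by (auto simp: mfaces_iff oriented_edges_def)
  then have "\<not> b (t, q, p)" using branching_antisym[OF b] fx(2) by blast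
  then have e: "p' = p" "q' = q" using pq fy(2) by (auto simp: doubleton_eq_iff)
  have "r' = r"
  proof (rule ccontr)
    assume "r' \<noteq> r"
    then have "orientation (- s) p q r'"
      using orientation_other[OF fx(3), of r'] fy(1) e by (auto simp: mfaces_iff)
    then have "- s = s" using orientation_unique fy(3) e by blast
    moreover have "s = 1 \<or> s = - 1" using fx(3) unfolding orientation_def sign_def by (auto split: if_splits)
    ultimately show False by auto
  qed
  then show "x = y" using x y t e by simp
qed

text \<open>A slope difference depends only on the cocycle along the edges of a 2-face.\<close>

lemma slope_diff_glue:
  assumes T: "gluing T" and z: "edge_function T z" and q: "q \<in> mfaces T"
  shows "slope_diff z (glue T q) = slope_diff z q"
proof -
  obtain t a b c where q': "q = (t, a, b, c)" by (cases q)
  obtain t' a' b' c' where g: "glue T q = (t', a', b', c')" by (cases "glue T q")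
  have 1: "z (t, a, b) = z (t', a', b')"
    using edge_functionD[OF z] q g unfolding q' by blast
  have "(t, a, c, b) \<in> mfaces T" using q q' by (auto simp: mfaces_iff)
  then have "z (t, a, c) = z (t', a', c')"
    using edge_functionD[OF z] glue_swap_last[OF T] q g unfolding q' by blast
  then show ?thesis using 1 unfolding g unfolding q' by (simp add: slope_diff_def)
qed

text \<open>Face identifications reverse the orientation, so they match the faces on one side of the
  tetrahedra around an edge with those on the other side.\<close>

lemma glue_edge_faces:
  assumes T: "gluing T" and b: "edge_function T b" and E: "E = edge T x"
  shows "q \<in> edge_faces T b s E \<Longrightarrow> glue T q \<in> edge_faces T b (- s) E"
proof -
  assume q: "q \<in> edge_faces T b s E"
  obtain t p p' r where q': "q = (t, p, p', r)" by (cases q)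
  obtain t1 p1 p1' r1 where g: "glue T q = (t1, p1, p1', r1)" by (cases "glue T q")
  have f: "(t, p, p', r) \<in> mfaces T" "(t, {p, p'}) \<in> E" "b (t, p, p')" "orientation s p p' r"
    using q q' by (auto simp: edge_faces_def)
  have g': "glue T (t, p, p', r) = (t1, p1, p1', r1)" using g q' by simp
  have "(t1, p1, p1', r1) \<in> mfaces T" using gluing_mfaces[OF T f(1)] g' by simp
  moreover have "(t1, {p1, p1'}) \<in> E" using edge_closed[OF _ f(1) g'] f(2) E by blast
  moreover have "b (t1, p1, p1')" using edge_functionD[OF b f(1) g'] f(3) by simp
  moreover obtain \<pi> where \<pi>: "\<pi> permutes {..<4}" "sign \<pi> = - 1" "\<pi> p = p1" "\<pi> p' = p1'" "\<pi> r = r1"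
    using glue_reverses_orientation[OF T f(1) g'] by blast
  then have "orientation (- s) p1 p1' r1" using orientation_permute[OF f(4) \<pi>(1)] by simp
  ultimately show ?thesis unfolding g by (simp add: edge_faces_def)
qed

lemma powi_uminus_1: "(x :: complex) powi (- 1) = inverse x"
  by (simp add: power_int_minus)

text \<open>By \<open>modulus_conv_slopes\<close> the product is the product of the slope differences of the faces on one
  side, divided by that for the other side. The identifications of the faces exchange the two sides and
  preserve slope differences.\<close>

theorem edge_product_eq_1:
  assumes T: "gluing T" and b: "is_branching T b" and z: "cocycle T z"
    and id: "\<And>t. t \<in> tets T \<Longrightarrow> idealizable b z t" and x: "x \<in> abs_edges T"
  shows "edge_product b (moduli_of T b z) (edge T x) = 1"
proof -
  define E where "E = edge T x"
  have bf: "edge_function T b" using b by (simp add: is_branching_def)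
  have zf: "edge_function T z" using z by (simp add: cocycle_def)
  have E: "E \<subseteq> abs_edges T" using edge_subset[OF T x] by (simp add: E_def)
  have "\<forall>y\<in>E. \<exists>q q'. q \<in> edge_faces T b 1 E \<and> q' \<in> edge_faces T b (- 1) E \<and>
      first_edge q = y \<and> first_edge q' = y \<and> slope_diff z q' \<noteq> 0 \<and>
      moduli_of T b z y powi index b (fst y) = slope_diff z q / slope_diff z q'"
  proof
    fix y assume y: "y \<in> E"
    obtain t e where te: "y = (t, e)" by (cases y)
    have e: "(t, e) \<in> abs_edges T" using y E te by blast
    then have t: "t \<in> tets T" by (auto simp: abs_edges_def)
    obtain v where v: "orders b t v" using b t by (auto simp: is_branching_def)
    obtain i j k l where q: "(i, j, k, l) \<in> even_quadruples" "e = {v i, v j}"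
      using abs_edge_cases[OF v e] by blast
    note B = even_quadruples_bounds[OF q(1)]
    have ij: "i < 4" "i \<noteq> j" using B by auto
    note vl = orders_less_4[OF v] and vi = orders_inj[OF v]
    have vp: "v permutes {..<4}" and bij: "b (t, v i, v j)"
      using v B ij by (auto simp: orders_def)
    have ok: "orientation (sign v) (v i) (v j) (v k)"
      using orientation_permute[OF orientation_even[OF q(1)] vp] by simp
    have ol: "orientation (- sign v) (v i) (v j) (v l)"
      by (rule orientation_other[OF ok]) (use vl vi B in auto)
    have m: "(t, v i, v j, v k) \<in> mfaces T" "(t, v i, v j, v l) \<in> mfaces T"
      using t vl vi B ij by (auto simp: mfaces_iff)
    have fk: "(t, v i, v j, v k) \<in> edge_faces T b (sign v) E"
      and fl: "(t, v i, v j, v l) \<in> edge_faces T b (- sign v) E"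
      using ok ol m y bij te q(2) by (auto simp: edge_faces_def)
    have nz: "slope_diff z (t, v i, v j, v k) \<noteq> 0" "slope_diff z (t, v i, v j, v l) \<noteq> 0"
      using slope_diff_nonzero[OF z t v id[OF t]] B ij by auto
    have w: "moduli_of T b z y = slope_diff z (t, v i, v j, v k) / slope_diff z (t, v i, v j, v l)"
      using modulus_conv_slopes[OF z t v id[OF t] q(1)] te q(2) by simp
    have ind: "index b (fst y) = sign v" by (simp add: te index_def vertex_order_eq[OF v])
    show "\<exists>q q'. q \<in> edge_faces T b 1 E \<and> q' \<in> edge_faces T b (- 1) E \<and>
      first_edge q = y \<and> first_edge q' = y \<and> slope_diff z q' \<noteq> 0 \<and>
      moduli_of T b z y powi index b (fst y) = slope_diff z q / slope_diff z q'"
    proof (cases "sign v = 1")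
      case True
      with fk fl nz w ind te q(2) show ?thesis
        by (intro exI[of _ "(t, v i, v j, v k)"] exI[of _ "(t, v i, v j, v l)"]) simp
    next
      case False
      then have "sign v = - 1" by (simp add: sign_def split: if_splits)
      with fk fl nz w ind te q(2) show ?thesis
        by (intro exI[of _ "(t, v i, v j, v l)"] exI[of _ "(t, v i, v j, v k)"])
          (simp add: powi_uminus_1)
    qed
  qed
  then obtain N N' where N: "\<And>y. y \<in> E \<Longrightarrow> N y \<in> edge_faces T b 1 E \<and> N' y \<in> edge_faces T b (- 1) E \<and>
      first_edge (N y) = y \<and> first_edge (N' y) = y \<and> slope_diff z (N' y) \<noteq> 0 \<and>
      moduli_of T b z y powi index b (fst y) = slope_diff z (N y) / slope_diff z (N' y)"
    by metis
  have fE: "first_edge q \<in> E" if "q \<in> edge_faces T b s E" for q s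
    using that by (auto simp: edge_faces_def)
  have inv: "N (first_edge q) = q" if "q \<in> edge_faces T b 1 E" for q
    using edge_faces_inj[OF b] N[OF fE[OF that]] that by (auto dest: inj_onD)
  have inv': "N' (first_edge q) = q" if "q \<in> edge_faces T b (- 1) E" for q
    using edge_faces_inj[OF b] N[OF fE[OF that]] that by (auto dest: inj_onD)
  have r: "(\<Prod>y\<in>E. slope_diff z (N y)) = (\<Prod>q\<in>edge_faces T b 1 E. slope_diff z q)"
    by (rule prod.reindex_bij_witness[of _ first_edge N]) (use N inv fE in simp_all)
  have r': "(\<Prod>y\<in>E. slope_diff z (N' y)) = (\<Prod>q\<in>edge_faces T b (- 1) E. slope_diff z q)"
    by (rule prod.reindex_bij_witness[of _ first_edge N']) (use N inv' fE in simp_all)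
  have mf: "q \<in> mfaces T" if "q \<in> edge_faces T b s E" for q s
    using that by (auto simp: edge_faces_def)
  have "(\<Prod>q\<in>edge_faces T b 1 E. slope_diff z q) = (\<Prod>q\<in>edge_faces T b (- 1) E. slope_diff z q)"
  proof (rule prod.reindex_bij_witness[of _ "glue T" "glue T"])
    show "glue T q \<in> edge_faces T b (- 1) E" if "q \<in> edge_faces T b 1 E" for q
      using glue_edge_faces[OF T bf E_def that] .
    show "glue T q \<in> edge_faces T b 1 E" if "q \<in> edge_faces T b (- 1) E" for q
      using glue_edge_faces[OF T bf E_def that] by simp
  qed (use gluing_involution[OF T] slope_diff_glue[OF T zf] mf in blast)+
  moreover have "(\<Prod>y\<in>E. slope_diff z (N' y)) \<noteq> 0"
    using N finite_subset[OF E finite_abs_edges[OF T]] by auto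
  moreover have "edge_product b (moduli_of T b z) E =
      (\<Prod>y\<in>E. slope_diff z (N y)) / (\<Prod>y\<in>E. slope_diff z (N' y))"
    unfolding edge_product_def prod_dividef[symmetric] by (rule prod.cong) (use N in auto)
  ultimately show ?thesis using r r' by (simp add: E_def)
qed

section \<open>One modulus determines the modular triple\<close>

text \<open>This is \<open>p\<^sub>0 + p\<^sub>1 + p\<^sub>2 = 0\<close>, written in terms of the quotients of the \<open>p\<^sub>j\<close>.\<close>

lemma modulus_w_next:
  assumes id: "idealizable b z t" and u0: "aff (ideal_point b z t 0) = 0"
  shows "modulus_w b z t 1 = 1 / (1 - modulus_w b z t 0)"
    "modulus_w b z t 2 = 1 / (1 - modulus_w b z t 1)"
    "modulus_w b z t 0 = 1 / (1 - modulus_w b z t 2)"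
proof -
  define u where "u = (\<lambda>k. aff (ideal_point b z t k))"
  have ne: "u p \<noteq> u q" if "p < 4" "q < 4" "p \<noteq> q" for p q
    using aff_ideal_point_eq_iff[OF id that(1,2)] that(3) by (simp add: u_def)
  have "u 0 = 0" using u0 by (simp add: u_def)
  define p0 p1 p2 where "p0 = modulus_p b z t 0" and "p1 = modulus_p b z t 1" and "p2 = modulus_p b z t 2"
  have p: "p0 = u 1 * (u 3 - u 2)" "p1 = (u 2 - u 1) * u 3" "p2 = - u 2 * (u 3 - u 1)"
    by (simp_all add: p0_def p1_def p2_def modulus_p_def u_def Let_def)
  have nz: "p0 \<noteq> 0" "p1 \<noteq> 0" "p2 \<noteq> 0"
    using ne[of 1 0] ne[of 2 0] ne[of 3 0] ne[of 2 1] ne[of 3 1] ne[of 3 2] \<open>u 0 = 0\<close>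
    unfolding p by auto
  have s: "p0 + p1 + p2 = 0" unfolding p by (simp add: algebra_simps)
  have w: "modulus_w b z t 0 = - p1 / p2" "modulus_w b z t 1 = - p2 / p0" "modulus_w b z t 2 = - p0 / p1"
    by (simp_all only: modulus_w_conv_p p0_def p1_def p2_def)
  have key: "- y / x = 1 / (1 - (- z / y))" if "x + z + y = 0" "x \<noteq> 0" "y \<noteq> 0" for x y z :: complex
  proof -
    have "z + y = - x" using that(1) by (simp add: eq_neg_iff_add_eq_0 algebra_simps)
    moreover have "1 - (- z / y) = (z + y) / y" using that(3) by (simp add: divide_simps)
    ultimately show ?thesis by simp
  qed
  show "modulus_w b z t 1 = 1 / (1 - modulus_w b z t 0)" unfolding w by (rule key) (use s nz in auto)
  show "modulus_w b z t 2 = 1 / (1 - modulus_w b z t 1)" unfolding w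
    by (rule key) (use s nz in \<open>auto simp: algebra_simps\<close>)
  show "modulus_w b z t 0 = 1 / (1 - modulus_w b z t 2)" unfolding w
    by (rule key) (use s nz in \<open>auto simp: algebra_simps\<close>)
qed

lemma moduli_of_conv_w:
  assumes v: "orders b t v" and e: "(t, e) \<in> abs_edges T"
  obtains j where "j \<in> {0, 1, 2}" "\<And>z. moduli_of T b z (t, e) = modulus_w b z t j"
proof -
  obtain i j k l where q: "(i, j, k, l) \<in> even_quadruples" "e = {v i, v j}"
    using abs_edge_cases[OF v e] by blast
  have "t \<in> tets T" using e by (auto simp: abs_edges_def)
  note m = moduli_of_basic[OF this v]
  from q(1) show ?thesis
  proof (cases rule: even_quadruples_cases)
    case 1 then show ?thesis by (intro that[of 0]) (simp_all add: q(2) m[simplified])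
  next
    case 2 then show ?thesis by (intro that[of 2]) (simp_all add: q(2) m[simplified])
  next
    case 3 then show ?thesis by (intro that[of 1]) (simp_all add: q(2) m[simplified])
  next
    case 4 then show ?thesis by (intro that[of 1]) (simp_all add: q(2) m[simplified])
  next
    case 5 then show ?thesis by (intro that[of 2]) (simp_all add: q(2) m[simplified])
  next
    case 6 then show ?thesis by (intro that[of 0]) (simp_all add: q(2) m[simplified])
  qed
qed

lemma moduli_of_determined:
  assumes z: "cocycle T z1" "cocycle T z2" and t: "t \<in> tets T" and v: "orders b t v"
    and id: "idealizable b z1 t" "idealizable b z2 t"
    and e: "(t, e) \<in> abs_edges T" "moduli_of T b z1 (t, e) = moduli_of T b z2 (t, e)"
    and e': "(t, e') \<in> abs_edges T"
  shows "moduli_of T b z1 (t, e') = moduli_of T b z2 (t, e')"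
proof -
  have u0: "aff (ideal_point b z1 t 0) = 0" "aff (ideal_point b z2 t 0) = 0"
    using ideal_point_conv[OF _ t v, of _ 0] z by (simp_all add: moebius_one from_first_def)
  obtain j where j: "j \<in> {0, 1, 2}" "\<And>z. moduli_of T b z (t, e) = modulus_w b z t j"
    using moduli_of_conv_w[OF v e(1)] by blast
  obtain j' where j': "j' \<in> {0, 1, 2}" "\<And>z. moduli_of T b z (t, e') = modulus_w b z t j'"
    using moduli_of_conv_w[OF v e'] by blast
  have "modulus_w b z1 t j = modulus_w b z2 t j" using e(2) j(2) by simp
  with j(1) have "modulus_w b z1 t 0 = modulus_w b z2 t 0 \<and> modulus_w b z1 t 1 = modulus_w b z2 t 1 \<and>
      modulus_w b z1 t 2 = modulus_w b z2 t 2"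
    using modulus_w_next[OF id(1) u0(1)] modulus_w_next[OF id(2) u0(2)]
    unfolding insert_iff empty_iff by metis
  then have "modulus_w b z1 t j' = modulus_w b z2 t j'" using j'(1) by auto
  then show ?thesis using j'(2) by simp
qed

section \<open>Conjugation by parabolic elements fixing 0\<close>

lift_definition shear :: "complex \<Rightarrow> psl2" is "\<lambda>k. vector [vector [1, 0], vector [k, 1]]"
  by (simp add: det_2)

lemma shear_inverse: "inverse (shear k) = shear (- k)"
  by transfer (simp add: det_2 mat2_eq_iff adjugate2_nth)

lemma moebius_shear_0: "moebius (shear k) (Aff 0) = Aff 0"
  by transfer (simp add: moebius_mat_def)

lemma reciprocal_moebius_shear: "x \<noteq> Aff 0 \<Longrightarrow> reciprocal (moebius (shear k) x) = reciprocal x + k"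
  by transfer (auto simp: moebius_mat_def divide_simps add.commute split: cp1.split)

lemma slope_conjugate:
  assumes "moebius g (Aff 0) \<noteq> Aff 0"
  shows "slope (inverse (shear k) * g * shear k) = slope g - k"
  using assms by (simp add: slope_def moebius_mult moebius_shear_0 shear_inverse reciprocal_moebius_shear)

lemma moebius_conjugate_0:
  "moebius (inverse (shear k) * g * shear k) (Aff 0) = Aff 0 \<longleftrightarrow> moebius g (Aff 0) = Aff 0"
  by (metis moebius_eq_iff moebius_mult moebius_shear_0 shear_inverse)

lemma psl2_inverse_unique: "(g::psl2) * h = 1 \<Longrightarrow> inverse g = h"
  using inverse_psl2_mult_cancel[of g h] by simp

lemma cocycle_conjugate:
  assumes z: "cocycle T z"
  shows "cocycle T (\<lambda>e. inverse g * z e * g)"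
proof -
  have inv: "inverse (inverse g * x * g) = inverse g * inverse x * g" for x :: psl2
  proof -
    have "(inverse g * x * g) * (inverse g * inverse x * g) = 1"
      by (simp add: mult.assoc psl2_mult_inverse_cancel psl2_left_inverse)
    then show ?thesis by (rule psl2_inverse_unique)
  qed
  show ?thesis
    unfolding cocycle_def
  proof (intro conjI ballI)
    show "edge_function T (\<lambda>e. inverse g * z e * g)"
      unfolding edge_function_def
    proof (intro allI impI)
      fix t a b c t' a' b' c'
      assume f: "(t, a, b, c) \<in> mfaces T \<and> glue T (t, a, b, c) = (t', a', b', c')"
      have "z (t, a, b) = z (t', a', b')" using z f edge_functionD by (force simp: cocycle_def)
      then show "inverse g * z (t, a, b) * g = inverse g * z (t', a', b') * g" by simp
    qed
    show "case e of (t, a, b) \<Rightarrow> inverse g * z (t, b, a) * g = inverse (inverse g * z (t, a, b) * g)"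
      if "e \<in> oriented_edges T" for e
      using cocycle_inverse[OF z] that by (cases e) (simp add: inv)
    show "case q of (t, a, b, c) \<Rightarrow>
        inverse g * z (t, a, b) * g * (inverse g * z (t, b, c) * g) = inverse g * z (t, a, c) * g"
      if "q \<in> mfaces T" for q
      using cocycle_mult[OF z, symmetric] that by (cases q) (simp add: mult.assoc psl2_mult_inverse_cancel)
  qed
qed

lemma idealizableI:
  assumes "cocycle T z" "t \<in> tets T" "orders b t v"
    and "\<And>p q. p < 4 \<Longrightarrow> q < 4 \<Longrightarrow> p \<noteq> q \<Longrightarrow> moebius (z (t, p, q)) (Aff 0) \<notin> {Aff 0, Infty}"
  shows "idealizable b z t"
  unfolding idealizable_iff[OF assms(1-3)]
  using assms(4) orders_less_4[OF assms(3)] orders_inj[OF assms(3)] by auto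

lemma idealizable_moebius_nonzero:
  assumes z: "cocycle T z" and v: "orders b t v" and id: "idealizable b z t"
    and e: "(t, p, q) \<in> oriented_edges T"
  shows "moebius (z (t, p, q)) (Aff 0) \<noteq> Aff 0"
proof -
  have pq: "t \<in> tets T" "p < 4" "q < 4" "p \<noteq> q" using e by (auto simp: oriented_edges_def)
  obtain i j where "i < 4" "v i = p" "j < 4" "v j = q"
    using orders_surj[OF v pq(2)] orders_surj[OF v pq(3)] by blast
  then show ?thesis using id pq unfolding idealizable_iff[OF z pq(1) v] by blast
qed

lemma finite_oriented_edges: "gluing T \<Longrightarrow> finite (oriented_edges T)"
proof -
  assume "gluing T"
  then have "finite (tets T \<times> {..<4::nat} \<times> {..<4::nat})" by (simp add: gluing_def)
  moreover have "oriented_edges T \<subseteq> tets T \<times> {..<4} \<times> {..<4}" by (auto simp: oriented_edges_def)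
  ultimately show ?thesis using finite_subset by blast
qed

text \<open>An edge sends 0 to infinity if its slope is 0. Conjugation by \<open>shear k\<close> subtracts \<open>k\<close> from all
  slopes, so it is enough that \<open>k\<close> is not one of the finitely many slopes.\<close>

lemma D_triangulation_generic:
  assumes fl: "flat_psl2_bundle W \<rho>" and D: "D_triangulation W \<omega> \<rho> (T, b, z)"
  obtains z' where "D_triangulation W \<omega> \<rho> (T, b, z')" "moduli_of T b z' = moduli_of T b z"
    "\<And>e. e \<in> oriented_edges T \<Longrightarrow> moebius (z' e) (Aff 0) \<notin> {Aff 0, Infty}"
proof -
  have T: "triangulates T W \<omega>" "quasi_regular T" and b: "is_branching T b" and z: "cocycle T z"
    and rep: "represents T z \<rho>" and id: "\<And>t. t \<in> tets T \<Longrightarrow> idealizable b z t"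
    using D by (auto simp: D_triangulation_def)
  have gl: "gluing T" and ch: "\<forall>t\<in>tets T. singular_simplex 3 W (chart T t)"
    using T by (auto simp: triangulates_def)
  have "finite ((\<lambda>e. slope (z e)) ` oriented_edges T)" using finite_oriented_edges[OF gl] by blast
  then obtain k where k: "k \<notin> (\<lambda>e. slope (z e)) ` oriented_edges T"
    using ex_new_if_finite[OF infinite_UNIV_char_0] by blast
  define z' where "z' = (\<lambda>e. inverse (shear k) * z e * shear k)"
  have nz: "moebius (z e) (Aff 0) \<noteq> Aff 0" if e: "e \<in> oriented_edges T" for e
  proof -
    obtain t p q where [simp]: "e = (t, p, q)" by (cases e)
    have t: "t \<in> tets T" using e by (auto simp: oriented_edges_def)
    then obtain v where "orders b t v" using b by (auto simp: is_branching_def)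
    then show ?thesis using idealizable_moebius_nonzero[OF z _ id[OF t]] e by auto
  qed
  have sl: "slope (z' e) = slope (z e) - k" if "e \<in> oriented_edges T" for e
    unfolding z'_def by (rule slope_conjugate[OF nz[OF that]])
  have gen: "moebius (z' e) (Aff 0) \<notin> {Aff 0, Infty}" if e: "e \<in> oriented_edges T" for e
  proof -
    have "moebius (z' e) (Aff 0) \<noteq> Aff 0" unfolding z'_def moebius_conjugate_0 by (rule nz[OF e])
    moreover have "slope (z' e) \<noteq> 0" using sl[OF e] k e by auto
    ultimately show ?thesis by (auto simp: slope_def)
  qed
  have z': "cocycle T z'" unfolding z'_def by (rule cocycle_conjugate[OF z])
  have id': "idealizable b z' t" if t: "t \<in> tets T" for t
  proof -
    obtain v where v: "orders b t v" using b t by (auto simp: is_branching_def)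
    show ?thesis by (rule idealizableI[OF z' t v]) (use gen t in \<open>auto simp: oriented_edges_def\<close>)
  qed
  have "moduli_of T b z' x = moduli_of T b z x" for x
  proof (cases "x \<in> abs_edges T")
    case True
    obtain t e where x: "x = (t, e)" by (cases x)
    have t: "t \<in> tets T" using True x by (auto simp: abs_edges_def)
    obtain v where v: "orders b t v" using b t by (auto simp: is_branching_def)
    obtain i j l m where q: "(i, j, l, m) \<in> even_quadruples" "e = {v i, v j}"
      using abs_edge_cases[OF v] True x by metis
    note B = even_quadruples_bounds[OF q(1)]
    note vl = orders_less_4[OF v] and vi = orders_inj[OF v]
    have "slope_diff z' (t, v i, v j, v n) = slope_diff z (t, v i, v j, v n)" if "n < 4" "n \<noteq> i" for n
    proof -
      have "(t, v i, v j) \<in> oriented_edges T" "(t, v i, v n) \<in> oriented_edges T"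
        using t B vl vi that by (auto simp: oriented_edges_def)
      then show ?thesis by (simp add: slope_diff_def sl)
    qed
    then show ?thesis
      unfolding x q(2) modulus_conv_slopes[OF z t v id[OF t] q(1)] modulus_conv_slopes[OF z' t v id'[OF t] q(1)]
      using B by simp
  next
    case False then show ?thesis by (cases x) (simp add: moduli_of_def)
  qed
  then have m: "moduli_of T b z' = moduli_of T b z" by (rule ext)
  have "represents T z' \<rho>" unfolding z'_def by (rule represents_conjugate[OF fl ch rep])
  then have "D_triangulation W \<omega> \<rho> (T, b, z')"
    using T b z' id' by (simp add: D_triangulation_def)
  from that[OF this m gen] show ?thesis .
qed

section \<open>Vertices\<close>

text \<open>A function of the vertices is encoded as a function of the corners of the tetrahedra; evaluating
  it at the first endpoint makes it an edge function, so that results on edge functions apply.\<close>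

definition vertex_function :: "('t, 'w) triangulation \<Rightarrow> ('t \<times> nat \<Rightarrow> 'c) \<Rightarrow> bool" where
  "vertex_function T F \<longleftrightarrow> edge_function T (\<lambda>(t, a, b). F (t, a))"

lemma vertex_functionD:
  assumes "vertex_function T F" "(t, a, b, c) \<in> mfaces T" "glue T (t, a, b, c) = (t', a', b', c')"
  shows "F (t, a) = F (t', a')"
  using edge_functionD[OF assms(1)[unfolded vertex_function_def] assms(2,3)] by simp

lemma vertex_functionI:
  assumes "\<And>t a b c t' a' b' c'. (t, a, b, c) \<in> mfaces T \<Longrightarrow> glue T (t, a, b, c) = (t', a', b', c') \<Longrightarrow>
    F (t, a) = F (t', a')"
  shows "vertex_function T F"
  unfolding vertex_function_def edge_function_def using assms by fastforce

definition vertex_step :: "('t, 'w) triangulation \<Rightarrow> (('t \<times> nat) \<times> ('t \<times> nat)) set" where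
  "vertex_step T = {((t, a), (t', a')) | t a t' a'. \<exists>b c b' c'.
     (t, a, b, c) \<in> mfaces T \<and> glue T (t, a, b, c) = (t', a', b', c')}"

lemma vert_conv: "vert T x = (vertex_step T)\<^sup>* `` {x}"
  by (simp add: vert_def vertex_step_def)

lemma sym_vertex_step: "gluing T \<Longrightarrow> sym (vertex_step T)"
proof (rule symI)
  fix x y assume T: "gluing T" and "(x, y) \<in> vertex_step T"
  then obtain t a b c t' a' b' c' where xy: "x = (t, a)" "y = (t', a')" and
    f: "(t, a, b, c) \<in> mfaces T" "glue T (t, a, b, c) = (t', a', b', c')"
    unfolding vertex_step_def by blast
  have "(t', a', b', c') \<in> mfaces T" "glue T (t', a', b', c') = (t, a, b, c)"
    using gluing_mfaces[OF T f(1)] gluing_involution[OF T f(1)] f(2) by simp_all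
  then show "(y, x) \<in> vertex_step T" unfolding xy vertex_step_def by blast
qed

lemma vertex_function_vert:
  assumes T: "gluing T"
  shows "vertex_function T (vert T)"
proof (rule vertex_functionI)
  fix t a b c t' a' b' c'
  assume "(t, a, b, c) \<in> mfaces T" "glue T (t, a, b, c) = (t', a', b', c')"
  then have s: "((t, a), (t', a')) \<in> vertex_step T" unfolding vertex_step_def by blast
  then have s': "((t', a'), (t, a)) \<in> vertex_step T" using sym_vertex_step[OF T] by (simp add: sym_def)
  show "vert T (t, a) = vert T (t', a')"
    unfolding vert_conv using s s' by (auto intro: converse_rtrancl_into_rtrancl)
qed

lemma edge_endpoints:
  assumes T: "gluing T" and F: "vertex_function T F" and y: "(t', e') \<in> edge T (t, e)"
  shows "(\<lambda>a. F (t', a)) ` e' = (\<lambda>a. F (t, a)) ` e"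
proof -
  have "((t, e), (t', e')) \<in> (edge_step T)\<^sup>*" using y by (simp add: edge_conv)
  then have "(\<lambda>a. F (fst (t', e'), a)) ` snd (t', e') = (\<lambda>a. F (fst (t, e), a)) ` snd (t, e)"
  proof (induction rule: rtrancl_induct)
    case (step y z)
    then obtain t a b c t' a' b' c' where yz: "y = (t, {a, b})" "z = (t', {a', b'})" and
      f: "(t, a, b, c) \<in> mfaces T" "glue T (t, a, b, c) = (t', a', b', c')"
      unfolding edge_step_def by blast
    have "(t, b, a, c) \<in> mfaces T" using f(1) by (auto simp: mfaces_iff)
    then have "F (t, b) = F (t', b')" by (rule vertex_functionD[OF F _ glue_swap[OF T f]])
    moreover have "F (t, a) = F (t', a')" by (rule vertex_functionD[OF F f])
    ultimately show ?case using step.IH yz by simp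
  qed simp
  then show ?thesis by simp
qed

definition corner :: "nat \<Rightarrow> nat \<Rightarrow> real" where
  "corner a = (\<lambda>i. if i = a then 1 else 0)"

lemma edge_point_corner: "edge_point a b 0 = corner a" "a \<noteq> b \<Longrightarrow> edge_point a b 1 = corner b"
  by (auto simp: edge_point_def corner_def)

lemma corner_inj: "corner a = corner b \<longleftrightarrow> a = b"
  by (auto simp: corner_def fun_eq_iff split: if_splits)

lemma corner_in_simplex: "a < 4 \<Longrightarrow> corner a \<in> standard_simplex 3"
  using edge_point_in_simplex[of a "if a = 0 then 1 else 0" 0]
  by (auto simp: edge_point_corner split: if_splits)

lemma standard_simplex_cornerI:
  assumes x: "x \<in> standard_simplex 3" and a: "a < 4" "x a = 1"
  shows "x = corner a"
proof
  fix i
  have nn: "0 \<le> x i" for i using x by (simp add: standard_simplex_def)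
  have s: "(\<Sum>i\<le>3. x i) = 1" and o: "\<And>i. i > 3 \<Longrightarrow> x i = 0" using x by (auto simp: standard_simplex_def)
  have "a \<in> {..3}" using a by auto
  then have "(\<Sum>i\<in>{..3} - {a}. x i) = 0" using s a(2) by (simp add: sum_diff1)
  then have z: "\<forall>i\<in>{..3} - {a}. x i = 0" using nn by (subst (asm) sum_nonneg_eq_0_iff) auto
  show "x i = corner a i" using z o a by (cases "i \<le> 3") (auto simp: corner_def)
qed

lemma point_glueI:
  assumes "(t, a, b, c) \<in> mfaces T" "glue T (t, a, b, c) = (t', a', b', c')"
    "x \<in> standard_simplex 3" "x' \<in> standard_simplex 3"
    "x a + x b + x c = 1" "x' a' = x a" "x' b' = x b" "x' c' = x c"
  shows "((t, x), (t', x')) \<in> point_glue T"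
  unfolding point_glue_def using assms by blast

lemma triangulates_chart_eq:
  assumes "triangulates T W \<omega>" "t \<in> tets T" "t' \<in> tets T" "x \<in> standard_simplex 3" "x' \<in> standard_simplex 3"
  shows "chart T t x = chart T t' x' \<longleftrightarrow> ((t, x), (t', x')) \<in> (point_glue T)\<^sup>*"
  using assms unfolding triangulates_def by blast

lemma vertex_function_chart:
  assumes T: "triangulates T W \<omega>"
  shows "vertex_function T (\<lambda>(t, a). chart T t (corner a))"
proof (rule vertex_functionI)
  fix t a b c t' a' b' c'
  assume f: "(t, a, b, c) \<in> mfaces T" "glue T (t, a, b, c) = (t', a', b', c')"
  have gl: "gluing T" using T by (simp add: triangulates_def)
  have f': "(t', a', b', c') \<in> mfaces T" using gluing_mfaces[OF gl f(1)] f(2) by simp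
  have "((t, corner a), (t', corner a')) \<in> point_glue T"
    by (rule point_glueI[OF f]) (use f(1) f' in \<open>auto simp: mfaces_iff corner_in_simplex corner_def\<close>)
  then show "(case (t, a) of (t, a) \<Rightarrow> chart T t (corner a)) = (case (t', a') of (t, a) \<Rightarrow> chart T t (corner a))"
    using triangulates_chart_eq[OF T, of t t' "corner a" "corner a'"] f(1) f'
    by (auto simp: mfaces_iff corner_in_simplex)
qed

text \<open>The point of \<open>W\<close> at a corner determines the vertex of \<open>T\<close>: a chain of point identifications that
  starts at a corner passes through corners only.\<close>

lemma vertex_function_chart_eq:
  assumes T: "triangulates T W \<omega>" and F: "vertex_function T F"
    and t: "t \<in> tets T" "a < 4" "t1 \<in> tets T" "a1 < 4"
    and e: "chart T t (corner a) = chart T t1 (corner a1)"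
  shows "F (t, a) = F (t1, a1)"
proof -
  have gl: "gluing T" using T by (simp add: triangulates_def)
  have "((t, corner a), (t1, corner a1)) \<in> (point_glue T)\<^sup>*"
    using triangulates_chart_eq[OF T t(1,3) corner_in_simplex[OF t(2)] corner_in_simplex[OF t(4)]] e by simp
  then have "\<exists>a'<4. snd (t1, corner a1) = corner a' \<and> F (t, a) = F (fst (t1, corner a1), a')"
  proof (induction rule: rtrancl_induct)
    case base then show ?case using t(2) by auto
  next
    case (step y y')
    from step.hyps(2) obtain u x p q r u' x' p' q' r' where y: "y = (u, x)" "y' = (u', x')" and
      f: "(u, p, q, r) \<in> mfaces T" "glue T (u, p, q, r) = (u', p', q', r')" and
      x: "x' \<in> standard_simplex 3" "x p + x q + x r = 1" "x' p' = x p" "x' q' = x q" "x' r' = x r"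
      unfolding point_glue_def by blast
    obtain a' where a': "a' < 4" "x = corner a'" "F (t, a) = F (u, a')"
      using step.IH y(1) by auto
    have f': "(u', p', q', r') \<in> mfaces T" using gluing_mfaces[OF gl f(1)] f(2) by simp
    have fq: "(u, q, p, r) \<in> mfaces T" "(u, q, r, p) \<in> mfaces T" using f(1) by (auto simp: mfaces_iff)
    have F3: "F (u, p) = F (u', p')" "F (u, q) = F (u', q')" "F (u, r) = F (u', r')"
      using vertex_functionD[OF F f] vertex_functionD[OF F fq(1) glue_swap[OF gl f]]
        vertex_functionD[OF F _ glue_rotate[OF gl fq(2) glue_rotate[OF gl f]]] f(1)
      by (auto simp: mfaces_iff)
    have "a' = p \<or> a' = q \<or> a' = r" using x(2) unfolding a'(2) corner_def by (auto split: if_splits)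
    then obtain c where "c < 4" "x' c = 1" "F (u, a') = F (u', c)"
      using x(3-5) F3 f' unfolding a'(2) corner_def mfaces_iff by auto
    then show ?case using standard_simplex_cornerI[OF x(1)] a'(3) y(2) by auto
  qed
  then show ?thesis by (auto simp: corner_inj)
qed

section \<open>Markings of a face\<close>

text \<open>The six markings of a 2-face. The identification of a face is given for one marking in the
  description of a move, and is needed for all of them.\<close>

fun remark :: "nat \<Rightarrow> 't mface \<Rightarrow> 't mface" where
  "remark n (t, a, b, c) = (t, [(a, b, c), (b, a, c), (b, c, a), (c, b, a), (c, a, b), (a, c, b)] ! n)"

lemma less_6_cases: "(n::nat) < 6 \<Longrightarrow> n = 0 \<or> n = 1 \<or> n = 2 \<or> n = 3 \<or> n = 4 \<or> n = 5"
  by linarith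

lemma remark_mfaces: "n < 6 \<Longrightarrow> q \<in> mfaces T \<Longrightarrow> remark n q \<in> mfaces T"
  by (cases q, drule less_6_cases, elim disjE) (auto simp: mfaces_iff)

lemma glue_remark:
  assumes T: "gluing T" and q: "q \<in> mfaces T" and n: "n < 6"
  shows "glue T (remark n q) = remark n (glue T q)"
proof -
  obtain t a b c where q': "q = (t, a, b, c)" by (cases q)
  obtain t' a' b' c' where g: "glue T q = (t', a', b', c')" by (cases "glue T q")
  have f: "(t, a, b, c) \<in> mfaces T" "glue T (t, a, b, c) = (t', a', b', c')" using q g q' by simp_all
  have m: "(t, b, c, a) \<in> mfaces T" "(t, c, a, b) \<in> mfaces T" using f(1) by (auto simp: mfaces_iff)
  note 1 = glue_swap[OF T f] and 2 = glue_rotate[OF T f]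
  note 3 = glue_swap[OF T m(1) 2] and 4 = glue_rotate[OF T m(1) 2] and 5 = glue_swap_last[OF T f]
  show ?thesis using less_6_cases[OF n] unfolding g unfolding q'
    by (elim disjE) (simp_all add: f(2) 1 2 3 4 5)
qed

lemma remark_eqI:
  assumes "distinct [p, q, r]" "p \<in> {x, y, w}" "q \<in> {x, y, w}" "r \<in> {x, y, w}"
  obtains n where "n < 6" "\<And>s f. (s, f p, f q, f r) = remark n (s, f x, f y, f w)"
proof -
  from assms consider "(p, q, r) = (x, y, w)" | "(p, q, r) = (y, x, w)" | "(p, q, r) = (y, w, x)"
    | "(p, q, r) = (w, y, x)" | "(p, q, r) = (w, x, y)" | "(p, q, r) = (x, w, y)"
    unfolding insert_iff empty_iff distinct_length_2_or_more by metis
  then show ?thesis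
  proof cases
    case 1 then show ?thesis by (intro that[of 0]) simp_all
  next
    case 2 then show ?thesis by (intro that[of 1]) simp_all
  next
    case 3 then show ?thesis by (intro that[of 2]) simp_all
  next
    case 4 then show ?thesis by (intro that[of 3]) simp_all
  next
    case 5 then show ?thesis by (intro that[of 4]) simp_all
  next
    case 6 then show ?thesis by (intro that[of 5]) simp_all
  qed
qed

lemma same_unmark_remark:
  fixes q q' :: "'t mface"
  assumes q: "q \<in> mfaces T" "q' \<in> mfaces T'" and u: "unmark q' = unmark q"
  obtains n where "n < 6" "q' = remark n q"
proof -
  obtain t a b c where q1: "q = (t, a, b, c)" by (cases q)
  obtain t' a' b' c' where q2: "q' = (t', a', b', c')" by (cases q')
  have t: "t' = t" and s: "{a', b', c'} = {a, b, c}" using u q1 q2 by auto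
  have d: "distinct [a', b', c']" using q q1 q2 by (auto simp: mfaces_iff)
  have m: "a' \<in> {a, b, c}" "b' \<in> {a, b, c}" "c' \<in> {a, b, c}" using s by blast+
  obtain n where n: "n < 6" "\<And>(s :: 't) (f :: nat \<Rightarrow> nat). (s, f a', f b', f c') = remark n (s, f a, f b, f c)"
    using remark_eqI[OF d m] by metis
  show ?thesis using that[OF n(1)] n(2)[of t "\<lambda>x. x"] by (simp only: q1 q2 t)
qed

definition face_function :: "('t, 'w) triangulation \<Rightarrow> ('t mface \<Rightarrow> 'c) \<Rightarrow> bool" where
  "face_function T X \<longleftrightarrow> (\<forall>q\<in>mfaces T. X (glue T q) = X q)"

lemma edge_function_conv_face_function:
  "edge_function T f \<longleftrightarrow> face_function T (\<lambda>(t, a, b, c). f (t, a, b))"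
proof
  assume f: "edge_function T f"
  show "face_function T (\<lambda>(t, a, b, c). f (t, a, b))"
    unfolding face_function_def
  proof
    fix q assume q: "q \<in> mfaces T"
    obtain t a b c where q': "q = (t, a, b, c)" by (cases q)
    obtain t' a' b' c' where g: "glue T q = (t', a', b', c')" by (cases "glue T q")
    show "(case glue T q of (t, a, b, c) \<Rightarrow> f (t, a, b)) = (case q of (t, a, b, c) \<Rightarrow> f (t, a, b))"
      using edge_functionD[OF f] q g unfolding q' by fastforce
  qed
next
  assume f: "face_function T (\<lambda>(t, a, b, c). f (t, a, b))"
  show "edge_function T f"
    unfolding edge_function_def
  proof (intro allI impI, elim conjE)
    fix t a b c t' a' b' c'
    assume q: "(t, a, b, c) \<in> mfaces T" "glue T (t, a, b, c) = (t', a', b', c')"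
    then have "(case glue T (t, a, b, c) of (t, a, b, c) \<Rightarrow> f (t, a, b)) = f (t, a, b)"
      using f unfolding face_function_def by fastforce
    then show "f (t, a, b) = f (t', a', b')" using q(2) by simp
  qed
qed

section \<open>Restriction along a 2-3 move\<close>

text \<open>As in the definition of the move, the vertices of the bipyramid are 0,...,4 with apexes 0 and 1, and
  \<open>\<tau> m\<close> is the tetrahedron without the vertex \<open>m\<close>; \<open>T\<close> contains \<open>\<tau> 0\<close> and \<open>\<tau> 1\<close>, which meet in the
  equatorial face, and \<open>T'\<close> contains \<open>\<tau> 2\<close>, \<open>\<tau> 3\<close> and \<open>\<tau> 4\<close> around the axis.\<close>

locale bipyramid =
  fixes \<tau> :: "nat \<Rightarrow> 't" and \<kappa> :: "nat \<Rightarrow> nat \<Rightarrow> nat" and T T' :: "('t, 'w) triangulation"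
  assumes move: "positive_move (Move23 \<tau> \<kappa>) T T'" and T: "gluing T" and T': "gluing T'"
begin

lemma tau_inj: "m \<le> 4 \<Longrightarrow> n \<le> 4 \<Longrightarrow> \<tau> m = \<tau> n \<longleftrightarrow> m = n"
  using move by (auto dest: inj_onD)

lemma tau_old: "m \<in> {0, 1} \<Longrightarrow> \<tau> m \<in> tets T" "m \<in> {0, 1} \<Longrightarrow> \<tau> m \<notin> tets T'"
proof -
  assume m: "m \<in> {0, 1}"
  show "\<tau> m \<in> tets T" using move m by auto
  have "\<tau> m \<noteq> \<tau> n" if "n \<in> {2, 3, 4}" for n using tau_inj[of m n] m that by auto
  moreover have "tets T' = (tets T - {\<tau> 0, \<tau> 1}) \<union> {\<tau> 2, \<tau> 3, \<tau> 4}" using move by simp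
  ultimately show "\<tau> m \<notin> tets T'" using m by auto
qed

lemma tau_new: "n \<in> {2, 3, 4} \<Longrightarrow> \<tau> n \<in> tets T'" "n \<in> {2, 3, 4} \<Longrightarrow> \<tau> n \<notin> tets T"
  using move by auto

lemma tets_unchanged: "t \<in> tets T \<Longrightarrow> t \<notin> {\<tau> 0, \<tau> 1} \<Longrightarrow> t \<in> tets T'"
  using move by auto

lemma kappa_bij: "m \<le> 4 \<Longrightarrow> bij_betw (\<kappa> m) ({..4} - {m}) {..<4}"
  using move by simp

lemma kappa_less: "m \<le> 4 \<Longrightarrow> p \<le> 4 \<Longrightarrow> p \<noteq> m \<Longrightarrow> \<kappa> m p < 4"
  using bij_betwE[OF kappa_bij[of m]] by auto

lemma kappa_inj: "m \<le> 4 \<Longrightarrow> p \<le> 4 \<Longrightarrow> p \<noteq> m \<Longrightarrow> q \<le> 4 \<Longrightarrow> q \<noteq> m \<Longrightarrow> \<kappa> m p = \<kappa> m q \<longleftrightarrow> p = q"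
  using inj_on_eq_iff[OF bij_betw_imp_inj_on[OF kappa_bij[of m]], of p q] by simp

lemma kappa_surj:
  assumes "m \<le> 4" "a < 4"
  obtains p where "p \<le> 4" "p \<noteq> m" "\<kappa> m p = a"
proof -
  have "\<kappa> m ` ({..4} - {m}) = {..<4}" using bij_betw_imp_surj_on[OF kappa_bij[OF assms(1)]] .
  then have "a \<in> \<kappa> m ` ({..4} - {m})" using assms(2) by simp
  then show ?thesis using that by auto
qed

lemma tet_face:
  assumes "m \<le> 4" "p \<le> 4" "q \<le> 4" "r \<le> 4" "distinct [m, p, q, r]" "\<tau> m \<in> tets S"
  shows "(\<tau> m, \<kappa> m p, \<kappa> m q, \<kappa> m r) \<in> mfaces S"
  using assms kappa_less[of m p] kappa_less[of m q] kappa_less[of m r]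
    kappa_inj[of m p q] kappa_inj[of m q r] kappa_inj[of m p r] by (auto simp: mfaces_iff)

lemma tet_edge:
  assumes "m \<le> 4" "p \<le> 4" "q \<le> 4" "distinct [m, p, q]" "\<tau> m \<in> tets S"
  shows "(\<tau> m, \<kappa> m p, \<kappa> m q) \<in> oriented_edges S"
  using assms kappa_less[of m p] kappa_less[of m q] kappa_inj[of m p q] by (auto simp: oriented_edges_def)

text \<open>The common face of \<open>\<tau> n\<close> and \<open>\<tau> n'\<close> has vertices 0, 1 and the third equatorial vertex, in
  any order.\<close>

lemma glue_new:
  assumes n: "n \<in> {2, 3, 4}" "n' \<in> {2, 3, 4}" "n \<noteq> n'"
    and pqr: "p \<le> 4" "q \<le> 4" "r \<le> 4" "distinct [n, n', p, q, r]"
  shows "glue T' (\<tau> n, \<kappa> n p, \<kappa> n q, \<kappa> n r) = (\<tau> n', \<kappa> n' p, \<kappa> n' q, \<kappa> n' r)"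
proof -
  define k where "k = 9 - n - n'"
  have k: "k \<in> {2, 3, 4}" "k \<noteq> n" "k \<noteq> n'" using n by (auto simp: k_def)
  then have nnk: "{n, n', k} = {2, 3, 4}" using n by auto
  then have g: "glue T' (\<tau> n, \<kappa> n 0, \<kappa> n 1, \<kappa> n k) = (\<tau> n', \<kappa> n' 0, \<kappa> n' 1, \<kappa> n' k)"
    using move by simp
  have f: "(\<tau> n, \<kappa> n 0, \<kappa> n 1, \<kappa> n k) \<in> mfaces T'"
    by (rule tet_face) (use n(1) k(1,2) tau_new(1)[OF n(1)] in auto)
  have five: "x \<in> {0, 1, n, n', k}" if "x \<le> 4" for x
  proof -
    have "x \<in> {0, 1} \<union> {2, 3, 4}" using that by auto
    then show ?thesis unfolding nnk[symmetric] by blast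
  qed
  have "p \<in> {0, 1, k}" "q \<in> {0, 1, k}" "r \<in> {0, 1, k}"
    using five[OF pqr(1)] five[OF pqr(2)] five[OF pqr(3)] pqr(4) by simp_all blast+
  moreover have "distinct [p, q, r]" using pqr(4) by simp
  ultimately obtain i where i: "i < 6"
    "\<And>(s :: 't) (f :: nat \<Rightarrow> nat). (s, f p, f q, f r) = remark i (s, f 0, f 1, f k)"
    using remark_eqI by metis
  show ?thesis unfolding i(2) glue_remark[OF T' f i(1)] g ..
qed

lemma glue_inner:
  assumes m: "m \<in> {0, 1}" and pqr: "p \<in> {2, 3, 4}" "q \<in> {2, 3, 4}" "r \<in> {2, 3, 4}" "distinct [p, q, r]"
  shows "glue T (\<tau> m, \<kappa> m p, \<kappa> m q, \<kappa> m r) = (\<tau> (1 - m), \<kappa> (1 - m) p, \<kappa> (1 - m) q, \<kappa> (1 - m) r)"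
proof -
  have g: "glue T (\<tau> 0, \<kappa> 0 2, \<kappa> 0 3, \<kappa> 0 4) = (\<tau> 1, \<kappa> 1 2, \<kappa> 1 3, \<kappa> 1 4)"
    using move by simp
  have f: "(\<tau> 0, \<kappa> 0 2, \<kappa> 0 3, \<kappa> 0 4) \<in> mfaces T"
    by (rule tet_face) (use tau_old in auto)
  obtain i where i: "i < 6" "\<And>(s :: 't) (f :: nat \<Rightarrow> nat). (s, f p, f q, f r) = remark i (s, f 2, f 3, f 4)"
    using remark_eqI[OF pqr(4,1-3)] by metis
  have 0: "glue T (\<tau> 0, \<kappa> 0 p, \<kappa> 0 q, \<kappa> 0 r) = (\<tau> 1, \<kappa> 1 p, \<kappa> 1 q, \<kappa> 1 r)"
    unfolding i(2) glue_remark[OF T f i(1)] g ..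
  have "(\<tau> 0, \<kappa> 0 p, \<kappa> 0 q, \<kappa> 0 r) \<in> mfaces T"
    by (rule tet_face) (use tau_old pqr in auto)
  then have "glue T (\<tau> 1, \<kappa> 1 p, \<kappa> 1 q, \<kappa> 1 r) = (\<tau> 0, \<kappa> 0 p, \<kappa> 0 q, \<kappa> 0 r)"
    using gluing_involution[OF T] 0 by metis
  then show ?thesis using 0 m by auto
qed

definition corresponding_faces :: "('t mface \<times> 't mface) set" where
  "corresponding_faces = {(q, q) | q. q \<in> mfaces T \<inter> mfaces T'} \<union> move23_outer \<tau> \<kappa>"

lemma outer_glue: "(q, q') \<in> corresponding_faces \<Longrightarrow> (glue T q, glue T' q') \<in> corresponding_faces"
proof -
  have "\<forall>(q, q')\<in>corresponding_faces. (glue T q, glue T' q') \<in> corresponding_faces"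
    using move unfolding positive_move.simps Let_def corresponding_faces_def by (elim conjE)
  then show "(q, q') \<in> corresponding_faces \<Longrightarrow> ?thesis" using bspec[of _ _ "(q, q')"] by blast
qed

lemma corresponding_facesI: "x \<in> move23_outer \<tau> \<kappa> \<Longrightarrow> x \<in> corresponding_faces"
  by (simp add: corresponding_faces_def)

lemma move23_outerI:
  assumes "m \<in> {0, 1}" "n \<in> {2, 3, 4}" "{m, n, p, q, r} = {..4}"
  shows "((\<tau> m, \<kappa> m p, \<kappa> m q, \<kappa> m r), (\<tau> n, \<kappa> n p, \<kappa> n q, \<kappa> n r)) \<in> move23_outer \<tau> \<kappa>"
  unfolding move23_outer_def using assms by blast

lemma ex_other_vertex:
  obtains x :: nat where "x \<le> 4" "x \<notin> {a, b, c, d}"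
proof -
  have "card {a, b, c, d} \<le> 4" using card_length[of "[a, b, c, d]"] by simp
  then have "{..4} - {a, b, c, d} \<noteq> {}" using card_mono[of "{a, b, c, d}" "{..4::nat}"] by auto
  then show ?thesis using that by blast
qed

lemma all_5_vertices:
  fixes m n p q r :: nat
  assumes "distinct [m, n, p, q, r]" "m \<le> 4" "n \<le> 4" "p \<le> 4" "q \<le> 4" "r \<le> 4"
  shows "{m, n, p, q, r} = {..4}"
proof (rule card_subset_eq)
  have "card (set [m, n, p, q, r]) = length [m, n, p, q, r]" using assms(1) by (rule distinct_card)
  then show "card {m, n, p, q, r} = card {..4::nat}" by simp
qed (use assms in auto)

lemma card_5_distinct:
  assumes "{m, n, p, q, r} = {..4::nat}"
  shows "distinct [m, n, p, q, r]" "p \<le> 4" "q \<le> 4" "r \<le> 4"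
proof -
  have "card (set [m, n, p, q, r]) = length [m, n, p, q, r]" using assms by simp
  then show "distinct [m, n, p, q, r]" by (rule card_distinct)
  have "p \<in> {..4}" "q \<in> {..4}" "r \<in> {..4}" unfolding assms[symmetric] by simp_all
  then show "p \<le> 4" "q \<le> 4" "r \<le> 4" by simp_all
qed

text \<open>A face of \<open>T\<close> belongs to an unchanged tetrahedron, or it is on the boundary of the bipyramid, or
  it is one of the two copies of the equatorial face. In the first two cases its identification in \<open>T\<close>
  corresponds to one in \<open>T'\<close>.\<close>

lemma restrict_face_function:
  assumes X': "face_function T' X'"
    and XX': "\<And>q q'. (q, q') \<in> corresponding_faces \<Longrightarrow> X q = X' q'"
    and inner: "\<And>p q r. p \<in> {2, 3, 4} \<Longrightarrow> q \<in> {2, 3, 4} \<Longrightarrow> r \<in> {2, 3, 4} \<Longrightarrow> distinct [p, q, r] \<Longrightarrow>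
      X (\<tau> 0, \<kappa> 0 p, \<kappa> 0 q, \<kappa> 0 r) = X (\<tau> 1, \<kappa> 1 p, \<kappa> 1 q, \<kappa> 1 r)"
  shows "face_function T X"
  unfolding face_function_def
proof
  fix f assume f: "f \<in> mfaces T"
  obtain t a b c where f': "f = (t, a, b, c)" by (cases f)
  have X'g: "X' (glue T' q) = X' q" if "q \<in> mfaces T'" for q
    using X' that by (simp add: face_function_def)
  have related: "X (glue T f) = X f"
    if "(f, q') \<in> corresponding_faces" "q' \<in> mfaces T'" for q'
    using XX'[OF that(1)] XX'[OF outer_glue[OF that(1)]] X'g[OF that(2)] by simp
  show "X (glue T f) = X f"
  proof (cases "t \<in> {\<tau> 0, \<tau> 1}")
    case False
    then have "f \<in> mfaces T'" using f tets_unchanged by (auto simp: f' mfaces_iff)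
    then show ?thesis using related f unfolding corresponding_faces_def by blast
  next
    case True
    then obtain m where m: "m \<in> {0, 1}" "t = \<tau> m" by blast
    then have m4: "m \<le> 4" by auto
    have abc: "a < 4" "b < 4" "c < 4" "a \<noteq> b" "b \<noteq> c" "a \<noteq> c" using f by (auto simp: f' mfaces_iff)
    obtain p where p: "p \<le> 4" "p \<noteq> m" "\<kappa> m p = a" using kappa_surj[OF m4 abc(1)] by blast
    obtain q where q: "q \<le> 4" "q \<noteq> m" "\<kappa> m q = b" using kappa_surj[OF m4 abc(2)] by blast
    obtain r where r: "r \<le> 4" "r \<noteq> m" "\<kappa> m r = c" using kappa_surj[OF m4 abc(3)] by blast
    have d: "distinct [p, q, r]" using abc p q r by auto
    have fm: "f = (\<tau> m, \<kappa> m p, \<kappa> m q, \<kappa> m r)" using f' m p q r by simp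
    show ?thesis
    proof (cases "{p, q, r} \<subseteq> {2, 3, 4}")
      case True
      then have "glue T f = (\<tau> (1 - m), \<kappa> (1 - m) p, \<kappa> (1 - m) q, \<kappa> (1 - m) r)"
        unfolding fm using glue_inner[OF m(1)] d by simp
      then show ?thesis using inner[of p q r] True d m(1) unfolding fm by auto
    next
      case False
      obtain n where n: "n \<le> 4" "n \<notin> {m, p, q, r}" by (rule ex_other_vertex)
      have all: "{m, n, p, q, r} = {..4}"
        by (rule all_5_vertices) (use n d p q r m4 in auto)
      obtain x where x: "x \<in> {p, q, r}" "x \<notin> {2, 3, 4}" using False by blast
      then have "x \<le> 4" "x \<noteq> m" using p q r by blast+
      then have "x = 1 - m" using x(2) m(1) by auto
      then have "n \<noteq> m" "n \<noteq> 1 - m" using n x(1) by auto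
      then have n2: "n \<in> {2, 3, 4}" using m(1) n(1) by auto
      have "(\<tau> n, \<kappa> n p, \<kappa> n q, \<kappa> n r) \<in> mfaces T'"
        by (rule tet_face) (use n2 tau_new p q r d n in auto)
      then show ?thesis
        using related move23_outerI[OF m(1) n2 all] unfolding fm corresponding_faces_def by blast
    qed
  qed
qed

lemma equatorial: "p \<in> {2, 3, 4} \<Longrightarrow> p \<le> 4 \<and> p \<noteq> 0 \<and> p \<noteq> (1::nat)"
  by auto

text \<open>One of the tetrahedra of \<open>T'\<close> in the bipyramid that contain the vertices \<open>p\<close> and \<open>q\<close>.\<close>

definition new_tet :: "nat \<Rightarrow> nat \<Rightarrow> nat" where
  "new_tet p q = (if 2 \<notin> {p, q} then 2 else if 3 \<notin> {p, q} then 3 else 4)"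

lemma new_tet: "new_tet p q \<in> {2, 3, 4}" "p \<noteq> new_tet p q" "q \<noteq> new_tet p q" "new_tet p q \<le> 4"
  by (auto simp: new_tet_def)

text \<open>The edge of the bipyramid from \<open>p\<close> to \<open>q\<close> may lie in several tetrahedra of \<open>T'\<close>; an edge
  function has the same value on all copies.\<close>

definition bipyramid_edge :: "('t oedge \<Rightarrow> 'c) \<Rightarrow> nat \<Rightarrow> nat \<Rightarrow> 'c" where
  "bipyramid_edge f p q = (let n = new_tet p q in f (\<tau> n, \<kappa> n p, \<kappa> n q))"

lemma bipyramid_edge:
  assumes f: "edge_function T' f" and n: "n \<in> {2, 3, 4}" and pq: "p \<le> 4" "q \<le> 4" "distinct [n, p, q]"
  shows "f (\<tau> n, \<kappa> n p, \<kappa> n q) = bipyramid_edge f p q"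
proof (cases "n = new_tet p q")
  case True then show ?thesis by (simp add: bipyramid_edge_def Let_def)
next
  case False
  define n' where "n' = new_tet p q"
  have n': "n' \<in> {2, 3, 4}" "p \<noteq> n'" "q \<noteq> n'" "n \<noteq> n'" using new_tet False by (auto simp: n'_def)
  obtain r where r: "r \<le> 4" "r \<notin> {n, n', p, q}" by (rule ex_other_vertex)
  have "(\<tau> n, \<kappa> n p, \<kappa> n q, \<kappa> n r) \<in> mfaces T'"
    by (rule tet_face) (use n n' pq r tau_new in auto)
  then have "f (\<tau> n, \<kappa> n p, \<kappa> n q) = f (\<tau> n', \<kappa> n' p, \<kappa> n' q)"
    by (rule edge_functionD[OF f _ glue_new]) (use n n' pq r in auto)
  then show ?thesis by (simp add: bipyramid_edge_def Let_def n'_def)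
qed

definition position :: "nat \<Rightarrow> nat \<Rightarrow> nat" where
  "position m = inv_into ({..4} - {m}) (\<kappa> m)"

lemma position: "m \<le> 4 \<Longrightarrow> p \<le> 4 \<Longrightarrow> p \<noteq> m \<Longrightarrow> position m (\<kappa> m p) = p"
  unfolding position_def by (rule inv_into_f_f[OF bij_betw_imp_inj_on[OF kappa_bij]]) auto

definition restrict_edges :: "('t oedge \<Rightarrow> 'c) \<Rightarrow> 't oedge \<Rightarrow> 'c" where
  "restrict_edges f = (\<lambda>(t, a, b).
     if t = \<tau> 0 then bipyramid_edge f (position 0 a) (position 0 b)
     else if t = \<tau> 1 then bipyramid_edge f (position 1 a) (position 1 b)
     else f (t, a, b))"

lemma restrict_edges_old:
  assumes "m \<in> {0, 1}" "p \<le> 4" "p \<noteq> m" "q \<le> 4" "q \<noteq> m"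
  shows "restrict_edges f (\<tau> m, \<kappa> m p, \<kappa> m q) = bipyramid_edge f p q"
  using assms tau_inj[of 1 0] position[of m] by (auto simp: restrict_edges_def)

lemma restrict_edges_unchanged: "t \<in> tets T' \<Longrightarrow> restrict_edges f (t, a, b) = f (t, a, b)"
  using tau_old(2)[of 0] tau_old(2)[of 1] by (auto simp: restrict_edges_def)

lemma restrict_edges_outer:
  assumes f: "edge_function T' f"
    and q: "((t, a, b, c), (t', a', b', c')) \<in> corresponding_faces"
  shows "restrict_edges f (t, a, b) = f (t', a', b')"
  using q unfolding corresponding_faces_def
proof
  assume "((t, a, b, c), (t', a', b', c')) \<in> {(q, q) | q. q \<in> mfaces T \<inter> mfaces T'}"
  then have "t' = t" "a' = a" "b' = b" "t \<in> tets T'" by (auto simp: mfaces_iff)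
  then show ?thesis using restrict_edges_unchanged by simp
next
  assume "((t, a, b, c), (t', a', b', c')) \<in> move23_outer \<tau> \<kappa>"
  then obtain m n p q r where e: "t = \<tau> m" "a = \<kappa> m p" "b = \<kappa> m q" "t' = \<tau> n" "a' = \<kappa> n p" "b' = \<kappa> n q"
    and mn: "m \<in> {0, 1}" "n \<in> {2, 3, 4}" "{m, n, p, q, r} = {..4}"
    unfolding move23_outer_def by blast
  note d = card_5_distinct[OF mn(3)]
  have "restrict_edges f (\<tau> m, \<kappa> m p, \<kappa> m q) = bipyramid_edge f p q"
    by (rule restrict_edges_old) (use mn d in auto)
  moreover have "f (\<tau> n, \<kappa> n p, \<kappa> n q) = bipyramid_edge f p q"
    by (rule bipyramid_edge[OF f]) (use mn d in auto)
  ultimately show ?thesis by (simp add: e)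
qed

lemma edge_function_restrict_edges:
  assumes f: "edge_function T' f"
  shows "edge_function T (restrict_edges f)"
  unfolding edge_function_conv_face_function
proof (rule restrict_face_function[OF f[unfolded edge_function_conv_face_function]])
  fix q q' assume q: "(q, q') \<in> corresponding_faces"
  obtain t a b c where 1: "q = (t, a, b, c)" by (cases q)
  obtain t' a' b' c' where 2: "q' = (t', a', b', c')" by (cases q')
  show "(case q of (t, a, b, c) \<Rightarrow> restrict_edges f (t, a, b)) = (case q' of (t, a, b, c) \<Rightarrow> f (t, a, b))"
    using restrict_edges_outer[OF f q[unfolded 1 2]] by (simp add: 1 2)
next
  fix p q r :: nat assume "p \<in> {2, 3, 4}" "q \<in> {2, 3, 4}" "r \<in> {2, 3, 4}" "distinct [p, q, r]"
  then show "(case (\<tau> 0, \<kappa> 0 p, \<kappa> 0 q, \<kappa> 0 r) of (t, a, b, c) \<Rightarrow> restrict_edges f (t, a, b)) =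
      (case (\<tau> 1, \<kappa> 1 p, \<kappa> 1 q, \<kappa> 1 r) of (t, a, b, c) \<Rightarrow> restrict_edges f (t, a, b))"
    using restrict_edges_old[of 0 p q f] restrict_edges_old[of 1 p q f] equatorial[of p] equatorial[of q]
    by simp
qed

lemma boundary_edges_outer:
  assumes "((t, a, b), (t', a', b')) \<in> boundary_edges (Move23 \<tau> \<kappa>)"
  obtains c c' where "((t, a, b, c), (t', a', b', c')) \<in> move23_outer \<tau> \<kappa>"
  using assms unfolding boundary_edges.simps by blast

lemma boundary_edgesI:
  assumes "((t, a, b, c), (t', a', b', c')) \<in> move23_outer \<tau> \<kappa>"
  shows "((t, a, b), (t', a', b')) \<in> boundary_edges (Move23 \<tau> \<kappa>)"
  unfolding boundary_edges.simps by (rule CollectI, intro exI conjI, rule refl, rule assms)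

lemma agree_restrict_edges:
  assumes f: "edge_function T' f"
  shows "agree (Move23 \<tau> \<kappa>) T T' (restrict_edges f) f"
  unfolding agree_def
proof (intro ballI)
  fix x assume x: "x \<in> common_edges (Move23 \<tau> \<kappa>) T T'"
  obtain t a b t' a' b' where x': "x = ((t, a, b), (t', a', b'))" by (cases x) auto
  from x consider "(t', a', b') = (t, a, b)" "(t, a, b) \<in> oriented_edges T'"
    | "((t, a, b), (t', a', b')) \<in> boundary_edges (Move23 \<tau> \<kappa>)"
    unfolding x' common_edges_def by blast
  then have "restrict_edges f (t, a, b) = f (t', a', b')"
  proof cases
    case 1 then show ?thesis using restrict_edges_unchanged by (auto simp: oriented_edges_def)
  next
    case 2
    then obtain c c' where "((t, a, b, c), (t', a', b', c')) \<in> move23_outer \<tau> \<kappa>"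
      by (rule boundary_edges_outer)
    then show ?thesis by (intro restrict_edges_outer[OF f] corresponding_facesI)
  qed
  then show "case x of (a, a') \<Rightarrow> restrict_edges f a = f a'" by (simp add: x')
qed

lemma bipyramid_edge_mult:
  assumes z: "cocycle T' z" and n: "n \<in> {2, 3, 4}" and pqr: "p \<le> 4" "q \<le> 4" "r \<le> 4" "distinct [n, p, q, r]"
  shows "bipyramid_edge z p q * bipyramid_edge z q r = bipyramid_edge z p r"
proof -
  have f: "edge_function T' z" using z by (simp add: cocycle_def)
  have "(\<tau> n, \<kappa> n p, \<kappa> n q, \<kappa> n r) \<in> mfaces T'"
    by (rule tet_face) (use n pqr tau_new in auto)
  from cocycle_mult[OF z this] show ?thesis
    using bipyramid_edge[OF f n, of p q] bipyramid_edge[OF f n, of q r] bipyramid_edge[OF f n, of p r] pqr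
    by simp
qed

lemma cocycle_restrict_edges:
  assumes z: "cocycle T' z"
  shows "cocycle T (restrict_edges z)"
  unfolding cocycle_def
proof (intro conjI ballI)
  have f: "edge_function T' z" using z by (simp add: cocycle_def)
  show "edge_function T (restrict_edges z)" by (rule edge_function_restrict_edges[OF f])
  fix e assume e: "e \<in> oriented_edges T"
  obtain t a b where e': "e = (t, a, b)" by (cases e)
  have ab: "a < 4" "b < 4" "a \<noteq> b" "t \<in> tets T" using e by (auto simp: e' oriented_edges_def)
  have "restrict_edges z (t, b, a) = inverse (restrict_edges z (t, a, b))"
  proof (cases "t \<in> {\<tau> 0, \<tau> 1}")
    case False
    then have "t \<in> tets T'" using tets_unchanged ab by blast
    then show ?thesis
      using cocycle_inverse[OF z, of t a b] ab by (simp add: restrict_edges_unchanged oriented_edges_def)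
  next
    case True
    then obtain m where m: "m \<in> {0, 1}" "t = \<tau> m" by blast
    then have m4: "m \<le> 4" by auto
    obtain p where p: "p \<le> 4" "p \<noteq> m" "\<kappa> m p = a" using kappa_surj[OF m4 ab(1)] by blast
    obtain q where q: "q \<le> 4" "q \<noteq> m" "\<kappa> m q = b" using kappa_surj[OF m4 ab(2)] by blast
    have pq: "p \<noteq> q" using ab p q by auto
    let ?n = "new_tet p q"
    note n = new_tet[where p = p and q = q]
    have "(\<tau> ?n, \<kappa> ?n p, \<kappa> ?n q) \<in> oriented_edges T'"
      by (rule tet_edge) (use n(2-4) p q pq tau_new(1)[OF n(1)] in auto)
    from cocycle_inverse[OF z this] have "bipyramid_edge z q p = inverse (bipyramid_edge z p q)"
      using bipyramid_edge[OF f n(1), of p q] bipyramid_edge[OF f n(1), of q p] n(2,3) p q pq by auto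
    then show ?thesis
      using restrict_edges_old[OF m(1) p(1,2) q(1,2), of z] restrict_edges_old[OF m(1) q(1,2) p(1,2), of z]
        p q m by simp
  qed
  then show "case e of (t, a, b) \<Rightarrow> restrict_edges z (t, b, a) = inverse (restrict_edges z (t, a, b))"
    by (simp add: e')
next
  have f: "edge_function T' z" using z by (simp add: cocycle_def)
  fix x assume x: "x \<in> mfaces T"
  obtain t a b c where x': "x = (t, a, b, c)" by (cases x)
  have abc: "a < 4" "b < 4" "c < 4" "a \<noteq> b" "b \<noteq> c" "a \<noteq> c" "t \<in> tets T"
    using x by (auto simp: x' mfaces_iff)
  have "restrict_edges z (t, a, b) * restrict_edges z (t, b, c) = restrict_edges z (t, a, c)"
  proof (cases "t \<in> {\<tau> 0, \<tau> 1}")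
    case False
    then have "t \<in> tets T'" using tets_unchanged abc by blast
    then show ?thesis
      using cocycle_mult[OF z, of t a b c] abc by (simp add: restrict_edges_unchanged mfaces_iff)
  next
    case True
    then obtain m where m: "m \<in> {0, 1}" "t = \<tau> m" by blast
    then have m4: "m \<le> 4" by auto
    obtain p where p: "p \<le> 4" "p \<noteq> m" "\<kappa> m p = a" using kappa_surj[OF m4 abc(1)] by blast
    obtain q where q: "q \<le> 4" "q \<noteq> m" "\<kappa> m q = b" using kappa_surj[OF m4 abc(2)] by blast
    obtain r where r: "r \<le> 4" "r \<noteq> m" "\<kappa> m r = c" using kappa_surj[OF m4 abc(3)] by blast
    have d: "distinct [p, q, r]" using abc p q r by auto
    have "bipyramid_edge z p q * bipyramid_edge z q r = bipyramid_edge z p r"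
    proof (cases "{2, 3, 4} \<subseteq> {p, q, r}")
      case False
      then obtain n where n: "n \<in> {2, 3, 4}" "n \<notin> {p, q, r}" by blast
      show ?thesis by (rule bipyramid_edge_mult[OF z n(1)]) (use p q r d n in auto)
    next
      case True
      \<comment> \<open>The equatorial face is not a face of \<open>T'\<close>; its sides are compared through the apex 0.\<close>
      have s: "{p, q, r} = {2, 3, 4}"
      proof (rule card_subset_eq[symmetric])
        have "card (set [p, q, r]) = length [p, q, r]" using d by (rule distinct_card)
        then show "card {2, 3, 4 :: nat} = card {p, q, r}" by simp
      qed (use True in auto)
      then have pqr: "p \<in> {2, 3, 4}" "q \<in> {2, 3, 4}" "r \<in> {2, 3, 4}" by blast+
      have 1: "bipyramid_edge z p 0 * bipyramid_edge z 0 q = bipyramid_edge z p q"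
        by (rule bipyramid_edge_mult[OF z pqr(3)]) (use p q r d pqr in auto)
      have 2: "bipyramid_edge z 0 q * bipyramid_edge z q r = bipyramid_edge z 0 r"
        by (rule bipyramid_edge_mult[OF z pqr(1)]) (use p q r d pqr in auto)
      have 3: "bipyramid_edge z p 0 * bipyramid_edge z 0 r = bipyramid_edge z p r"
        by (rule bipyramid_edge_mult[OF z pqr(2)]) (use p q r d pqr in auto)
      show ?thesis unfolding 1[symmetric] 3[symmetric] 2[symmetric] by (simp add: mult.assoc)
    qed
    then show ?thesis
      using restrict_edges_old[OF m(1) p(1,2) q(1,2), of z] restrict_edges_old[OF m(1) q(1,2) r(1,2), of z]
        restrict_edges_old[OF m(1) p(1,2) r(1,2), of z] p q r m by simp
  qed
  then show "case x of (t, a, b, c) \<Rightarrow>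
      restrict_edges z (t, a, b) * restrict_edges z (t, b, c) = restrict_edges z (t, a, c)"
    by (simp add: x')
qed

definition bipyramid_vertex :: "('t \<times> nat \<Rightarrow> 'c) \<Rightarrow> nat \<Rightarrow> 'c" where
  "bipyramid_vertex F p = (let n = new_tet p p in F (\<tau> n, \<kappa> n p))"

lemma bipyramid_vertex:
  assumes F: "vertex_function T' F" and n: "n \<in> {2, 3, 4}" and p: "p \<le> 4" "p \<noteq> n"
  shows "F (\<tau> n, \<kappa> n p) = bipyramid_vertex F p"
proof -
  define n' where "n' = new_tet p p"
  have n': "n' \<in> {2, 3, 4}" "p \<noteq> n'" using new_tet by (auto simp: n'_def)
  obtain q where q: "q \<le> 4" "q \<notin> {n, n', p, p}" by (rule ex_other_vertex)
  have "F (\<tau> n, \<kappa> n p) = bipyramid_edge (\<lambda>(t, a, b). F (t, a)) p q"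
    "F (\<tau> n', \<kappa> n' p) = bipyramid_edge (\<lambda>(t, a, b). F (t, a)) p q"
    using bipyramid_edge[OF F[unfolded vertex_function_def] n, of p q]
      bipyramid_edge[OF F[unfolded vertex_function_def] n'(1), of p q] p q n' by auto
  then show ?thesis by (simp add: bipyramid_vertex_def Let_def n'_def)
qed

definition restrict_vertices :: "('t \<times> nat \<Rightarrow> 'c) \<Rightarrow> 't \<times> nat \<Rightarrow> 'c" where
  "restrict_vertices F = (\<lambda>(t, a).
     if t = \<tau> 0 then bipyramid_vertex F (position 0 a)
     else if t = \<tau> 1 then bipyramid_vertex F (position 1 a)
     else F (t, a))"

lemma restrict_vertices_old:
  assumes "m \<in> {0, 1}" "p \<le> 4" "p \<noteq> m"
  shows "restrict_vertices F (\<tau> m, \<kappa> m p) = bipyramid_vertex F p"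
  using assms tau_inj[of 1 0] position[of m] by (auto simp: restrict_vertices_def)

lemma restrict_vertices_unchanged: "t \<in> tets T' \<Longrightarrow> restrict_vertices F (t, a) = F (t, a)"
  using tau_old(2)[of 0] tau_old(2)[of 1] by (auto simp: restrict_vertices_def)

lemma restrict_vertices_outer:
  assumes F: "vertex_function T' F"
    and q: "((t, a, b, c), (t', a', b', c')) \<in> corresponding_faces"
  shows "restrict_vertices F (t, a) = F (t', a') \<and> restrict_vertices F (t, b) = F (t', b')"
  using q unfolding corresponding_faces_def
proof
  assume "((t, a, b, c), (t', a', b', c')) \<in> {(q, q) | q. q \<in> mfaces T \<inter> mfaces T'}"
  then have "t' = t" "a' = a" "b' = b" "t \<in> tets T'" by (auto simp: mfaces_iff)
  then show ?thesis by (simp add: restrict_vertices_unchanged)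
next
  assume "((t, a, b, c), (t', a', b', c')) \<in> move23_outer \<tau> \<kappa>"
  then obtain m n p q r where e: "t = \<tau> m" "a = \<kappa> m p" "b = \<kappa> m q" "t' = \<tau> n" "a' = \<kappa> n p" "b' = \<kappa> n q"
    and mn: "m \<in> {0, 1}" "n \<in> {2, 3, 4}" "{m, n, p, q, r} = {..4}"
    unfolding move23_outer_def by blast
  note d = card_5_distinct[OF mn(3)]
  have "restrict_vertices F (\<tau> m, \<kappa> m x) = F (\<tau> n, \<kappa> n x)" if "x \<in> {p, q}" for x
    using restrict_vertices_old[OF mn(1), of x F] bipyramid_vertex[OF F mn(2), of x] that d by auto
  then show ?thesis by (simp add: e)
qed

lemma vertex_function_restrict_vertices:
  assumes F: "vertex_function T' F"
  shows "vertex_function T (restrict_vertices F)"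
  unfolding vertex_function_def edge_function_conv_face_function
proof (rule restrict_face_function[OF F[unfolded vertex_function_def edge_function_conv_face_function]])
  fix q q' assume q: "(q, q') \<in> corresponding_faces"
  obtain t a b c where 1: "q = (t, a, b, c)" by (cases q)
  obtain t' a' b' c' where 2: "q' = (t', a', b', c')" by (cases q')
  show "(case q of (t, a, b, c) \<Rightarrow> case (t, a, b) of (t, a, b) \<Rightarrow> restrict_vertices F (t, a)) =
      (case q' of (t, a, b, c) \<Rightarrow> case (t, a, b) of (t, a, b) \<Rightarrow> F (t, a))"
    using restrict_vertices_outer[OF F q[unfolded 1 2]] by (simp add: 1 2)
next
  fix p q r :: nat assume "p \<in> {2, 3, 4}" "q \<in> {2, 3, 4}" "r \<in> {2, 3, 4}" "distinct [p, q, r]"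
  then show "(case (\<tau> 0, \<kappa> 0 p, \<kappa> 0 q, \<kappa> 0 r) of
        (t, a, b, c) \<Rightarrow> case (t, a, b) of (t, a, b) \<Rightarrow> restrict_vertices F (t, a)) =
      (case (\<tau> 1, \<kappa> 1 p, \<kappa> 1 q, \<kappa> 1 r) of
        (t, a, b, c) \<Rightarrow> case (t, a, b) of (t, a, b) \<Rightarrow> restrict_vertices F (t, a))"
    using restrict_vertices_old[of 0 p F] restrict_vertices_old[of 1 p F] equatorial[of p] by simp
qed

lemma boundary_edges_oriented:
  assumes "((t, a, b), (t', a', b')) \<in> boundary_edges (Move23 \<tau> \<kappa>)"
  shows "(t, a, b) \<in> oriented_edges T" "(t', a', b') \<in> oriented_edges T'"
proof -
  obtain m n p q r where e: "t = \<tau> m" "a = \<kappa> m p" "b = \<kappa> m q" "t' = \<tau> n" "a' = \<kappa> n p" "b' = \<kappa> n q"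
    and mn: "m \<in> {0, 1}" "n \<in> {2, 3, 4}" "{m, n, p, q, r} = {..4}"
    using assms unfolding boundary_edges.simps move23_outer_def by blast
  note d = card_5_distinct[OF mn(3)]
  have "m \<le> 4" "n \<le> 4" using mn(1,2) by auto
  then show "(t, a, b) \<in> oriented_edges T" "(t', a', b') \<in> oriented_edges T'"
    unfolding e using d tet_edge[of m p q T] tet_edge[of n p q T'] tau_old(1)[OF mn(1)] tau_new(1)[OF mn(2)]
    by simp_all
qed

lemma ex_common_edge:
  assumes e: "(t, a, b) \<in> oriented_edges T"
  shows "\<exists>t' a' b'. ((t, a, b), (t', a', b')) \<in> common_edges (Move23 \<tau> \<kappa>) T T'"
proof -
  have ab: "a < 4" "b < 4" "a \<noteq> b" "t \<in> tets T" using e by (auto simp: oriented_edges_def)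
  show ?thesis
  proof (cases "t \<in> {\<tau> 0, \<tau> 1}")
    case False
    then have "(t, a, b) \<in> oriented_edges T'" using tets_unchanged ab by (auto simp: oriented_edges_def)
    then show ?thesis using e unfolding common_edges_def by blast
  next
    case True
    then obtain m where m: "m \<in> {0, 1}" "t = \<tau> m" by blast
    then have m4: "m \<le> 4" by auto
    obtain p where p: "p \<le> 4" "p \<noteq> m" "\<kappa> m p = a" using kappa_surj[OF m4 ab(1)] by blast
    obtain q where q: "q \<le> 4" "q \<noteq> m" "\<kappa> m q = b" using kappa_surj[OF m4 ab(2)] by blast
    define n where "n = new_tet p q"
    have n: "n \<in> {2, 3, 4}" "p \<noteq> n" "q \<noteq> n" using new_tet by (auto simp: n_def)
    obtain r where r: "r \<le> 4" "r \<notin> {m, n, p, q}" by (rule ex_other_vertex)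
    have "distinct [m, n, p, q, r]" using n ab p q r m by auto
    then have all: "{m, n, p, q, r} = {..4}"
      by (rule all_5_vertices) (use n(1) p(1) q(1) r(1) m4 in auto)
    have "((t, a, b, \<kappa> m r), (\<tau> n, \<kappa> n p, \<kappa> n q, \<kappa> n r)) \<in> move23_outer \<tau> \<kappa>"
      using move23_outerI[OF m(1) n(1) all] m p q by simp
    then have "((t, a, b), (\<tau> n, \<kappa> n p, \<kappa> n q)) \<in> common_edges (Move23 \<tau> \<kappa>) T T'"
      unfolding common_edges_def by (intro UnI2 boundary_edgesI)
    then show ?thesis by blast
  qed
qed

end

section \<open>Restriction along a 0-2 move or a bubble move\<close>

lemma mfaces_mono: "tets T \<subseteq> tets T' \<Longrightarrow> q \<in> mfaces T \<Longrightarrow> q \<in> mfaces T'"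
  by (cases q) (auto simp: mfaces_iff)

lemma permuted_face:
  assumes "\<kappa> permutes {..<4}" "i < 4" "j < 4" "k < 4" "distinct [i, j, k]" "s \<in> tets S"
  shows "(s, \<kappa> i, \<kappa> j, \<kappa> k) \<in> mfaces S"
  using assms permutes_in_image[OF assms(1)] inj_eq[OF permutes_inj[OF assms(1)]]
  by (simp add: mfaces_iff)

text \<open>A 2-face \<open>q0\<close> is replaced by a pillow: in \<open>T'\<close> its two copies are glued to corresponding faces of
  the two new tetrahedra. A function that takes the same values on these tetrahedra does not notice
  the pillow.\<close>

lemma restrict_pillow_face:
  assumes T: "gluing T" and T': "gluing T'" and X: "face_function T' X"
    and \<kappa>: "\<kappa>1 permutes {..<4}" "\<kappa>2 permutes {..<4}" and s: "s1 \<in> tets T'" "s2 \<in> tets T'"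
    and Xs: "\<And>i j k. i < 4 \<Longrightarrow> j < 4 \<Longrightarrow> k < 4 \<Longrightarrow> distinct [i, j, k] \<Longrightarrow>
      X (s1, \<kappa>1 i, \<kappa>1 j, \<kappa>1 k) = X (s2, \<kappa>2 i, \<kappa>2 j, \<kappa>2 k)"
    and g: "q0 \<in> mfaces T" "glue T' (s1, \<kappa>1 i, \<kappa>1 j, \<kappa>1 k) = q0"
      "glue T' (s2, \<kappa>2 i, \<kappa>2 j, \<kappa>2 k) = glue T q0"
    and ijk: "i < 4" "j < 4" "k < 4" "distinct [i, j, k]"
    and q: "q \<in> mfaces T" "unmark q \<in> {unmark q0, unmark (glue T q0)}"
  shows "X (glue T q) = X q"
proof -
  define p1 p2 where "p1 = (s1, \<kappa>1 i, \<kappa>1 j, \<kappa>1 k)" and "p2 = (s2, \<kappa>2 i, \<kappa>2 j, \<kappa>2 k)"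
  have p: "p1 \<in> mfaces T'" "p2 \<in> mfaces T'"
    unfolding p1_def p2_def using permuted_face \<kappa> s ijk by metis+
  have pp: "X (remark n p1) = X (remark n p2)" if "n < 6" for n
    unfolding p1_def p2_def using less_6_cases[OF that] ijk
      Xs[of i j k] Xs[of j i k] Xs[of j k i] Xs[of k j i] Xs[of k i j] Xs[of i k j]
    by (elim disjE) auto
  have X': "X (remark n (glue T' p)) = X (remark n p)" if "p \<in> mfaces T'" "n < 6" for p n
    using X remark_mfaces[OF that(2,1)] glue_remark[OF T' that] by (metis face_function_def)
  have g': "glue T' p1 = q0" "glue T' p2 = glue T q0" using g(2,3) by (simp_all add: p1_def p2_def)
  have g0: "glue T q0 \<in> mfaces T" using gluing_mfaces[OF T g(1)] .
  consider "unmark q = unmark q0" | "unmark q = unmark (glue T q0)" using q(2) by blast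
  then show ?thesis
  proof cases
    case 1
    obtain n where n: "n < 6" "q = remark n q0" using same_unmark_remark[OF g(1) q(1) 1] .
    have "X (glue T q) = X (remark n (glue T' p2))"
      unfolding n(2) glue_remark[OF T g(1) n(1)] g'(2) ..
    also have "\<dots> = X (remark n (glue T' p1))" using X' p pp n(1) by simp
    finally show ?thesis unfolding g'(1) n(2) .
  next
    case 2
    obtain n where n: "n < 6" "q = remark n (glue T q0)" using same_unmark_remark[OF g0 q(1) 2] .
    have "X (glue T q) = X (remark n (glue T' p1))"
      unfolding n(2) glue_remark[OF T g0 n(1)] gluing_involution[OF T g(1)] g'(1) ..
    also have "\<dots> = X (remark n (glue T' p2))" using X' p pp n(1) by simp
    finally show ?thesis unfolding g'(2) n(2) .
  qed
qed

lemma face_function_restrict_02: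
  assumes m: "positive_move (Move02 q1 q2 s1 s2 \<kappa>1 \<kappa>2) T T'" and T: "gluing T" and T': "gluing T'"
    and X: "face_function T' X"
    and s: "\<And>i j k. i < 4 \<Longrightarrow> j < 4 \<Longrightarrow> k < 4 \<Longrightarrow> distinct [i, j, k] \<Longrightarrow>
      X (s1, \<kappa>1 i, \<kappa>1 j, \<kappa>1 k) = X (s2, \<kappa>2 i, \<kappa>2 j, \<kappa>2 k)"
  shows "face_function T X"
  unfolding face_function_def
proof
  fix q assume q: "q \<in> mfaces T"
  have qq: "q1 \<in> mfaces T" "q2 \<in> mfaces T" and tets: "tets T' = tets T \<union> {s1, s2}"
    and p: "\<kappa>1 permutes {..<4}" "\<kappa>2 permutes {..<4}"
    and g1: "glue T' (s1, \<kappa>1 0, \<kappa>1 1, \<kappa>1 2) = q1" "glue T' (s2, \<kappa>2 0, \<kappa>2 1, \<kappa>2 2) = glue T q1"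
    and g2: "glue T' (s1, \<kappa>1 0, \<kappa>1 1, \<kappa>1 3) = q2" "glue T' (s2, \<kappa>2 0, \<kappa>2 1, \<kappa>2 3) = glue T q2"
    and o: "\<forall>q\<in>mfaces T. unmark q \<notin> unmark ` {q1, glue T q1, q2, glue T q2} \<longrightarrow> glue T' q = glue T q"
    using m unfolding positive_move.simps by (elim conjE, simp)+
  have ss: "s1 \<in> tets T'" "s2 \<in> tets T'" using tets by simp_all
  consider "unmark q \<in> {unmark q1, unmark (glue T q1)}" | "unmark q \<in> {unmark q2, unmark (glue T q2)}"
    | "unmark q \<notin> unmark ` {q1, glue T q1, q2, glue T q2}" by auto
  then show "X (glue T q) = X q"
  proof cases
    case 1
    show ?thesis by (rule restrict_pillow_face[OF T T' X p ss s qq(1) g1 _ _ _ _ q 1]) simp_all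
  next
    case 2
    show ?thesis by (rule restrict_pillow_face[OF T T' X p ss s qq(2) g2 _ _ _ _ q 2]) simp_all
  next
    case 3
    then have "glue T q = glue T' q" using o q by simp
    moreover have "q \<in> mfaces T'" using mfaces_mono[OF _ q] tets by blast
    ultimately show ?thesis using X by (simp add: face_function_def)
  qed
qed

lemma face_function_restrict_bubble:
  assumes m: "positive_move (Bubble q0 s1 s2 \<kappa>1 \<kappa>2) T T'" and T: "gluing T" and T': "gluing T'"
    and X: "face_function T' X"
    and s: "\<And>i j k. i < 4 \<Longrightarrow> j < 4 \<Longrightarrow> k < 4 \<Longrightarrow> distinct [i, j, k] \<Longrightarrow>
      X (s1, \<kappa>1 i, \<kappa>1 j, \<kappa>1 k) = X (s2, \<kappa>2 i, \<kappa>2 j, \<kappa>2 k)"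
  shows "face_function T X"
  unfolding face_function_def
proof
  fix q assume q: "q \<in> mfaces T"
  have qq: "q0 \<in> mfaces T" and tets: "tets T' = tets T \<union> {s1, s2}"
    and p: "\<kappa>1 permutes {..<4}" "\<kappa>2 permutes {..<4}"
    and g: "glue T' (s1, \<kappa>1 0, \<kappa>1 1, \<kappa>1 2) = q0" "glue T' (s2, \<kappa>2 0, \<kappa>2 1, \<kappa>2 2) = glue T q0"
    and o: "\<forall>q\<in>mfaces T. unmark q \<notin> unmark ` {q0, glue T q0} \<longrightarrow> glue T' q = glue T q"
    using m unfolding positive_move.simps by (elim conjE, simp)+
  have ss: "s1 \<in> tets T'" "s2 \<in> tets T'" using tets by simp_all
  show "X (glue T q) = X q"
  proof (cases "unmark q \<in> {unmark q0, unmark (glue T q0)}")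
    case True
    show ?thesis by (rule restrict_pillow_face[OF T T' X p ss s qq g _ _ _ _ q True]) simp_all
  next
    case False
    then have "glue T q = glue T' q" using o q by simp
    moreover have "q \<in> mfaces T'" using mfaces_mono[OF _ q] tets by blast
    ultimately show ?thesis using X by (simp add: face_function_def)
  qed
qed

lemma glued_edges_agree:
  assumes T: "gluing T" and f: "edge_function T f" and q: "(t, a, b, c) \<in> mfaces T"
    and g: "glue T (t, a, b, c) = (t', a', b', c')"
  shows "f (t, a, b) = f (t', a', b')" "f (t, b, a) = f (t', b', a')" "f (t, b, c) = f (t', b', c')"
    "f (t, c, b) = f (t', c', b')" "f (t, c, a) = f (t', c', a')" "f (t, a, c) = f (t', a', c')"
proof -
  have r: "f (fst p, fst (snd p), fst (snd (snd p))) = f (fst p', fst (snd p'), fst (snd (snd p')))"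
    if "p = remark n (t, a, b, c)" "p' = remark n (t', a', b', c')" "n < 6" for n p p'
  proof -
    have "p \<in> mfaces T" using remark_mfaces[OF that(3) q] that(1) by simp
    moreover have "glue T p = p'" using glue_remark[OF T q that(3)] that(1,2) g by simp
    ultimately show ?thesis using edge_functionD[OF f] by (cases p, cases p') auto
  qed
  show "f (t, a, b) = f (t', a', b')" using r[OF refl refl, of 0] by simp
  show "f (t, b, a) = f (t', b', a')" using r[OF refl refl, of 1] by simp
  show "f (t, b, c) = f (t', b', c')" using r[OF refl refl, of 2] by simp
  show "f (t, c, b) = f (t', c', b')" using r[OF refl refl, of 3] by simp
  show "f (t, c, a) = f (t', c', a')" using r[OF refl refl, of 4] by simp
  show "f (t, a, c) = f (t', a', c')" using r[OF refl refl, of 5] by simp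
qed

text \<open>In a 0-2 move the edge [a,b] is split, and an edge function of \<open>T'\<close> may take different values at
  the two copies. It takes the same value if, as for a cocycle, its value on an edge is determined by
  those on the two other sides of a triangle.\<close>

lemma pillow_edges_02:
  assumes m: "positive_move (Move02 q1 q2 s1 s2 \<kappa>1 \<kappa>2) T T'" and T': "gluing T'"
    and f: "edge_function T' f"
    and tri: "\<And>t a b c t' a' b' c'. (t, a, b, c) \<in> mfaces T' \<Longrightarrow> (t', a', b', c') \<in> mfaces T' \<Longrightarrow>
      f (t, a, c) = f (t', a', c') \<Longrightarrow> f (t, c, b) = f (t', c', b') \<Longrightarrow> f (t, a, b) = f (t', a', b')"
    and ij: "i < 4" "j < 4" "i \<noteq> j"
  shows "f (s1, \<kappa>1 i, \<kappa>1 j) = f (s2, \<kappa>2 i, \<kappa>2 j)"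
proof -
  have tets: "tets T' = tets T \<union> {s1, s2}"
    and p: "\<kappa>1 permutes {..<4}" "\<kappa>2 permutes {..<4}"
    and g: "glue T' (s1, \<kappa>1 0, \<kappa>1 2, \<kappa>1 3) = (s2, \<kappa>2 0, \<kappa>2 2, \<kappa>2 3)"
      "glue T' (s1, \<kappa>1 1, \<kappa>1 2, \<kappa>1 3) = (s2, \<kappa>2 1, \<kappa>2 2, \<kappa>2 3)"
    using m unfolding positive_move.simps by (elim conjE, simp)+
  have F: "(s1, \<kappa>1 i, \<kappa>1 j, \<kappa>1 k) \<in> mfaces T'" "(s2, \<kappa>2 i, \<kappa>2 j, \<kappa>2 k) \<in> mfaces T'"
    if "i < 4" "j < 4" "k < 4" "distinct [i, j, k]" for i j k
    by (rule permuted_face[OF p(1) that], simp add: tets, rule permuted_face[OF p(2) that], simp add: tets)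
  have "(s1, \<kappa>1 0, \<kappa>1 2, \<kappa>1 3) \<in> mfaces T'" "(s1, \<kappa>1 1, \<kappa>1 2, \<kappa>1 3) \<in> mfaces T'"
    by (rule F; simp)+
  note e = glued_edges_agree[OF T' f this(1) g(1)] glued_edges_agree[OF T' f this(2) g(2)]
  have "f (s1, \<kappa>1 0, \<kappa>1 1) = f (s2, \<kappa>2 0, \<kappa>2 1)"
    by (rule tri[of _ _ _ "\<kappa>1 2" _ _ _ "\<kappa>2 2"]) (use F e in simp_all)
  moreover have "f (s1, \<kappa>1 1, \<kappa>1 0) = f (s2, \<kappa>2 1, \<kappa>2 0)"
    by (rule tri[of _ _ _ "\<kappa>1 2" _ _ _ "\<kappa>2 2"]) (use F e in simp_all)
  ultimately show ?thesis
    using less_4_cases[OF ij(1)] less_4_cases[OF ij(2)] ij(3) e by (elim disjE) simp_all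
qed

lemma pillow_edges_bubble:
  assumes m: "positive_move (Bubble q0 s1 s2 \<kappa>1 \<kappa>2) T T'" and T': "gluing T'"
    and f: "edge_function T' f" and ij: "i < 4" "j < 4" "i \<noteq> j"
  shows "f (s1, \<kappa>1 i, \<kappa>1 j) = f (s2, \<kappa>2 i, \<kappa>2 j)"
proof -
  have tets: "tets T' = tets T \<union> {s1, s2}"
    and p: "\<kappa>1 permutes {..<4}" "\<kappa>2 permutes {..<4}"
    and g: "glue T' (s1, \<kappa>1 0, \<kappa>1 1, \<kappa>1 3) = (s2, \<kappa>2 0, \<kappa>2 1, \<kappa>2 3)"
      "glue T' (s1, \<kappa>1 0, \<kappa>1 2, \<kappa>1 3) = (s2, \<kappa>2 0, \<kappa>2 2, \<kappa>2 3)"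
      "glue T' (s1, \<kappa>1 1, \<kappa>1 2, \<kappa>1 3) = (s2, \<kappa>2 1, \<kappa>2 2, \<kappa>2 3)"
    using m unfolding positive_move.simps by (elim conjE, simp)+
  have "s1 \<in> tets T'" using tets by simp
  then have "(s1, \<kappa>1 0, \<kappa>1 1, \<kappa>1 3) \<in> mfaces T'" "(s1, \<kappa>1 0, \<kappa>1 2, \<kappa>1 3) \<in> mfaces T'"
    "(s1, \<kappa>1 1, \<kappa>1 2, \<kappa>1 3) \<in> mfaces T'"
    by (simp_all add: permuted_face[OF p(1)])
  note e = glued_edges_agree[OF T' f this(1) g(1)] glued_edges_agree[OF T' f this(2) g(2)]
    glued_edges_agree[OF T' f this(3) g(3)]
  show ?thesis
    using less_4_cases[OF ij(1)] less_4_cases[OF ij(2)] ij(3) e by (elim disjE) simp_all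
qed

section \<open>Restriction of cocycles and vertex functions along a positive move\<close>

lemma move_tets_mono:
  assumes "positive_move m T T'" "\<And>\<tau> \<kappa>. m \<noteq> Move23 \<tau> \<kappa>"
  shows "tets T \<subseteq> tets T'" "boundary_edges m = {}" "boundary_faces m = {}"
proof -
  have "(\<exists>q1 q2 s1 s2 \<kappa>1 \<kappa>2. m = Move02 q1 q2 s1 s2 \<kappa>1 \<kappa>2) \<or> (\<exists>q s1 s2 \<kappa>1 \<kappa>2. m = Bubble q s1 s2 \<kappa>1 \<kappa>2)"
    using assms(2) by (cases m) auto
  then show "boundary_edges m = {}" "boundary_faces m = {}" by (elim disjE exE; simp)+
  show "tets T \<subseteq> tets T'"
  proof (cases m)
    case (Move02 q1 q2 s1 s2 \<kappa>1 \<kappa>2)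
    then have "tets T' = tets T \<union> {s1, s2}"
      using assms(1) unfolding Move02 positive_move.simps by (elim conjE)
    then show ?thesis by blast
  next
    case (Bubble q s1 s2 \<kappa>1 \<kappa>2)
    then have "tets T' = tets T \<union> {s1, s2}"
      using assms(1) unfolding Bubble positive_move.simps by (elim conjE)
    then show ?thesis by blast
  qed (use assms(2) in blast)
qed

lemma cocycle_mono:
  assumes z: "cocycle T' z" and s: "tets T \<subseteq> tets T'" and f: "edge_function T z"
  shows "cocycle T z"
  unfolding cocycle_def
proof (intro conjI ballI)
  show "case e of (t, a, b) \<Rightarrow> z (t, b, a) = inverse (z (t, a, b))" if "e \<in> oriented_edges T" for e
    using cocycle_inverse[OF z] that s by (cases e) (auto simp: oriented_edges_def)
  show "case q of (t, a, b, c) \<Rightarrow> z (t, a, b) * z (t, b, c) = z (t, a, c)" if "q \<in> mfaces T" for q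
    using cocycle_mult[OF z] mfaces_mono[OF s that] by (cases q) simp
qed (rule f)

lemma pillow_edge_function:
  assumes m: "positive_move m T T'" "\<And>\<tau> \<kappa>. m \<noteq> Move23 \<tau> \<kappa>" and T: "gluing T" and T': "gluing T'"
    and f: "edge_function T' f"
    and tri: "\<And>t a b c t' a' b' c'. (t, a, b, c) \<in> mfaces T' \<Longrightarrow> (t', a', b', c') \<in> mfaces T' \<Longrightarrow>
      f (t, a, c) = f (t', a', c') \<Longrightarrow> f (t, c, b) = f (t', c', b') \<Longrightarrow> f (t, a, b) = f (t', a', b')"
  shows "edge_function T f"
proof (cases m)
  case (Move23 \<tau> \<kappa>) then show ?thesis using m(2) by blast
next
  case (Move02 q1 q2 s1 s2 \<kappa>1 \<kappa>2)
  note m' = m(1)[unfolded Move02]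
  have "f (s1, \<kappa>1 i, \<kappa>1 j) = f (s2, \<kappa>2 i, \<kappa>2 j)" if "i < 4" "j < 4" "i \<noteq> j" for i j
    using pillow_edges_02[OF m' T' f tri that] .
  then show ?thesis
    unfolding edge_function_conv_face_function
    by (intro face_function_restrict_02[OF m' T T' f[unfolded edge_function_conv_face_function]]) simp
next
  case (Bubble q0 s1 s2 \<kappa>1 \<kappa>2)
  note m' = m(1)[unfolded Bubble]
  have "f (s1, \<kappa>1 i, \<kappa>1 j) = f (s2, \<kappa>2 i, \<kappa>2 j)" if "i < 4" "j < 4" "i \<noteq> j" for i j
    using pillow_edges_bubble[OF m' T' f that] .
  then show ?thesis
    unfolding edge_function_conv_face_function
    by (intro face_function_restrict_bubble[OF m' T T' f[unfolded edge_function_conv_face_function]]) simp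
qed

text \<open>After a 0-2 or a bubble move the same function is a cocycle on the smaller triangulation. For a 2-3
  move the values on the edges of the two old tetrahedra are read off the boundary of the bipyramid.\<close>

lemma restrict_cocycle:
  assumes m: "positive_move m T T'" and T: "gluing T" and T': "gluing T'" and z: "cocycle T' z'"
  obtains z where "cocycle T z" "agree m T T' z z'"
proof (cases "\<exists>\<tau> \<kappa>. m = Move23 \<tau> \<kappa>")
  case True
  then obtain \<tau> \<kappa> where m': "m = Move23 \<tau> \<kappa>" by blast
  interpret bipyramid \<tau> \<kappa> T T' by unfold_locales (use m m' T T' in simp_all)
  have "edge_function T' z'" using z by (simp add: cocycle_def)
  from that[OF cocycle_restrict_edges[OF z]] show ?thesis
    unfolding m' using agree_restrict_edges[OF \<open>edge_function T' z'\<close>] by blast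
next
  case False
  then have m2: "\<And>\<tau> \<kappa>. m \<noteq> Move23 \<tau> \<kappa>" by blast
  note s = move_tets_mono[OF m m2]
  have f: "edge_function T' z'" using z by (simp add: cocycle_def)
  have "edge_function T z'"
  proof (rule pillow_edge_function[OF m m2 T T' f])
    fix t a b c t' a' b' c'
    assume q: "(t, a, b, c) \<in> mfaces T'" "(t', a', b', c') \<in> mfaces T'"
      and e: "z' (t, a, c) = z' (t', a', c')" "z' (t, c, b) = z' (t', c', b')"
    have "(t, a, c, b) \<in> mfaces T'" "(t', a', c', b') \<in> mfaces T'" using q by (auto simp: mfaces_iff)
    from cocycle_mult[OF z this(1)] cocycle_mult[OF z this(2)] e
    show "z' (t, a, b) = z' (t', a', b')" by simp
  qed
  then have "cocycle T z'" by (rule cocycle_mono[OF z s(1)])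
  moreover have "agree m T T' z' z'"
    unfolding agree_def common_edges_def s(2) by auto
  ultimately show ?thesis by (rule that)
qed

lemma restrict_vertex_function:
  assumes m: "positive_move m T T'" and T: "gluing T" and T': "gluing T'" and F: "vertex_function T' F'"
  obtains F where "vertex_function T F"
    "\<And>t a b t' a' b'. ((t, a, b), (t', a', b')) \<in> common_edges m T T' \<Longrightarrow>
      F (t, a) = F' (t', a') \<and> F (t, b) = F' (t', b')"
proof (cases "\<exists>\<tau> \<kappa>. m = Move23 \<tau> \<kappa>")
  case True
  then obtain \<tau> \<kappa> where m': "m = Move23 \<tau> \<kappa>" by blast
  interpret bipyramid \<tau> \<kappa> T T' by unfold_locales (use m m' T T' in simp_all)
  show ?thesis
  proof (rule that[OF vertex_function_restrict_vertices[OF F]])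
    fix t a b t' a' b' assume e: "((t, a, b), (t', a', b')) \<in> common_edges m T T'"
    then consider "(t', a', b') = (t, a, b)" "(t, a, b) \<in> oriented_edges T'"
      | "((t, a, b), (t', a', b')) \<in> boundary_edges (Move23 \<tau> \<kappa>)"
      unfolding common_edges_def m' by blast
    then show "restrict_vertices F' (t, a) = F' (t', a') \<and> restrict_vertices F' (t, b) = F' (t', b')"
    proof cases
      case 1
      then have "t \<in> tets T'" by (auto simp: oriented_edges_def)
      then show ?thesis using 1(1) by (simp add: restrict_vertices_unchanged)
    next
      case 2
      then obtain c c' where "((t, a, b, c), (t', a', b', c')) \<in> move23_outer \<tau> \<kappa>"
        by (rule boundary_edges_outer)
      then show ?thesis by (intro restrict_vertices_outer[OF F] corresponding_facesI)
    qed
  qed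
next
  case False
  then have m2: "\<And>\<tau> \<kappa>. m \<noteq> Move23 \<tau> \<kappa>" by blast
  note s = move_tets_mono[OF m m2]
  have "vertex_function T F'"
    unfolding vertex_function_def
    by (rule pillow_edge_function[OF m m2 T T' F[unfolded vertex_function_def]]) simp
  then show ?thesis
    by (rule that) (auto simp: common_edges_def s(2))
qed

lemma ex_common_edge:
  assumes m: "positive_move m T T'" and T: "gluing T" and T': "gluing T'"
    and e: "(t, a, b) \<in> oriented_edges T"
  obtains t' a' b' where "((t, a, b), (t', a', b')) \<in> common_edges m T T'" "(t', a', b') \<in> oriented_edges T'"
proof (cases "\<exists>\<tau> \<kappa>. m = Move23 \<tau> \<kappa>")
  case True
  then obtain \<tau> \<kappa> where m': "m = Move23 \<tau> \<kappa>" by blast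
  interpret bipyramid \<tau> \<kappa> T T' by unfold_locales (use m m' T T' in simp_all)
  obtain t' a' b' where e': "((t, a, b), (t', a', b')) \<in> common_edges m T T'"
    using ex_common_edge[OF e] m' by blast
  have "(t', a', b') \<in> oriented_edges T'"
  proof (cases "((t, a, b), (t', a', b')) \<in> boundary_edges m")
    case True then show ?thesis using boundary_edges_oriented(2) m' by blast
  next
    case False
    then have "((t, a, b), (t', a', b')) \<in> {(a, a) | a. a \<in> oriented_edges T \<inter> oriented_edges T'}"
      using e' unfolding common_edges_def by blast
    then show ?thesis by auto
  qed
  with e' show ?thesis by (rule that)
next
  case False
  then have "tets T \<subseteq> tets T'" using move_tets_mono[OF m] by blast
  then have "(t, a, b) \<in> oriented_edges T'" using e by (auto simp: oriented_edges_def)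
  then show ?thesis using that[of t a b] e unfolding common_edges_def by auto
qed

lemma move23_outerE:
  assumes "(x, y) \<in> move23_outer \<tau> \<kappa>"
  obtains m n p q r where "x = (\<tau> m, \<kappa> m p, \<kappa> m q, \<kappa> m r)" "y = (\<tau> n, \<kappa> n p, \<kappa> n q, \<kappa> n r)"
    "m \<in> {0, 1}" "n \<in> {2, 3, 4}" "{m, n, p, q, r} = {..4}"
  using assms unfolding move23_outer_def mem_Collect_eq by (elim exE conjE) (rule that, simp_all)

lemma in_place_edge:
  assumes h: "\<forall>t\<in>tets T \<inter> tets T'. \<forall>x\<in>standard_simplex 3. h (chart T' t x) = chart T t x"
    and hb: "\<forall>((t, a, b, c), (t', a', b', c'))\<in>boundary_faces m.
        \<forall>x\<in>standard_simplex 3. \<forall>x'\<in>standard_simplex 3.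
          x a + x b + x c = 1 \<and> x' a' = x a \<and> x' b' = x b \<and> x' c' = x c \<longrightarrow>
          h (chart T' t' x') = chart T t x"
    and m: "positive_move m T T'" and T: "gluing T" and T': "gluing T'"
    and e: "((t, a, b), (t', a', b')) \<in> common_edges m T T'" and r: "r \<in> {0..1}"
  shows "h (chart T' t' (edge_point a' b' r)) = chart T t (edge_point a b r)"
proof (cases "((t, a, b), (t', a', b')) \<in> boundary_edges m")
  case False
  then have "((t, a, b), (t', a', b')) \<in> {(a, a) | a. a \<in> oriented_edges T \<inter> oriented_edges T'}"
    using e unfolding common_edges_def by blast
  then have e': "t' = t" "a' = a" "b' = b" "t \<in> tets T \<inter> tets T'" "a < 4" "b < 4" "a \<noteq> b"
    by (auto simp: oriented_edges_def)
  show ?thesis unfolding e'(1-3)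
    using bspec[OF bspec[OF h e'(4)] edge_point_in_simplex[OF e'(5-7) r]] .
next
  case True
  then have "\<exists>\<tau> \<kappa>. m = Move23 \<tau> \<kappa>" by (cases m) simp_all
  then obtain \<tau> \<kappa> where m': "m = Move23 \<tau> \<kappa>" by blast
  interpret bipyramid \<tau> \<kappa> T T' by unfold_locales (use m m' T T' in simp_all)
  obtain c c' where o: "((t, a, b, c), (t', a', b', c')) \<in> move23_outer \<tau> \<kappa>"
    using boundary_edges_outer True m' by blast
  obtain n n' p q s where f': "(t, a, b, c) = (\<tau> n, \<kappa> n p, \<kappa> n q, \<kappa> n s)"
      "(t', a', b', c') = (\<tau> n', \<kappa> n' p, \<kappa> n' q, \<kappa> n' s)"
    and n: "n \<in> {0, 1}" "n' \<in> {2, 3, 4}" "{n, n', p, q, s} = {..4}"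
    using o by (rule move23_outerE)
  from f' have f: "t = \<tau> n" "a = \<kappa> n p" "b = \<kappa> n q" "c = \<kappa> n s"
      "t' = \<tau> n'" "a' = \<kappa> n' p" "b' = \<kappa> n' q" "c' = \<kappa> n' s" by simp_all
  note d = card_5_distinct[OF n(3)]
  have n4: "n \<le> 4" "n' \<le> 4" using n(1,2) by auto
  have "(t, a, b, c) \<in> mfaces T" unfolding f
    by (rule tet_face) (use d n4 tau_old(1)[OF n(1)] in auto)
  then have abc: "a < 4" "b < 4" "c < 4" "a \<noteq> b" "b \<noteq> c" "a \<noteq> c" by (auto simp: mfaces_iff)
  have "(t', a', b', c') \<in> mfaces T'" unfolding f
    by (rule tet_face) (use d n4 tau_new(1)[OF n(2)] in auto)
  then have abc': "a' < 4" "b' < 4" "c' < 4" "a' \<noteq> b'" "b' \<noteq> c'" "a' \<noteq> c'" by (auto simp: mfaces_iff)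
  have x: "edge_point a b r \<in> standard_simplex 3" "edge_point a' b' r \<in> standard_simplex 3"
    using edge_point_in_simplex abc abc' r by blast+
  have v: "edge_point a b r a + edge_point a b r b + edge_point a b r c = 1 \<and>
      edge_point a' b' r a' = edge_point a b r a \<and> edge_point a' b' r b' = edge_point a b r b \<and>
      edge_point a' b' r c' = edge_point a b r c"
    using abc abc' by (auto simp: edge_point_def)
  have mem: "((t, a, b, c), (t', a', b', c')) \<in> boundary_faces m" using o by (simp add: m')
  have "\<forall>x\<in>standard_simplex 3. \<forall>x'\<in>standard_simplex 3.
      x a + x b + x c = 1 \<and> x' a' = x a \<and> x' b' = x b \<and> x' c' = x c \<longrightarrow>
      h (chart T' t' x') = chart T t x"
    using bspec[OF hb mem] by (simp only: prod.case)
  then show ?thesis using x v by blast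
qed

lemma agreeD: "agree m T T' f f' \<Longrightarrow> (e, e') \<in> common_edges m T T' \<Longrightarrow> f e = f' e'"
  unfolding agree_def by (drule bspec, assumption) simp

text \<open>The hypothesis on \<open>z'\<close> concerns all edges, because an edge from the smallest vertex of an old
  tetrahedron need not start at the smallest vertex of a new one.\<close>

lemma restrict_D_triangulation:
  assumes fl: "flat_psl2_bundle W \<rho>" and tr: "positive_branching_transit W \<omega> m T b T' b'"
    and D: "D_triangulation W \<omega> \<rho> (T', b', z')"
    and gen: "\<And>e. e \<in> oriented_edges T' \<Longrightarrow> moebius (z' e) (Aff 0) \<notin> {Aff 0, Infty}"
  obtains z where "D_triangulation W \<omega> \<rho> (T, b, z)" "agree m T T' z z'"
proof -
  have T: "triangulates T W \<omega>" "quasi_regular T" "is_branching T b" and T': "triangulates T' W \<omega>"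
    and m: "positive_move m T T'" and pl: "in_place W m T T'"
    using tr by (simp_all add: positive_branching_transit_def)
  have gl: "gluing T" "gluing T'" using T T' by (simp_all add: triangulates_def)
  have ch: "\<forall>t\<in>tets T'. singular_simplex 3 W (chart T' t)" using T' by (simp add: triangulates_def)
  have z': "cocycle T' z'" and rep: "represents T' z' \<rho>" using D by (simp_all add: D_triangulation_def)
  obtain z where z: "cocycle T z" and ag: "agree m T T' z z'" using restrict_cocycle[OF m gl z'] .
  obtain F where F: "vertex_function T F" and
    FF: "\<And>t a b t' a' b'. ((t, a, b), (t', a', b')) \<in> common_edges m T T' \<Longrightarrow>
      F (t, a) = chart T' t' (corner a') \<and> F (t, b) = chart T' t' (corner b')"
    using restrict_vertex_function[OF m gl vertex_function_chart[OF T']] by (metis case_prod_conv)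
  obtain h where hom: "homotopic_with (\<lambda>_. True) W W h id" and
    h: "\<forall>t\<in>tets T \<inter> tets T'. \<forall>x\<in>standard_simplex 3. h (chart T' t x) = chart T t x" and
    hb: "\<forall>((t, a, b, c), (t', a', b', c'))\<in>boundary_faces m.
        \<forall>x\<in>standard_simplex 3. \<forall>x'\<in>standard_simplex 3.
          x a + x b + x c = 1 \<and> x' a' = x a \<and> x' b' = x b \<and> x' c' = x c \<longrightarrow>
          h (chart T' t' x') = chart T t x"
    using pl unfolding in_place_def by blast
  have "represents T z \<rho>"
  proof (rule represents_via_homotopy[OF fl hom ch rep, where F = F])
    fix t a b assume e: "(t, a, b) \<in> oriented_edges T"
    obtain t' a' b' where e': "((t, a, b), (t', a', b')) \<in> common_edges m T T'"
      "(t', a', b') \<in> oriented_edges T'" using ex_common_edge[OF m gl e] .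
    have "a' \<noteq> b'" using e'(2) by (simp add: oriented_edges_def)
    then have "chart T' t' (edge_point a' b' 0) = F (t, a)" "chart T' t' (edge_point a' b' 1) = F (t, b)"
      using FF[OF e'(1)] by (simp_all add: edge_point_corner)
    moreover have "z (t, a, b) = z' (t', a', b')" using agreeD[OF ag e'(1)] .
    moreover have "\<forall>r\<in>{0..1}. h (chart T' t' (edge_point a' b' r)) = chart T t (edge_point a b r)"
      using in_place_edge[OF h hb m gl e'(1)] by blast
    ultimately show "\<exists>t' a' b'. (t', a', b') \<in> oriented_edges T' \<and> z (t, a, b) = z' (t', a', b') \<and>
       (\<forall>r\<in>{0..1}. h (chart T' t' (edge_point a' b' r)) = chart T t (edge_point a b r)) \<and>
       chart T' t' (edge_point a' b' 0) = F (t, a) \<and> chart T' t' (edge_point a' b' 1) = F (t, b)"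
      using e'(2) by blast
  next
    fix t a b t1 a1 b1 assume e: "(t, a, b) \<in> oriented_edges T" "(t1, a1, b1) \<in> oriented_edges T"
      "chart T t (edge_point a b 0) = chart T t1 (edge_point a1 b1 0)"
    then show "F (t, a) = F (t1, a1)"
      using vertex_function_chart_eq[OF T(1) F, of t a t1 a1]
      by (simp add: edge_point_corner oriented_edges_def)
  qed
  moreover have "idealizable b z t" if t: "t \<in> tets T" for t
  proof -
    obtain v where v: "orders b t v" using T(3) t by (auto simp: is_branching_def)
    show ?thesis
    proof (rule idealizableI[OF z t v])
      fix p q :: nat assume "p < 4" "q < 4" "p \<noteq> q"
      then have e: "(t, p, q) \<in> oriented_edges T" using t by (simp add: oriented_edges_def)
      obtain t' a' b' where e': "((t, p, q), (t', a', b')) \<in> common_edges m T T'"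
        "(t', a', b') \<in> oriented_edges T'" using ex_common_edge[OF m gl e] .
      show "moebius (z (t, p, q)) (Aff 0) \<notin> {Aff 0, Infty}"
        using gen[OF e'(2)] agreeD[OF ag e'(1)] by simp
    qed
  qed
  ultimately have "D_triangulation W \<omega> \<rho> (T, b, z)"
    using T z by (simp add: D_triangulation_def)
  then show ?thesis using ag that by blast
qed

section \<open>Moduli and moves\<close>

lemma moduli_of_unchanged:
  assumes t: "t \<in> tets T" "t \<in> tets T'" and b: "is_branching T b"
    and bb: "agree m T T' b b'" and zz: "agree m T T' z z'"
  shows "moduli_of T b z (t, e) = moduli_of T' b' z' (t, e)"
proof -
  have c: "((t, p, q), (t, p, q)) \<in> common_edges m T T'" if "p < 4" "q < 4" "p \<noteq> q" for p q
    using t that by (auto simp: common_edges_def oriented_edges_def)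
  have be: "b (t, p, q) = b' (t, p, q)" and ze: "z (t, p, q) = z' (t, p, q)"
    if "p < 4" "q < 4" "p \<noteq> q" for p q
    using agreeD[OF bb c[OF that]] agreeD[OF zz c[OF that]] by simp_all
  obtain v where v: "orders b t v" using b t by (auto simp: is_branching_def)
  note vl = orders_less_4[OF v] and vi = orders_inj[OF v]
  have "b (t, v i, v j) = b' (t, v i, v j)" if "i < 4" "j < 4" "i \<noteq> j" for i j
    using be vl vi that by simp
  then have v': "orders b' t v" using v by (simp add: orders_def)
  have "ideal_point b z t = ideal_point b' z' t"
    using vl vi by (simp add: fun_eq_iff ideal_point_def Let_def vertex_order_eq[OF v] vertex_order_eq[OF v'] ze)
  then have "modulus_w b z t = modulus_w b' z' t"
    by (simp add: fun_eq_iff modulus_w_def modulus_p_def)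
  moreover have "basic_edge b t = basic_edge b' t"
    by (simp add: fun_eq_iff basic_edge_def vertex_order_eq[OF v] vertex_order_eq[OF v'])
  moreover have "(t, e) \<in> abs_edges T \<longleftrightarrow> (t, e) \<in> abs_edges T'" using t by (auto simp: abs_edges_def)
  ultimately show ?thesis by (simp add: moduli_of_def)
qed

lemma abs_edgesI: "(t, a, b) \<in> oriented_edges T \<Longrightarrow> (t, {a, b}) \<in> abs_edges T"
  unfolding abs_edges_def oriented_edges_def by blast

lemma (in bipyramid) bipyramid_vertex_vert_inj:
  assumes qr: "quasi_regular T'" and pq: "p \<le> 4" "q \<le> 4" "p \<noteq> q"
  shows "bipyramid_vertex (vert T') p \<noteq> bipyramid_vertex (vert T') q"
proof -
  let ?n = "new_tet p q"
  note n = new_tet[where p = p and q = q]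
  have "(\<tau> ?n, \<kappa> ?n p, \<kappa> ?n q) \<in> oriented_edges T'"
    by (rule tet_edge) (use n(2-4) pq tau_new(1)[OF n(1)] in auto)
  then have "vert T' (\<tau> ?n, \<kappa> ?n p) \<noteq> vert T' (\<tau> ?n, \<kappa> ?n q)"
    using qr unfolding quasi_regular_def by fast
  then show ?thesis
    using bipyramid_vertex[OF vertex_function_vert[OF T'] n(1) pq(1) n(2)]
      bipyramid_vertex[OF vertex_function_vert[OF T'] n(1) pq(2) n(3)] by simp
qed

text \<open>The edge from the apex \<open>1 - m\<close> to the vertex 2 lies, inside the bipyramid, only in
  \<open>\<tau> m\<close>, because the five vertices of the bipyramid are distinct.\<close>

lemma (in bipyramid) apical_edge:
  assumes qr: "quasi_regular T'" and m: "m \<in> {0, 1}"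
  shows "edge T (\<tau> m, {\<kappa> m (1 - m), \<kappa> m 2}) - {(\<tau> m, {\<kappa> m (1 - m), \<kappa> m 2})} \<subseteq> unchanged_edges T T'"
proof
  let ?x = "(\<tau> m, {\<kappa> m (1 - m), \<kappa> m 2})"
  define F where "F = restrict_vertices (vert T')"
  have F: "vertex_function T F"
    unfolding F_def by (rule vertex_function_restrict_vertices[OF vertex_function_vert[OF T']])
  have m4: "m \<le> 4" "1 - m \<le> 4" "1 - m \<noteq> m" "2 \<noteq> m" using m by auto
  have x: "?x \<in> abs_edges T"
    by (rule abs_edgesI, rule tet_edge) (use m4 tau_old(1)[OF m] in auto)
  fix y assume y: "y \<in> edge T ?x - {?x}"
  obtain t e where y': "y = (t, e)" by (cases y)
  have ye: "(t, e) \<in> abs_edges T" using edge_subset[OF T x] y y' by blast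
  have img: "(\<lambda>a. F (t, a)) ` e = (\<lambda>a. F (\<tau> m, a)) ` {\<kappa> m (1 - m), \<kappa> m 2}"
    using edge_endpoints[OF T F] y y' by blast
  show "y \<in> unchanged_edges T T'"
  proof (cases "t \<in> {\<tau> 0, \<tau> 1}")
    case False
    then show ?thesis using ye tets_unchanged unfolding y' unchanged_edges_def abs_edges_def by auto
  next
    case True
    then obtain m' where m': "m' \<in> {0, 1}" "t = \<tau> m'" by blast
    then have m'4: "m' \<le> 4" by auto
    obtain a b where ab: "e = {a, b}" "a < 4" "b < 4" "a \<noteq> b" using ye by (auto simp: abs_edges_def)
    obtain p where p: "p \<le> 4" "p \<noteq> m'" "\<kappa> m' p = a" using kappa_surj[OF m'4 ab(2)] by blast
    obtain q where q: "q \<le> 4" "q \<noteq> m'" "\<kappa> m' q = b" using kappa_surj[OF m'4 ab(3)] by blast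
    let ?G = "bipyramid_vertex (vert T')"
    have old: "F (\<tau> n, \<kappa> n s) = ?G s" if "n \<in> {0, 1}" "s \<le> 4" "s \<noteq> n" for n s
      unfolding F_def by (rule restrict_vertices_old[OF that])
    have "{?G p, ?G q} = {?G (1 - m), ?G 2}"
      using img old[OF m'(1) p(1,2)] old[OF m'(1) q(1,2)] old[OF m m4(2,3)] old[OF m _ m4(4)]
      by (simp add: ab(1) m'(2) p(3) q(3))
    then have "(p = 1 - m \<and> q = 2) \<or> (p = 2 \<and> q = 1 - m)"
      using bipyramid_vertex_vert_inj[OF qr] p(1) q(1) m4
      by (metis doubleton_eq_iff numeral_le_iff semiring_norm(68) semiring_norm(71))
    moreover from this have "m' = m" using m m' p q by auto
    ultimately have "y = ?x" using y' m'(2) ab(1) p(3) q(3) by auto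
    then show ?thesis using y by blast
  qed
qed

lemma powi_sign_inject:
  fixes x y :: complex
  assumes "s = 1 \<or> s = - 1" "x powi s = y powi s"
  shows "x = y"
  using assms by (auto simp: power_int_minus)

text \<open>The product of the moduli is 1 at the edge of \<open>apical_edge\<close>, and all its factors but one are
  known.\<close>

lemma moduli_determined_by_unchanged:
  fixes T T' :: "('t, 'w) triangulation"
  assumes tr: "positive_branching_transit W \<omega> m T b T' b'"
    and D: "D_triangulation W \<omega> \<rho> (T, b, z1)" "D_triangulation W \<omega> \<rho> (T, b, z2)"
    and eq: "\<And>a. a \<in> unchanged_edges T T' \<Longrightarrow> moduli_of T b z1 a = moduli_of T b z2 a"
  shows "moduli_of T b z1 = moduli_of T b z2"
proof
  fix x :: "'t aedge"
  have tT: "triangulates T W \<omega>" and br: "is_branching T b"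
    and tT': "triangulates T' W \<omega>" and qr: "quasi_regular T'"
    and m: "positive_move m T T'"
    using tr by (simp_all add: positive_branching_transit_def)
  have gl: "gluing T" "gluing T'" using tT tT' by (simp_all add: triangulates_def)
  have z: "cocycle T z1" "cocycle T z2"
    and id: "\<And>t. t \<in> tets T \<Longrightarrow> idealizable b z1 t" "\<And>t. t \<in> tets T \<Longrightarrow> idealizable b z2 t"
    using D by (simp_all add: D_triangulation_def)
  obtain t e where x: "x = (t, e)" by (cases x)
  consider "x \<notin> abs_edges T" | "x \<in> unchanged_edges T T'" | "x \<in> abs_edges T" "t \<notin> tets T'"
    unfolding unchanged_edges_def x abs_edges_def by auto
  then show "moduli_of T b z1 x = moduli_of T b z2 x"
  proof cases
    case 1 then show ?thesis by (simp add: x moduli_of_def)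
  next
    case 2 then show ?thesis by (rule eq)
  next
    case 3
    have t: "t \<in> tets T" using 3(1) x by (auto simp: abs_edges_def)
    then have "\<exists>\<tau> \<kappa>. m = Move23 \<tau> \<kappa>" using move_tets_mono(1)[OF m] 3(2) by blast
    then obtain \<tau> \<kappa> where m': "m = Move23 \<tau> \<kappa>" by blast
    interpret bipyramid \<tau> \<kappa> T T' by unfold_locales (use m m' gl in simp_all)
    obtain n where n: "n \<in> {0, 1}" "t = \<tau> n" using t 3(2) tets_unchanged by blast
    define y where "y = (\<tau> n, {\<kappa> n (1 - n), \<kappa> n 2})"
    have "n \<le> 4" "1 - n \<noteq> n" "2 \<noteq> n" using n(1) by auto
    then have yE: "y \<in> abs_edges T"
      unfolding y_def by (intro abs_edgesI tet_edge) (use tau_old(1)[OF n(1)] in auto)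
    define E where "E = edge T y"
    have E: "finite E" "y \<in> E" "E - {y} \<subseteq> unchanged_edges T T'"
      using finite_subset[OF edge_subset[OF gl(1) yE] finite_abs_edges[OF gl(1)]] edge_refl
        apical_edge[OF qr n(1)] by (auto simp: E_def y_def)
    let ?w = "\<lambda>z a. moduli_of T b z a powi index b (fst a)"
    have 1: "?w z1 y * (\<Prod>a\<in>E - {y}. ?w z1 a) = 1" "?w z2 y * (\<Prod>a\<in>E - {y}. ?w z2 a) = 1"
      using edge_product_eq_1[OF gl(1) br z(1) id(1) yE] edge_product_eq_1[OF gl(1) br z(2) id(2) yE]
      unfolding edge_product_def E_def[symmetric] prod.remove[OF E(1,2)] by blast+
    define R where "R = (\<Prod>a\<in>E - {y}. ?w z2 a)"
    have "(\<Prod>a\<in>E - {y}. ?w z1 a) = R"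
      unfolding R_def by (rule prod.cong) (use E(3) eq in auto)
    with 1 have R: "?w z1 y * R = 1" "?w z2 y * R = 1" by (simp_all add: R_def)
    then have "R \<noteq> 0" by auto
    moreover have "?w z1 y * R = ?w z2 y * R" unfolding R ..
    ultimately have "?w z1 y = ?w z2 y" by simp
    moreover have "index b (fst y) = 1 \<or> index b (fst y) = - 1" by (simp add: index_def sign_def)
    ultimately have w: "moduli_of T b z1 y = moduli_of T b z2 y" using powi_sign_inject by blast
    obtain v where v: "orders b t v" using br t by (auto simp: is_branching_def)
    show ?thesis
      using moduli_of_determined[OF z t v id(1)[OF t] id(2)[OF t] _ _ 3(1)[unfolded x]] yE w
      unfolding x y_def n(2) by blast
  qed
qed

section \<open>Transits\<close>

lemma D_triangulation_edge_product:
  assumes "D_triangulation W \<omega> \<rho> (T, b, z)" "a \<in> abs_edges T"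
  shows "edge_product b (moduli_of T b z) (edge T a) = 1"
  using assms by (intro edge_product_eq_1) (auto simp: D_triangulation_def triangulates_def)

lemma positive_D_transit_idealization:
  assumes d: "positive_D_transit W \<omega> \<rho> m D D'"
  shows "I_transit_data W \<omega> \<rho> m (idealization D) (idealization D')"
    "moduli_condition m (idealization D) (idealization D')"
proof -
  obtain T b z where D: "D = (T, b, z)" by (cases D)
  obtain T' b' z' where D': "D' = (T', b', z')" by (cases D')
  have DT: "D_triangulation W \<omega> \<rho> (T, b, z)" "D_triangulation W \<omega> \<rho> (T', b', z')"
    and tr: "positive_branching_transit W \<omega> m T b T' b'" and zz: "agree m T T' z z'"
    using d by (simp_all add: positive_D_transit_def D D')
  have br: "is_branching T b" "agree m T T' b b'" and mv: "positive_move m T T'"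
    and gl: "gluing T" "gluing T'"
    using tr by (simp_all add: positive_branching_transit_def triangulates_def)
  have "moduli_of T b z a = moduli_of T' b' z' a" if "a \<in> unchanged_edges T T'" for a
    using moduli_of_unchanged[OF _ _ br zz] that by (cases a) (auto simp: unchanged_edges_def)
  then show "I_transit_data W \<omega> \<rho> m (idealization D) (idealization D')"
    using DT tr by (auto simp: I_transit_data_def I_triangulation_def idealization_def D D')
  note one = D_triangulation_edge_product[OF DT(1)] and one' = D_triangulation_edge_product[OF DT(2)]
  show "moduli_condition m (idealization D) (idealization D')"
  proof (cases m)
    case (Move23 \<tau> \<kappa>)
    interpret bipyramid \<tau> \<kappa> T T' by unfold_locales (use mv Move23 gl in simp_all)
    have "edge_product b (moduli_of T b z) (edge T (t, {i, j})) =
        edge_product b' (moduli_of T' b' z') (edge T' (t', {i', j'}))"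
      if e: "((t, i, j), (t', i', j')) \<in> boundary_edges (Move23 \<tau> \<kappa>)" for t i j t' i' j'
    proof -
      have "(t, {i, j}) \<in> abs_edges T" "(t', {i', j'}) \<in> abs_edges T'"
        using boundary_edges_oriented[OF e] by (simp_all add: abs_edgesI)
      then show ?thesis using one one' by simp
    qed
    then show ?thesis
      unfolding Move23 idealization_def D D' prod.case moduli_condition.simps by blast
  next
    case Move02
    then show ?thesis using one' by (simp add: idealization_def D D' changed_edges_def)
  next
    case Bubble
    then show ?thesis using one' by (simp add: idealization_def D D' changed_edges_def)
  qed
qed

text \<open>The cocycle on the smaller triangulation is the restriction of one on the larger triangulation, for
  transits in both directions.\<close>

lemma I_transit_data_lift:
  assumes fl: "flat_psl2_bundle W \<rho>" and i: "I_transit_data W \<omega> \<rho> m J J'"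
  obtains D D' where "positive_D_transit W \<omega> \<rho> m D D'" "idealization D = J" "idealization D' = J'"
proof -
  obtain T b w where J: "J = (T, b, w)" by (cases J)
  obtain T' b' w' where J': "J' = (T', b', w')" by (cases J')
  have I: "I_triangulation W \<omega> \<rho> (T, b, w)" "I_triangulation W \<omega> \<rho> (T', b', w')"
    and tr: "positive_branching_transit W \<omega> m T b T' b'"
    and ww: "\<And>a. a \<in> unchanged_edges T T' \<Longrightarrow> w a = w' a"
    using i by (simp_all add: I_transit_data_def J J')
  obtain z0 where z0: "D_triangulation W \<omega> \<rho> (T, b, z0)" "w = moduli_of T b z0"
    using I(1) by (auto simp: I_triangulation_def idealization_def)
  obtain z1 where z1: "D_triangulation W \<omega> \<rho> (T', b', z1)" "w' = moduli_of T' b' z1"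
    using I(2) by (auto simp: I_triangulation_def idealization_def)
  obtain z' where z': "D_triangulation W \<omega> \<rho> (T', b', z')" "moduli_of T' b' z' = moduli_of T' b' z1"
    "\<And>e. e \<in> oriented_edges T' \<Longrightarrow> moebius (z' e) (Aff 0) \<notin> {Aff 0, Infty}"
    by (rule D_triangulation_generic[OF fl z1(1)]) (rule that)
  obtain z where z: "D_triangulation W \<omega> \<rho> (T, b, z)" "agree m T T' z z'"
    using restrict_D_triangulation[OF fl tr z'(1,3)] .
  have br: "is_branching T b" "agree m T T' b b'"
    using tr by (simp_all add: positive_branching_transit_def)
  have "moduli_of T b z a = moduli_of T b z0 a" if a: "a \<in> unchanged_edges T T'" for a
  proof -
    have "moduli_of T b z a = moduli_of T' b' z' a"
      using moduli_of_unchanged[OF _ _ br z(2)] a by (cases a) (auto simp: unchanged_edges_def)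
    then show ?thesis using ww[OF a] z'(2) z0(2) z1(2) by simp
  qed
  then have "moduli_of T b z = moduli_of T b z0"
    by (rule moduli_determined_by_unchanged[OF tr z(1) z0(1)])
  then have "idealization (T, b, z) = J" "idealization (T', b', z') = J'"
    using z0(2) z1(2) z'(2) by (simp_all add: idealization_def J J')
  moreover have "positive_D_transit W \<omega> \<rho> m (T, b, z) (T', b', z')"
    using z z'(1) tr by (simp add: positive_D_transit_def)
  ultimately show ?thesis using that by blast
qed

theorem proposition2p16:
  fixes W :: "'w topology" and \<omega> :: "'w orientation" and \<rho> :: "('w, 'p) psl2_bundle"
  assumes "closed_3_manifold W" and "orientation_of W \<omega>" and "flat_psl2_bundle W \<rho>"
  shows "(\<forall>d \<in> (D_transits W \<omega> \<rho> :: ('t, ('t, 'w) dtri) transit set).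
            \<exists>i \<in> I_transits W \<omega> \<rho>. covers i d) \<and>
         (\<forall>i \<in> (I_transits W \<omega> \<rho> :: ('t, ('t, 'w) itri) transit set).
            \<exists>d \<in> D_transits W \<omega> \<rho>. covers i d)"
proof (intro conjI ballI)
  fix d :: "('t, ('t, 'w) dtri) transit" assume d: "d \<in> D_transits W \<omega> \<rho>"
  obtain m dir where s: "support d = (m, dir)" by (cases "support d")
  define i where "i = \<lparr>support = support d, source = idealization (source d), target = idealization (target d)\<rparr>"
  have "i \<in> I_transits W \<omega> \<rho>"
  proof (cases dir)
    case Positive
    then have "positive_D_transit W \<omega> \<rho> m (source d) (target d)"
      using d s by (simp add: D_transits_def)
    from positive_D_transit_idealization[OF this] show ?thesis
      using s Positive by (simp add: I_transits_def i_def positive_I_transit_def)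
  next
    case Negative
    then have "positive_D_transit W \<omega> \<rho> m (target d) (source d)"
      using d s by (simp add: D_transits_def)
    from positive_D_transit_idealization[OF this] show ?thesis
      using s Negative by (cases m) (simp_all add: I_transits_def i_def negative_I_transit_def)
  qed
  moreover have "covers i d" by (simp add: covers_def i_def)
  ultimately show "\<exists>i\<in>I_transits W \<omega> \<rho>. covers i d" by blast
next
  fix i :: "('t, ('t, 'w) itri) transit" assume i: "i \<in> I_transits W \<omega> \<rho>"
  obtain m dir where s: "support i = (m, dir)" by (cases "support i")
  show "\<exists>d\<in>D_transits W \<omega> \<rho>. covers i d"
  proof (cases dir)
    case Positive
    then have "I_transit_data W \<omega> \<rho> m (source i) (target i)"
      using i s by (simp add: I_transits_def positive_I_transit_def)
    then obtain D D' where D: "positive_D_transit W \<omega> \<rho> m D D'" "idealization D = source i"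
      "idealization D' = target i"
      using I_transit_data_lift[OF assms(3)] by blast
    show ?thesis
      by (rule bexI[of _ "\<lparr>support = support i, source = D, target = D'\<rparr>"])
        (use D s Positive in \<open>simp_all add: covers_def D_transits_def\<close>)
  next
    case Negative
    then have "I_transit_data W \<omega> \<rho> m (target i) (source i)"
      using i s by (simp add: I_transits_def negative_I_transit_def)
    then obtain D D' where D: "positive_D_transit W \<omega> \<rho> m D D'" "idealization D = target i"
      "idealization D' = source i"
      using I_transit_data_lift[OF assms(3)] by blast
    show ?thesis
      by (rule bexI[of _ "\<lparr>support = support i, source = D', target = D\<rparr>"])
        (use D s Negative in \<open>simp_all add: covers_def D_transits_def\<close>)
  qed
qed

end
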